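(* Let $T^{r}$ be a rooted tree with $n$ leaves, with $n_v$ nodes and $n_e$ edges, whose leaves represent binary random variables $X_1,\ldots,X_n$, and assume that the joint distribution of $(X_1,\ldots,X_n)$ lies in the general Markov model $\mathcal{M}_T$. Let $X^{(N)}$ be $N$ independent realizations of this vector and let $\hat p^{(N)}$ be the corresponding sample proportions. Assume (A1) the prior density $\varphi:\Theta_T\to\mathbb{R}$ is strictly positive, bounded and smooth on $\Theta_T$; and (A2) there exists $N_0$ such that $\hat p^{(N)}=\hat p\in\mathcal{M}_T$ for all $N>N_0$, and $\hat p$ has positive entries. If there are no degenerate nodes, then as $N\to\infty$ $$\log Z(N)=\hat\ell_N-\frac{n_v+n_e-2l_2}{2}\log N+O(1),$$ where $Z(N)$ is the marginal likelihood and $\hat\ell_N$ is the maximum log-likelihood value.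
   Context: Model. $T=(V,E)$ is a tree rooted at $r\in V$ (all edges directed away from $r$), $n_v=|V|$, $n_e=|E|$; the set of leaves is identified with $[n]=\{1,\ldots,n\}$; other nodes are inner nodes. $\mathrm{pa}(v)$ denotes the parent of $v$. All random variables $Y_v$, $v\in V$, are binary with values in $\{0,1\}$. The free parameters are $\theta^{(r)}_1=P(Y_r=1)$ and $\theta^{(v)}_{1|i}=P(Y_v=1\mid Y_{\mathrm{pa}(v)}=i)$ for $v\in V\setminus\{r\}$, $i=0,1$ (with $\theta^{(r)}_0=1-\theta^{(r)}_1$, $\theta^{(v)}_{0|i}=1-\theta^{(v)}_{1|i}$), so the parameter space is $\Theta_T=[0,1]^{2n_e+1}$. The general Markov model $\mathcal{M}_T$ (all inner nodes hidden) is the image of the map $p:\Theta_T\to\Delta_{2^n-1}$ into the probability simplex, $$p_\alpha(\theta)=\sum_{\beta}\theta^{(r)}_{\beta_r}\prod_{v\in V\setminus\{r\}}\theta^{(v)}_{\beta_v|\beta_{\mathrm{pa}(v)}},\qquad \alpha\in\{0,1\}^{n},$$ where the sum is over all $\beta\in\{0,1\}^V$ whose restriction to the leaves equals $\alpha$. Marginal likelihood. $Z(N)=\int_{\Theta_T}L(\theta;X^{(N)})\varphi(\theta)\,d\theta$, where $L(\theta;X^{(N)})=\prod_\alpha p_\alpha(\theta)^{N_\alpha}$ is the observed likelihood, $N_\alpha$ are the sample counts, and $\hat p^{(N)}_\alpha=N_\alpha/N$. $\hat\ell_N$ is the maximum over $\Theta_T$ of $\log L(\theta;X^{(N)})$.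 Combinatorial quantities. $\widehat\Sigma=[\hat\mu_{ij}]$ is the sample covariance matrix, i.e. the covariance matrix of the leaf variables under $\hat p$. Nodes $u,w$ of $T$ are separated by a node $v$ if $v$ lies on the unique path between $u$ and $w$; a triple of leaves is separated by $v$ if every two of them are. A degenerate node is an inner node $v$ such that $\hat\mu_{ij}=0$ for any two leaves $i,j$ separated by $v$; all other nodes are nondegenerate. $l_2$ is the number of inner nodes $v$ such that for each triple $i,j,k$ of leaves separated in $T$ by $v$ one has $\hat\mu_{ij}\hat\mu_{ik}\hat\mu_{jk}=0$, but there exist leaves $i,j$ separated by $v$ with $\hat\mu_{ij}\neq0$.
   Formalization: Added assumption: some θ with p(θ)=p̂ has all transition probabilities in (0,1) on edges at the nodes counted by l_2 (the formula fails otherwise, e.g. when a path through such a node is deterministic). Counts may be real, since A2 cannot hold with integer counts. *)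

theory Defs
  imports "HOL-Analysis.Analysis" "HOL-Library.Landau_Symbols"
begin

section \<open>Rooted trees\<close>

text \<open>A finite tree on the node set \<open>V\<close> with root \<open>r\<close>, given by its set \<open>E\<close> of edges
  (parent, child), all directed away from the root. (\<open>Graph_Theory\<close>'s \<open>tree\<close> only
  forbids directed cycles, so it is not the notion needed here.)\<close>

definition rooted_tree :: "'v set \<Rightarrow> ('v \<times> 'v) set \<Rightarrow> 'v \<Rightarrow> bool" where
  "rooted_tree V E r \<longleftrightarrow>
     finite V \<and> r \<in> V \<and> E \<subseteq> V \<times> V \<and>
     (\<forall>u. (u, r) \<notin> E) \<and>
     (\<forall>v \<in> V - {r}. \<exists>!u. (u, v) \<in> E) \<and>
     (\<forall>v \<in> V. (r, v) \<in> E\<^sup>*)"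

definition parent :: "('v \<times> 'v) set \<Rightarrow> 'v \<Rightarrow> 'v" where
  "parent E v = (THE u. (u, v) \<in> E)"

definition adjacent :: "('v \<times> 'v) set \<Rightarrow> 'v \<Rightarrow> 'v \<Rightarrow> bool" where
  "adjacent E u v \<longleftrightarrow> (u, v) \<in> E \<or> (v, u) \<in> E"

text \<open>A leaf is a node of degree at most one in the undirected tree. So a root with a single
  child is a leaf, and so is the only node of a one-node tree.\<close>

definition leaves :: "'v set \<Rightarrow> ('v \<times> 'v) set \<Rightarrow> 'v set" where
  "leaves V E = {v \<in> V. card {u. adjacent E v u} \<le> 1}"

definition inner_nodes :: "'v set \<Rightarrow> ('v \<times> 'v) set \<Rightarrow> 'v set" where
  "inner_nodes V E = V - leaves V E"

definition tree_path :: "('v \<times> 'v) set \<Rightarrow> 'v \<Rightarrow> 'v list \<Rightarrow> 'v \<Rightarrow> bool" where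
  "tree_path E u xs w \<longleftrightarrow>
     xs \<noteq> [] \<and> hd xs = u \<and> last xs = w \<and> distinct xs \<and> successively (adjacent E) xs"

text \<open>In a tree the path is unique. If \<open>v\<close> is inner, it separates no leaf from itself, so pairs
  and triples of leaves separated by \<open>v\<close> automatically consist of distinct leaves.\<close>

definition separates :: "('v \<times> 'v) set \<Rightarrow> 'v \<Rightarrow> 'v \<Rightarrow> 'v \<Rightarrow> bool" where
  "separates E v u w \<longleftrightarrow> (\<exists>xs. tree_path E u xs w \<and> v \<in> set xs)"


section \<open>The general Markov model\<close>

text \<open>\<open>RootParam\<close> names \<open>\<theta>\<^sup>(\<^sup>r\<^sup>)\<^sub>1\<close> and \<open>EdgeParam v i\<close> names \<open>\<theta>\<^sup>(\<^sup>v\<^sup>)\<^sub>1\<^sub>|\<^sub>i\<close>. A parameter vector is an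
  element of \<open>real ^ 'k\<close> whose coordinates are labelled by a bijection \<open>coord\<close> from
  \<open>param_index V r\<close> onto \<open>'k\<close>; in particular \<open>CARD('k) = 2 * n\<^sub>e + 1\<close>.\<close>

datatype 'v param = RootParam | EdgeParam 'v nat

definition param_index :: "'v set \<Rightarrow> 'v \<Rightarrow> 'v param set" where
  "param_index V r = insert RootParam {EdgeParam v i | v i. v \<in> V - {r} \<and> i \<in> {0, 1}}"

definition param_space :: "(real ^ 'k::finite) set" where
  "param_space = {\<theta>. \<forall>k. 0 \<le> \<theta> $ k \<and> \<theta> $ k \<le> 1}"

definition root_prob :: "('v param \<Rightarrow> 'k::finite) \<Rightarrow> real ^ 'k \<Rightarrow> nat \<Rightarrow> real" where
  "root_prob coord \<theta> b = (if b = 1 then \<theta> $ coord RootParam else 1 - \<theta> $ coord RootParam)"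

definition edge_prob :: "('v param \<Rightarrow> 'k::finite) \<Rightarrow> real ^ 'k \<Rightarrow> 'v \<Rightarrow> nat \<Rightarrow> nat \<Rightarrow> real" where
  "edge_prob coord \<theta> v b i =
     (if b = 1 then \<theta> $ coord (EdgeParam v i) else 1 - \<theta> $ coord (EdgeParam v i))"

definition binary_states :: "'v set \<Rightarrow> ('v \<Rightarrow> nat) set" where
  "binary_states A = A \<rightarrow>\<^sub>E {0, 1}"

abbreviation leaf_states :: "'v set \<Rightarrow> ('v \<times> 'v) set \<Rightarrow> ('v \<Rightarrow> nat) set" where
  "leaf_states V E \<equiv> binary_states (leaves V E)"

definition tree_map ::
  "'v set \<Rightarrow> ('v \<times> 'v) set \<Rightarrow> 'v \<Rightarrow> ('v param \<Rightarrow> 'k::finite) \<Rightarrow> real ^ 'k \<Rightarrow> ('v \<Rightarrow> nat) \<Rightarrow> real" where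
  "tree_map V E r coord \<theta> =
     (\<lambda>\<alpha> \<in> leaf_states V E.
        \<Sum>\<beta> \<in> {\<beta> \<in> binary_states V. restrict \<beta> (leaves V E) = \<alpha>}.
          root_prob coord \<theta> (\<beta> r) *
          (\<Prod>v \<in> V - {r}. edge_prob coord \<theta> v (\<beta> v) (\<beta> (parent E v))))"

definition markov_model ::
  "'v set \<Rightarrow> ('v \<times> 'v) set \<Rightarrow> 'v \<Rightarrow> ('v param \<Rightarrow> 'k::finite) \<Rightarrow> (('v \<Rightarrow> nat) \<Rightarrow> real) set" where
  "markov_model V E r coord = tree_map V E r coord ` param_space"


section \<open>Data and marginal likelihood\<close>

text \<open>The data of sample size \<open>N\<close> enter only through the counts \<open>c N \<alpha>\<close> of the leaf states. The
  counts are allowed to be real: with integer counts, sample proportions that are positive and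
  constant for all large \<open>N\<close> do not exist (\<open>N * p\<close> and \<open>(N + 1) * p\<close> would both have to be
  integers), so the stability assumption on the proportions is understood as an idealization.\<close>

definition is_counts :: "'a set \<Rightarrow> nat \<Rightarrow> ('a \<Rightarrow> real) \<Rightarrow> bool" where
  "is_counts A N c \<longleftrightarrow> (\<forall>\<alpha> \<in> A. 0 \<le> c \<alpha>) \<and> (\<Sum>\<alpha> \<in> A. c \<alpha>) = real N"

definition sample_proportions :: "'a set \<Rightarrow> nat \<Rightarrow> ('a \<Rightarrow> real) \<Rightarrow> 'a \<Rightarrow> real" where
  "sample_proportions A N c = (\<lambda>\<alpha> \<in> A. c \<alpha> / real N)"

text \<open>The case distinction is needed because \<open>0 powr 0 = 0\<close>.\<close>

definition likelihood :: "'a set \<Rightarrow> ('t \<Rightarrow> 'a \<Rightarrow> real) \<Rightarrow> ('a \<Rightarrow> real) \<Rightarrow> 't \<Rightarrow> real" where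
  "likelihood A p c \<theta> = (\<Prod>\<alpha> \<in> A. if c \<alpha> = 0 then 1 else p \<theta> \<alpha> powr c \<alpha>)"

definition marginal_likelihood ::
  "'a set \<Rightarrow> (real ^ 'k::finite \<Rightarrow> 'a \<Rightarrow> real) \<Rightarrow> (real ^ 'k \<Rightarrow> real) \<Rightarrow> ('a \<Rightarrow> real) \<Rightarrow> real" where
  "marginal_likelihood A p \<phi> c =
     set_lebesgue_integral lborel param_space (\<lambda>\<theta>. likelihood A p c \<theta> * \<phi> \<theta>)"

text \<open>The maximum over the compact parameter space is written as a supremum. Parameters with
  likelihood zero (log-likelihood minus infinity) are left out since \<open>ln 0 = 0\<close>.\<close>

definition max_log_likelihood ::
  "'a set \<Rightarrow> (real ^ 'k::finite \<Rightarrow> 'a \<Rightarrow> real) \<Rightarrow> ('a \<Rightarrow> real) \<Rightarrow> real" where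
  "max_log_likelihood A p c =
     (SUP \<theta> \<in> {\<theta> \<in> param_space. likelihood A p c \<theta> > 0}. ln (likelihood A p c \<theta>))"


section \<open>Smooth functions\<close>

text \<open>For open \<open>U\<close>: \<open>k\<close> times continuously differentiable on \<open>U\<close>.\<close>

fun Ck_on :: "nat \<Rightarrow> 'a::real_normed_vector set \<Rightarrow> ('a \<Rightarrow> real) \<Rightarrow> bool" where
  "Ck_on 0 U f \<longleftrightarrow> continuous_on U f"
| "Ck_on (Suc k) U f \<longleftrightarrow>
     f differentiable_on U \<and> (\<forall>h. Ck_on k U (\<lambda>x. frechet_derivative f (at x) h))"

definition smooth_near :: "'a::real_normed_vector set \<Rightarrow> ('a \<Rightarrow> real) \<Rightarrow> bool" where
  "smooth_near S f \<longleftrightarrow>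
     (\<exists>U g. open U \<and> S \<subseteq> U \<and> (\<forall>k. Ck_on k U g) \<and> (\<forall>x \<in> S. g x = f x))"


section \<open>Combinatorial quantities\<close>

definition covariance :: "'v set \<Rightarrow> (('v \<Rightarrow> nat) \<Rightarrow> real) \<Rightarrow> 'v \<Rightarrow> 'v \<Rightarrow> real" where
  "covariance L q i j =
     (\<Sum>\<alpha> \<in> binary_states L. q \<alpha> * real (\<alpha> i) * real (\<alpha> j)) -
     (\<Sum>\<alpha> \<in> binary_states L. q \<alpha> * real (\<alpha> i)) * (\<Sum>\<alpha> \<in> binary_states L. q \<alpha> * real (\<alpha> j))"

definition degenerate_node ::
  "'v set \<Rightarrow> ('v \<times> 'v) set \<Rightarrow> (('v \<Rightarrow> nat) \<Rightarrow> real) \<Rightarrow> 'v \<Rightarrow> bool" where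
  "degenerate_node V E q v \<longleftrightarrow>
     v \<in> inner_nodes V E \<and>
     (\<forall>i \<in> leaves V E. \<forall>j \<in> leaves V E.
        separates E v i j \<longrightarrow> covariance (leaves V E) q i j = 0)"

text \<open>The set of nodes whose number is \<open>l\<^sub>2\<close>.\<close>

definition l2_nodes ::
  "'v set \<Rightarrow> ('v \<times> 'v) set \<Rightarrow> (('v \<Rightarrow> nat) \<Rightarrow> real) \<Rightarrow> 'v set" where
  "l2_nodes V E q =
     {v \<in> inner_nodes V E.
        (\<forall>i \<in> leaves V E. \<forall>j \<in> leaves V E. \<forall>k \<in> leaves V E.
           separates E v i j \<and> separates E v i k \<and> separates E v j k \<longrightarrow>
           covariance (leaves V E) q i j * covariance (leaves V E) q i k *
           covariance (leaves V E) q j k = 0) \<and>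
        (\<exists>i \<in> leaves V E. \<exists>j \<in> leaves V E.
           separates E v i j \<and> covariance (leaves V E) q i j \<noteq> 0)}"

text \<open>\<open>q\<close> has a representing parameter for which no transition on an edge at an \<open>l\<^sub>2\<close>-node is
  deterministic. This holds trivially if \<open>l\<^sub>2 = 0\<close>, and whenever \<open>q\<close> is the image of an interior
  point of the parameter space. Each \<open>l\<^sub>2\<close>-node contributes a two-dimensional family to the fibre
  of \<open>q\<close>, and to the exponent of \<open>log N\<close>, only if the condition holds. If, for instance, the
  path u - v - w through such a node carries the identity transition matrix, then both factors
  are the identity or both are the swap, and the fibre shrinks to boundary points.\<close>

definition nondeterministic_at_l2_nodes ::
  "'v set \<Rightarrow> ('v \<times> 'v) set \<Rightarrow> 'v \<Rightarrow> ('v param \<Rightarrow> 'k::finite) \<Rightarrow> (('v \<Rightarrow> nat) \<Rightarrow> real) \<Rightarrow> bool" where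
  "nondeterministic_at_l2_nodes V E r coord q \<longleftrightarrow>
     (\<exists>\<theta> \<in> param_space. tree_map V E r coord \<theta> = q \<and>
        (\<forall>(u, w) \<in> E. u \<in> l2_nodes V E q \<or> w \<in> l2_nodes V E q \<longrightarrow>
           (\<forall>i \<in> {0, 1}. 0 < \<theta> $ coord (EdgeParam w i) \<and> \<theta> $ coord (EdgeParam w i) < 1)))"

end

theory Submission
  imports Defs "HOL-Real_Asymp.Real_Asymp"
begin

text \<open>Since the sample proportions equal \<open>phat\<close>, the likelihood divided by its maximum is
  \<open>exp (- N * KL (phat, p \<theta>))\<close>, which is squeezed between two functions of the form
  \<open>exp (- const * N * |p \<theta> - phat|\<^sup>2)\<close>. So the claim amounts to: the set of \<open>\<theta>\<close> with
  \<open>|p \<theta> - phat| \<le> \<epsilon>\<close> has volume of order \<open>\<epsilon>\<close> to the power \<open>n\<^sub>v + n\<^sub>e - 2 l\<^sub>2\<close>.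

  For the upper bound, all parameters near the fibre of \<open>phat\<close> are Lipschitz functions of \<open>p \<theta>\<close> and of
  two further numbers for each \<open>l\<^sub>2\<close>-node (on finitely many sheets given by signs), so the set is
  covered by about \<open>(1 / \<epsilon>) ^ (2 l\<^sub>2)\<close> cubes of side of order \<open>\<epsilon>\<close>. This uses only second and third
  moments: \<open>cov i j * var v = cov i v * cov j v\<close> if \<open>v\<close> separates \<open>i\<close> and \<open>j\<close>, and a triple of leaves
  separated by \<open>v\<close> with nonzero covariances determines the law of \<open>Y\<^sub>v\<close> up to relabelling.

  For the lower bound, means and edge covariances are coordinates on the parameter space in which
  each \<open>l\<^sub>2\<close>-node, having exactly two live edges, can be moved in an explicit two-parameter family
  without changing \<open>p \<theta>\<close>. Disjoint cubes around an \<open>\<epsilon>\<close>-grid of such points fill the required volume.\<close>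


section \<open>Rooted trees\<close>

text \<open>Points of the fibre of \<open>phat\<close> may lie on the boundary of the cube, where no
  chart of the fibre is at hand; both volume bounds therefore count cubes. In the upper bound the
  obstacle is uniform control of the divisions by moments of hidden variables. A non-degenerate
  inner node \<open>v\<close> separates two leaves \<open>i\<close>, \<open>j\<close> of nonzero
  covariance, and the absolute value of \<open>cov i j\<close> is at most those of
  \<open>cov i v\<close> and \<open>cov j v\<close> and at most \<open>var v\<close>
  (\<open>cov_lower\<close>). So lower bounds seen in the leaf distribution pass to the hidden
  nodes. In the lower bound the obstacle is to remain inside the cube: the family moves only
  transition probabilities on edges at \<open>l2\<close> nodes, which \<open>boundary\<close> places
  strictly between 0 and 1, and possibly the root probability, which is neither 0 nor 1 because
  every node has positive variance. To integrate, the cube is cut into shells of width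
  \<open>1 / sqrt N\<close> by the largest deviation of a leaf probability from \<open>phat\<close>;
  the Gaussian factor in the shell number outweighs the polynomial growth of the volumes, and the
  innermost shell alone gives the lower bound.\<close>

locale rtree =
  fixes V :: "'v set" and E :: "('v \<times> 'v) set" and r :: 'v
  assumes rooted: "rooted_tree V E r"
begin

lemma finite_V: "finite V" and r_in_V: "r \<in> V" and E_sub: "E \<subseteq> V \<times> V"
  and no_edge_to_root: "(u, r) \<notin> E" and root_reaches: "v \<in> V \<Longrightarrow> (r, v) \<in> E\<^sup>*"
  using rooted by (auto simp: rooted_tree_def)

lemma finite_E: "finite E"
  using finite_V E_sub by (meson finite_SigmaI finite_subset)

lemma parent_unique: "(u, v) \<in> E \<Longrightarrow> (u', v) \<in> E \<Longrightarrow> u = u'"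
  using rooted no_edge_to_root E_sub unfolding rooted_tree_def by (metis DiffI mem_Sigma_iff singletonD subsetD)

lemma parent_eq: "(u, v) \<in> E \<Longrightarrow> parent E v = u"
  unfolding parent_def using parent_unique by blast

lemma parent_edge: "v \<in> V - {r} \<Longrightarrow> (parent E v, v) \<in> E"
  using rooted parent_eq unfolding rooted_tree_def by metis

lemma edge_in_V: "(u, v) \<in> E \<Longrightarrow> u \<in> V" "(u, v) \<in> E \<Longrightarrow> v \<in> V"
  using E_sub by auto

lemma edge_target: "(u, v) \<in> E \<Longrightarrow> v \<in> V - {r}"
  using edge_in_V no_edge_to_root by auto

lemma parent_in_V: "v \<in> V - {r} \<Longrightarrow> parent E v \<in> V"
  using parent_edge edge_in_V by blast

lemma edge_iff: "(u, v) \<in> E \<longleftrightarrow> v \<in> V - {r} \<and> parent E v = u"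
  using parent_eq parent_edge edge_target by metis

text \<open>A cycle through a node enters it by its only incoming edge and so passes through its
  parent. Going up to the root, this would produce an edge into \<open>r\<close>.\<close>

lemma acyclic_E: "acyclic E"
proof (rule acyclicI, rule allI)
  fix v
  have "(v, v) \<notin> E\<^sup>+" if "(r, v) \<in> E\<^sup>*"
    using that
  proof (induction rule: rtrancl_induct)
    case base
    show ?case using no_edge_to_root by (metis tranclD2)
  next
    case (step u w)
    show ?case
    proof
      assume "(w, w) \<in> E\<^sup>+"
      then obtain u' where "(w, u') \<in> E\<^sup>*" "(u', w) \<in> E" by (metis tranclD2)
      then have "(w, u) \<in> E\<^sup>*" using parent_unique step.hyps(2) by blast
      then have "(u, u) \<in> E\<^sup>+" using step.hyps(2) by (meson rtrancl_into_trancl2)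
      then show False using step.IH by blast
    qed
  qed
  moreover have "v \<in> V" if "(v, v) \<in> E\<^sup>+"
    using that edge_in_V by (metis tranclD)
  ultimately show "(v, v) \<notin> E\<^sup>+" using root_reaches by blast
qed

lemma wf_E: "wf E" and wf_E_converse: "wf (E\<inverse>)"
  using finite_acyclic_wf[OF finite_E acyclic_E] finite_acyclic_wf_converse[OF finite_E acyclic_E] by auto

lemma card_E: "card E + 1 = card V"
proof -
  have "bij_betw snd E (V - {r})"
    unfolding bij_betw_def
    by (auto simp: inj_on_def edge_iff image_iff) (metis edge_iff DiffI insertE empty_iff snd_conv)
  then have "card E = card (V - {r})" by (rule bij_betw_same_card)
  then show ?thesis using card_Suc_Diff1[OF finite_V r_in_V] by simp
qed

section \<open>Descendants of a node\<close>

definition desc :: "'v \<Rightarrow> 'v set" where "desc v = {w. (v, w) \<in> E\<^sup>*}"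

lemma desc_self: "v \<in> desc v" by (simp add: desc_def)

lemma desc_sub: "v \<in> V \<Longrightarrow> desc v \<subseteq> V"
  unfolding desc_def by (auto elim: rtranclE dest: edge_in_V)

lemma desc_root: "desc r = V"
  using desc_sub[OF r_in_V] root_reaches by (auto simp: desc_def)

lemma desc_child: "x \<in> desc v \<Longrightarrow> (x, y) \<in> E \<Longrightarrow> y \<in> desc v"
  by (auto simp: desc_def)

lemma desc_parent: "y \<in> desc v \<Longrightarrow> y \<noteq> v \<Longrightarrow> (x, y) \<in> E \<Longrightarrow> x \<in> desc v"
  unfolding desc_def by (auto elim: rtranclE dest: parent_unique)

lemma parent_notin_desc: "(u, v) \<in> E \<Longrightarrow> u \<notin> desc v"
  using acyclic_E by (auto simp: desc_def acyclic_def dest: rtrancl_into_trancl2)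

lemma not_parent_and_child: "(u, v) \<in> E \<Longrightarrow> (v, u) \<notin> E"
  using parent_notin_desc desc_self desc_child by blast

lemma edge_neq: "(u, v) \<in> E \<Longrightarrow> u \<noteq> v"
  using parent_notin_desc desc_self by blast

section \<open>Neighbours and the components around a node\<close>

abbreviation adj :: "'v \<Rightarrow> 'v \<Rightarrow> bool" where "adj \<equiv> adjacent E"

lemma adj_sym: "adj u v \<longleftrightarrow> adj v u"
  by (auto simp: adjacent_def)

lemma adj_in_V: "adj u v \<Longrightarrow> u \<in> V \<and> v \<in> V"
  by (auto simp: adjacent_def dest: edge_in_V)

text \<open>The component of the neighbour \<open>u\<close> of \<open>v\<close> after removal of \<open>v\<close>.\<close>

definition side :: "'v \<Rightarrow> 'v \<Rightarrow> 'v set" where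
  "side v u = (if (v, u) \<in> E then desc u else V - desc v)"

lemma side_sub: "adj v u \<Longrightarrow> side v u \<subseteq> V"
  using desc_sub adj_in_V by (auto simp: side_def)

lemma side_compl: "adj v u \<Longrightarrow> side u v = V - side v u"
  using desc_sub adj_in_V not_parent_and_child by (auto simp: side_def adjacent_def)

lemma side_self: "adj v u \<Longrightarrow> u \<in> side v u" "adj v u \<Longrightarrow> v \<notin> side v u"
  using desc_self parent_notin_desc edge_in_V by (auto simp: side_def adjacent_def)

text \<open>A set \<open>desc x\<close> can be crossed only by the edge into its top node
  \<open>x\<close>: it is closed under children, and under parents except at the top.\<close>

lemma side_crossing:
  assumes "adj v u" "(a, b) \<in> E" "a \<in> side v u \<longleftrightarrow> b \<notin> side v u"
  shows "{a, b} = {u, v}"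
proof (cases "(v, u) \<in> E")
  case True
  then show ?thesis using assms desc_child desc_parent parent_unique unfolding side_def by (metis doubleton_eq_iff)
next
  case False
  then have "(u, v) \<in> E" using assms by (auto simp: adjacent_def)
  then show ?thesis using False assms desc_child desc_parent parent_unique edge_in_V unfolding side_def
    by (metis DiffD2 DiffI)
qed

text \<open>For two children of \<open>v\<close>, going up from a common descendant would put one of
  them below the other, and then \<open>v\<close> below a child of its own. The component of the
  parent lies outside \<open>desc v\<close> and so misses the subtrees of all children.\<close>

lemma side_disjoint:
  assumes "adj v u" "adj v u'" "u \<noteq> u'"
  shows "side v u \<inter> side v u' = {}"
proof -
  \<comment> \<open>At most one neighbour is the parent, so by symmetry the first may be taken to be
    a child.\<close>
  have *: "side v u \<inter> side v u' = {}" if h: "(v, u) \<in> E" "adj v u'" "u \<noteq> u'" for u u'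
  proof -
    have u': "u' \<notin> side v u"
    proof
      assume "u' \<in> side v u"
      then have a: "u' \<in> desc u" using h by (simp add: side_def)
      show False
      proof (cases "(v, u') \<in> E")
        case True
        then have "v \<in> desc u" using a desc_parent h by blast
        then show False using parent_notin_desc h by blast
      next
        case False
        then have "(u', v) \<in> E" using h by (auto simp: adjacent_def)
        then have "v \<in> desc u" using a desc_child h by blast
        then show False using parent_notin_desc h by blast
      qed
    qed
    show ?thesis
    proof (cases "(v, u') \<in> E")
      case True
      { fix x assume x: "x \<in> desc u" "x \<in> desc u'"
        have "(u', x) \<in> E\<^sup>*" using x by (simp add: desc_def)
        then have "x \<in> desc u \<longrightarrow> u' \<in> desc u \<or> u \<in> desc u'"
        proof (induction rule: rtrancl_induct)
          case base then show ?case by simp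
        next
          case (step y z)
          show ?case
          proof
            assume z: "z \<in> desc u"
            show "u' \<in> desc u \<or> u \<in> desc u'"
            proof (cases "z = u")
              case True
              then show ?thesis using step by (auto simp: desc_def intro: rtrancl_into_rtrancl)
            next
              case False
              then show ?thesis using step z desc_parent by blast
            qed
          qed
        qed
        then have "u \<in> desc u'" using x u' h by (simp add: side_def)
        then have "v \<in> desc u'" using desc_parent h by blast
        then have False using parent_notin_desc True by blast }
      then show ?thesis using h True by (auto simp: side_def)
    next
      case False
      have "desc u \<subseteq> desc v" using h by (auto simp: desc_def)
      then show ?thesis using h False by (auto simp: side_def)
    qed
  qed
  consider "(v, u) \<in> E" | "(v, u') \<in> E" | "(u, v) \<in> E" "(u', v) \<in> E"
    using assms by (auto simp: adjacent_def)
  then show ?thesis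
    using *[of u u'] *[of u' u] assms parent_unique by cases auto
qed

lemma side_exists:
  assumes "v \<in> V" "x \<in> V" "x \<noteq> v"
  obtains u where "adj v u" "x \<in> side v u"
proof (cases "x \<in> desc v")
  case True
  then have "(v, x) \<in> E\<^sup>*" by (simp add: desc_def)
  then obtain u where "(v, u) \<in> E" "(u, x) \<in> E\<^sup>*" using assms by (metis converse_rtranclE)
  then show ?thesis using that[of u] by (auto simp: side_def desc_def adjacent_def)
next
  case False
  then have "v \<noteq> r" using desc_root assms by auto
  then have "(parent E v, v) \<in> E" using parent_edge assms by blast
  then show ?thesis using that[of "parent E v"] False assms not_parent_and_child
    by (auto simp: side_def adjacent_def)
qed

text \<open>Somewhere the walk steps out of \<open>A\<close>, and every such step lands on
  \<open>v\<close>.\<close>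

lemma successively_meets_crossing:
  assumes "successively adj xs" "xs \<noteq> []" "hd xs \<in> A" "last xs \<notin> A"
    and closed: "\<And>x y. adj x y \<Longrightarrow> x \<in> A \<Longrightarrow> y \<notin> A \<Longrightarrow> y = v"
  shows "v \<in> set xs"
  using assms(1-4)
proof (induction xs)
  case Nil then show ?case by simp
next
  case (Cons x xs)
  show ?case
  proof (cases "xs = []")
    case True then show ?thesis using Cons by auto
  next
    case False
    then have a: "adj x (hd xs)" "successively adj xs" using Cons.prems by (auto simp: successively_Cons)
    show ?thesis
    proof (cases "hd xs \<in> A")
      case True then show ?thesis using Cons a False by auto
    next
      case f: False
      then have "hd xs = v" using closed[OF a(1)] Cons.prems by simp
      then show ?thesis using False by (metis hd_in_set list.set_intros(2))
    qed
  qed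
qed

lemma side_adj_closed:
  assumes "adj v u" "adj x y" "x \<in> side v u" "y \<notin> side v u"
  shows "y = v \<and> x = u"
proof -
  have "{x, y} = {u, v}"
    using side_crossing[OF assms(1), of x y] side_crossing[OF assms(1), of y x] assms
    unfolding adjacent_def by blast
  then show ?thesis using side_self assms by (metis doubleton_eq_iff)
qed

lemma tree_path_exists:
  assumes "x \<in> V" "y \<in> V"
  obtains xs where "tree_path E x xs y"
proof -
  have "(x, r) \<in> (E \<union> E\<inverse>)\<^sup>*"
    using root_reaches[OF assms(1)] by (metis in_rtrancl_UnI rtrancl_converseI)
  moreover have "(r, y) \<in> (E \<union> E\<inverse>)\<^sup>*"
    using root_reaches[OF assms(2)] by (metis in_rtrancl_UnI)
  ultimately have "(x, y) \<in> (E \<union> E\<inverse>)\<^sup>*" by (rule rtrancl_trans)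
  then have "\<exists>xs. tree_path E x xs y"
  proof (induction rule: converse_rtrancl_induct)
    case base
    then show ?case by (intro exI[of _ "[y]"]) (auto simp: tree_path_def)
  next
    case (step x z)
    then obtain xs where xs: "tree_path E z xs y" by blast
    show ?case
    proof (cases "x \<in> set xs")
      case True
      \<comment> \<open>The loop at \<open>x\<close> is cut off by keeping only the part of the path
        from \<open>x\<close> on.\<close>
      then obtain ys zs where "xs = ys @ x # zs" by (meson split_list)
      then have "tree_path E x (x # zs) y"
        using xs by (auto simp: tree_path_def successively_append_iff)
      then show ?thesis by blast
    next
      case False
      then have "tree_path E x (x # xs) y"
        using xs step.hyps(1) by (auto simp: tree_path_def successively_Cons adjacent_def)
      then show ?thesis by blast
    qed
  qed
  then show ?thesis using that by blast
qed

lemma separatesI: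
  assumes "adj v u" "x \<in> side v u" "y \<in> V - side v u"
  shows "separates E v x y"
proof -
  obtain xs where xs: "tree_path E x xs y"
    using tree_path_exists[of x y] assms side_sub by blast
  moreover have "v \<in> set xs"
    by (rule successively_meets_crossing[where A = "side v u"])
      (use xs assms side_adj_closed in \<open>auto simp: tree_path_def\<close>)
  ultimately show ?thesis unfolding separates_def by blast
qed

text \<open>The neighbours of \<open>v\<close> before and after it on the path are distinct, and
  neither half of the path can leave the component it is in without meeting \<open>v\<close> a
  second time.\<close>

lemma separatesD:
  assumes "separates E v x y" "x \<noteq> v" "y \<noteq> v"
  obtains u where "adj v u" "x \<in> side v u" "y \<in> V - side v u"
proof -
  obtain xs where xs: "tree_path E x xs y" "v \<in> set xs"
    using assms(1) by (auto simp: separates_def)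
  then obtain ys zs where split: "xs = ys @ v # zs" by (meson split_list)
  have ne: "ys \<noteq> []" "zs \<noteq> []" using xs split assms by (auto simp: tree_path_def)
  define p q where "p = last ys" and "q = hd zs"
  have succ: "successively adj ys" "adj p v" "adj v q" "successively adj zs"
    using xs split ne by (auto simp: tree_path_def successively_append_iff successively_Cons p_def q_def)
  have dist: "distinct xs" using xs by (simp add: tree_path_def)
  then have vn: "v \<notin> set ys" "v \<notin> set zs" and pq: "p \<noteq> q"
    using split ne by (auto simp: p_def q_def disjoint_iff)
      (metis hd_in_set last_in_set)
  have adj: "adj v p" using succ adj_sym by blast
  have "hd ys \<in> side v p"
  proof (rule ccontr)
    assume h: "hd ys \<notin> side v p"
    have "v \<in> set (rev ys)"
      by (rule successively_meets_crossing[where A = "side v p"])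
        (use h ne succ side_self[OF adj] side_adj_closed[OF adj] in
          \<open>auto simp: hd_rev last_rev p_def adj_sym\<close>)
    then show False using vn by simp
  qed
  moreover have "last zs \<in> side v q"
  proof (rule ccontr)
    assume h: "last zs \<notin> side v q"
    have "v \<in> set zs"
      by (rule successively_meets_crossing[where A = "side v q"])
        (use h ne succ side_self side_adj_closed in \<open>auto simp: q_def\<close>)
    then show False using vn by simp
  qed
  moreover have "hd ys = x" "last zs = y" using xs split ne by (auto simp: tree_path_def)
  ultimately show ?thesis
    using that[OF adj] side_disjoint[OF adj succ(3) pq] side_sub[OF succ(3)] by blast
qed

lemma leaves_sub: "leaves V E \<subseteq> V"
  by (auto simp: leaves_def)

lemma inner_iff: "v \<in> inner_nodes V E \<longleftrightarrow> v \<in> V \<and> v \<notin> leaves V E"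
  by (auto simp: inner_nodes_def)

end


section \<open>Sums over binary states\<close>

text \<open>Conditional independence is proved by exchanging the values on \<open>A\<close> between two independent copies.\<close>

lemma sum_exchange:
  fixes W F G :: "('v \<Rightarrow> 'b) \<Rightarrow> real" and A :: "'v set"
  defines "sw \<equiv> \<lambda>\<beta> \<gamma> v. if v \<in> A then \<gamma> v else \<beta> v"
  assumes closed: "\<And>\<beta> \<gamma>. \<beta> \<in> \<Omega> \<Longrightarrow> \<gamma> \<in> \<Omega> \<Longrightarrow> sw \<beta> \<gamma> \<in> \<Omega>"
    and W: "\<And>\<beta> \<gamma>. \<beta> \<in> \<Omega> \<Longrightarrow> \<gamma> \<in> \<Omega> \<Longrightarrow> W (sw \<beta> \<gamma>) * W (sw \<gamma> \<beta>) = W \<beta> * W \<gamma>"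
    and F: "\<And>\<beta> \<gamma>. \<beta> \<in> \<Omega> \<Longrightarrow> \<gamma> \<in> \<Omega> \<Longrightarrow> F (sw \<beta> \<gamma>) = F \<gamma>"
    and G: "\<And>\<beta> \<gamma>. \<beta> \<in> \<Omega> \<Longrightarrow> \<gamma> \<in> \<Omega> \<Longrightarrow> G (sw \<beta> \<gamma>) = G \<beta>"
  shows "(\<Sum>\<beta>\<in>\<Omega>. W \<beta> * (F \<beta> * G \<beta>)) * (\<Sum>\<beta>\<in>\<Omega>. W \<beta>) = (\<Sum>\<beta>\<in>\<Omega>. W \<beta> * F \<beta>) * (\<Sum>\<beta>\<in>\<Omega>. W \<beta> * G \<beta>)"
proof -
  have inv: "sw (sw \<beta> \<gamma>) (sw \<gamma> \<beta>) = \<beta>" for \<beta> \<gamma> by (auto simp: sw_def)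
  \<comment> \<open>The exchange is an involution on pairs that keeps the weight of the pair. It
    moves \<open>F\<close> and \<open>G\<close> of one copy into different copies, and then the sum
    over pairs splits.\<close>
  have "(\<Sum>(\<beta>, \<gamma>)\<in>\<Omega> \<times> \<Omega>. W \<beta> * (F \<beta> * G \<beta>) * W \<gamma>) =
        (\<Sum>(\<beta>, \<gamma>)\<in>\<Omega> \<times> \<Omega>. W \<beta> * F \<beta> * (W \<gamma> * G \<gamma>))"
  proof (rule sum.reindex_bij_witness[where i = "\<lambda>(\<beta>, \<gamma>). (sw \<gamma> \<beta>, sw \<beta> \<gamma>)" and j = "\<lambda>(\<beta>, \<gamma>). (sw \<gamma> \<beta>, sw \<beta> \<gamma>)"])
    fix p assume "p \<in> \<Omega> \<times> \<Omega>"
    then obtain \<beta> \<gamma> where p: "p = (\<beta>, \<gamma>)" "\<beta> \<in> \<Omega>" "\<gamma> \<in> \<Omega>" by auto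
    show "(case (case p of (\<beta>, \<gamma>) \<Rightarrow> (sw \<gamma> \<beta>, sw \<beta> \<gamma>)) of (\<beta>, \<gamma>) \<Rightarrow> W \<beta> * F \<beta> * (W \<gamma> * G \<gamma>)) =
      (case p of (\<beta>, \<gamma>) \<Rightarrow> W \<beta> * (F \<beta> * G \<beta>) * W \<gamma>)"
    proof -
      have "W (sw \<gamma> \<beta>) * F (sw \<gamma> \<beta>) * (W (sw \<beta> \<gamma>) * G (sw \<beta> \<gamma>)) =
        (W (sw \<beta> \<gamma>) * W (sw \<gamma> \<beta>)) * (F \<beta> * G \<beta>)"
        using F[OF p(3,2)] G[OF p(2,3)] by (simp only: ac_simps)
      then show ?thesis unfolding W[OF p(2,3)] by (simp add: p(1) ac_simps)
    qed
  qed (auto simp: inv closed)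
  then show ?thesis by (simp add: sum_product sum.cartesian_product)
qed

lemma finite_binary_states: "finite A \<Longrightarrow> finite (binary_states A)"
  by (auto simp: binary_states_def intro: finite_PiE)

lemma binary_states_val: "\<beta> \<in> binary_states A \<Longrightarrow> v \<in> A \<Longrightarrow> \<beta> v = 0 \<or> \<beta> v = 1"
  by (auto simp: binary_states_def PiE_def Pi_def)

lemma binary_states_upd: "\<beta> \<in> binary_states A \<Longrightarrow> v \<in> A \<Longrightarrow> b \<in> {0, 1} \<Longrightarrow> \<beta>(v := b) \<in> binary_states A"
  by (auto simp: binary_states_def PiE_def Pi_def extensional_def)

text \<open>Each sum is half a sum over pairs of states that differ only at \<open>x\<close>, so it
  is enough to compare pair by pair. This is how a single variable is summed out without changing
  the set of states.\<close>

lemma sum_binary_states_cong_flip: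
  fixes g h :: "('v \<Rightarrow> nat) \<Rightarrow> real"
  assumes x: "x \<in> A"
    and eq: "\<And>\<beta>. \<beta> \<in> binary_states A \<Longrightarrow> g (\<beta>(x := 0)) + g (\<beta>(x := 1)) = h (\<beta>(x := 0)) + h (\<beta>(x := 1))"
  shows "sum g (binary_states A) = sum h (binary_states A)"
proof -
  have double: "2 * sum g (binary_states A) = (\<Sum>\<beta>\<in>binary_states A. g (\<beta>(x := 0)) + g (\<beta>(x := 1)))"
    for g :: "('v \<Rightarrow> nat) \<Rightarrow> real"
  proof -
    have flip: "\<beta>(x := 1 - \<beta> x) \<in> binary_states A" "1 - (1 - \<beta> x) = \<beta> x"
      if "\<beta> \<in> binary_states A" for \<beta>
      using binary_states_val[OF that x] by (auto intro: binary_states_upd[OF that x])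
    have "sum g (binary_states A) = (\<Sum>\<beta>\<in>binary_states A. g (\<beta>(x := 1 - \<beta> x)))"
      by (rule sum.reindex_bij_witness[where i = "\<lambda>\<beta>. \<beta>(x := 1 - \<beta> x)" and j = "\<lambda>\<beta>. \<beta>(x := 1 - \<beta> x)"])
        (simp_all only: flip fun_upd_same fun_upd_upd fun_upd_triv)
    then have "2 * sum g (binary_states A) = (\<Sum>\<beta>\<in>binary_states A. g \<beta> + g (\<beta>(x := 1 - \<beta> x)))"
      by (simp add: sum.distrib)
    also have "\<dots> = (\<Sum>\<beta>\<in>binary_states A. g (\<beta>(x := 0)) + g (\<beta>(x := 1)))"
    proof (rule sum.cong[OF refl])
      fix \<beta> assume "\<beta> \<in> binary_states A"
      then have "\<beta> x = 0 \<or> \<beta> x = 1" by (rule binary_states_val[OF _ x])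
      then show "g \<beta> + g (\<beta>(x := 1 - \<beta> x)) = g (\<beta>(x := 0)) + g (\<beta>(x := 1))"
        by (elim disjE) (simp_all add: fun_upd_idem)
    qed
    finally show ?thesis .
  qed
  have "2 * sum g (binary_states A) = 2 * sum h (binary_states A)"
    unfolding double[of g] double[of h] by (rule sum.cong[OF refl], erule eq)
  then show ?thesis by simp
qed

context rtree
begin

section \<open>Weights that factor along the edges\<close>

abbreviation St :: "('v \<Rightarrow> nat) set" where "St \<equiv> binary_states V"

text \<open>\<open>e v b a\<close> stands for the probability of state \<open>b\<close> at
  \<open>v\<close> given state \<open>a\<close> of its parent. Both \<open>q\<close> and
  \<open>e\<close> are arbitrary functions, so that single transitions can be replaced by uniform
  ones.\<close>

definition tree_weight :: "(nat \<Rightarrow> real) \<Rightarrow> ('v \<Rightarrow> nat \<Rightarrow> nat \<Rightarrow> real) \<Rightarrow> ('v \<Rightarrow> nat) \<Rightarrow> real" where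
  "tree_weight q e \<beta> = q (\<beta> r) * (\<Prod>v \<in> V - {r}. e v (\<beta> v) (\<beta> (parent E v)))"

lemma finite_St: "finite St"
  using finite_V finite_binary_states by blast

text \<open>The nodes of \<open>A\<close> are made uniform one at a time from the bottom up: once the children of \<open>x\<close> no longer depend
  on \<open>\<beta> x\<close>, summing over \<open>\<beta> x\<close> gives the same for the law of \<open>Y\<^sub>x\<close> and for the uniform law.\<close>

lemma tree_weight_strip:
  fixes q e f
  defines "st \<equiv> \<lambda>A v b a. if v \<in> A then 1 / 2 else (e v b a :: real)"
  assumes "A \<subseteq> V - {r}" "\<And>x y. x \<in> A \<Longrightarrow> (x, y) \<in> E \<Longrightarrow> y \<in> A"
    and "\<And>v a. v \<in> V - {r} \<Longrightarrow> a \<in> {0, 1} \<Longrightarrow> e v 0 a + e v 1 a = 1"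
    and "\<And>\<beta> x b. x \<in> A \<Longrightarrow> f (\<beta>(x := b)) = f \<beta>"
  shows "(\<Sum>\<beta>\<in>St. tree_weight q e \<beta> * f \<beta>) = (\<Sum>\<beta>\<in>St. tree_weight q (st A) \<beta> * f \<beta>)"
proof -
  have "finite A" using assms(2) finite_V by (meson finite_Diff finite_subset)
  then show ?thesis using assms(2-)
  proof (induction A rule: finite_psubset_induct)
    case (psubset A)
    show ?case
    proof (cases "A = {}")
      case True
      then show ?thesis by (simp add: st_def)
    next
      case False
      \<comment> \<open>With \<open>x\<close> topmost, \<open>A - {x}\<close> is still closed under
        children. In the weight for \<open>A - {x}\<close> all children of \<open>x\<close> are
        already uniform, so the factor of \<open>x\<close> itself is the only one that depends on
        \<open>\<beta> x\<close>.\<close>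
      then obtain x where x: "x \<in> A" "\<And>y. (y, x) \<in> E \<Longrightarrow> y \<notin> A"
        using wf_E by (metis equals0I wfE_min)
      have xV: "x \<in> V - {r}" using psubset.prems x by blast
      let ?u = "parent E x"
      have u: "?u \<noteq> x" "?u \<in> V" "?u \<notin> A" using parent_edge[OF xV] edge_neq edge_in_V x by blast+
      define R where "R \<beta> = q (\<beta> r) * (\<Prod>v \<in> V - {r} - {x}. st A v (\<beta> v) (\<beta> (parent E v)))" for \<beta>
      have R: "R (\<beta>(x := b)) = R \<beta>" for \<beta> b
      proof -
        have "st A v ((\<beta>(x := b)) v) ((\<beta>(x := b)) (parent E v)) = st A v (\<beta> v) (\<beta> (parent E v))"
          if "v \<in> V - {r} - {x}" for v
          using that psubset.prems(2)[OF x(1)] parent_edge[of v] by (auto simp: st_def)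
        then show ?thesis using xV unfolding R_def by (auto intro!: prod.cong)
      qed
      have fin: "finite (V - {r})" using finite_V by simp
      have tA: "tree_weight q (st A) \<beta> = 1 / 2 * R \<beta>" for \<beta>
        using x(1) unfolding tree_weight_def R_def prod.remove[OF fin xV] by (simp add: st_def)
      have tA': "tree_weight q (st (A - {x})) \<beta> = e x (\<beta> x) (\<beta> ?u) * R \<beta>" for \<beta>
      proof -
        have "(\<Prod>v \<in> V - {r} - {x}. st (A - {x}) v (\<beta> v) (\<beta> (parent E v))) =
          (\<Prod>v \<in> V - {r} - {x}. st A v (\<beta> v) (\<beta> (parent E v)))"
          by (rule prod.cong) (auto simp: st_def)
        then show ?thesis unfolding tree_weight_def R_def prod.remove[OF fin xV] by (simp add: st_def)
      qed
      have "(\<Sum>\<beta>\<in>St. tree_weight q e \<beta> * f \<beta>) = (\<Sum>\<beta>\<in>St. tree_weight q (st (A - {x})) \<beta> * f \<beta>)"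
        using x psubset.prems by (intro psubset.IH) (blast+)
      also have "\<dots> = (\<Sum>\<beta>\<in>St. tree_weight q (st A) \<beta> * f \<beta>)"
      proof (rule sum_binary_states_cong_flip[of x])
        fix \<beta> assume b: "\<beta> \<in> St"
        have "e x 0 (\<beta> ?u) + e x 1 (\<beta> ?u) = 1"
          using psubset.prems(3)[OF xV] binary_states_val[OF b u(2)] by auto
        then have "e x 0 (\<beta> ?u) * R \<beta> * f \<beta> + e x 1 (\<beta> ?u) * R \<beta> * f \<beta> = R \<beta> * f \<beta>"
          by (simp flip: distrib_right)
        then show "tree_weight q (st (A - {x})) (\<beta>(x := 0)) * f (\<beta>(x := 0)) +
          tree_weight q (st (A - {x})) (\<beta>(x := 1)) * f (\<beta>(x := 1)) =
          tree_weight q (st A) (\<beta>(x := 0)) * f (\<beta>(x := 0)) +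
          tree_weight q (st A) (\<beta>(x := 1)) * f (\<beta>(x := 1))"
          using u by (simp add: tA tA' R psubset.prems(4)[OF x(1)])
      qed (use xV in auto)
      finally show ?thesis .
    qed
  qed
qed

text \<open>With every node below the root made uniform, a state has weight \<open>q\<close> times a
  power of 1/2, and this power cancels against the number of states.\<close>

lemma sum_tree_weight_root:
  assumes e: "\<And>v a. v \<in> V - {r} \<Longrightarrow> a \<in> {0, 1} \<Longrightarrow> e v 0 a + e v 1 a = 1"
  shows "(\<Sum>\<beta>\<in>St. tree_weight q e \<beta> * g (\<beta> r)) = q 0 * g 0 + q 1 * g 1"
proof -
  let ?c = "(1 / 2 :: real) ^ card (V - {r})"
  have "(\<Sum>\<beta>\<in>St. tree_weight q e \<beta> * g (\<beta> r)) = (\<Sum>\<beta>\<in>St. ?c * q (\<beta> r) * g (\<beta> r))"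
    by (subst tree_weight_strip[where A = "V - {r}"])
      (use e edge_target in \<open>auto simp: tree_weight_def intro!: sum.cong\<close>)
  also have "\<dots> = (\<Sum>\<beta>\<in>St. ?c * (1 / 2) * (q 0 * g 0 + q 1 * g 1))"
    by (rule sum_binary_states_cong_flip[OF r_in_V]) (auto simp: algebra_simps)
  also have "\<dots> = (2 ^ card V) * (1 / 2) ^ (card V) * (q 0 * g 0 + q 1 * g 1)"
  proof -
    have "card St = 2 ^ card V"
      unfolding binary_states_def by (subst card_PiE[OF finite_V]) (simp add: numeral_2_eq_2)
    moreover have "?c * (1 / 2) = (1 / 2) ^ card V"
      using card_Suc_Diff1[OF finite_V r_in_V] by (metis mult.commute power_Suc)
    ultimately show ?thesis by (simp add: algebra_simps)
  qed
  also have "\<dots> = q 0 * g 0 + q 1 * g 1"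
    by (simp flip: power_mult_distrib)
  finally show ?thesis .
qed

text \<open>Conditional expectation of \<open>g\<close> at \<open>w\<close> given the parent. Only
  the proper descendants of \<open>w\<close> are made uniform, so the true transition at
  \<open>w\<close> is still in place when \<open>\<beta> w\<close> is summed out.\<close>

lemma sum_tree_weight_edge:
  assumes e: "\<And>v a. v \<in> V - {r} \<Longrightarrow> a \<in> {0, 1} \<Longrightarrow> e v 0 a + e v 1 a = 1"
    and w: "w \<in> V - {r}"
    and f: "\<And>\<beta> x b. x \<in> desc w \<Longrightarrow> f (\<beta>(x := b)) = f \<beta>"
  shows "(\<Sum>\<beta>\<in>St. tree_weight q e \<beta> * (g (\<beta> w) * f \<beta>)) =
    (\<Sum>\<beta>\<in>St. tree_weight q e \<beta> * ((e w 0 (\<beta> (parent E w)) * g 0 + e w 1 (\<beta> (parent E w)) * g 1) * f \<beta>))"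
proof -
  let ?u = "parent E w" and ?A = "desc w - {w}"
  define st where "st = (\<lambda>v b a. if v \<in> ?A then 1 / 2 else e v b a)"
  have uw: "(?u, w) \<in> E" using parent_edge w by blast
  have u: "?u \<noteq> w" "?u \<in> V" "?u \<notin> desc w"
    using uw edge_neq edge_in_V parent_notin_desc by blast+
  have A: "?A \<subseteq> V - {r}"
    using w desc_sub[of w] desc_child no_edge_to_root unfolding desc_def by (auto dest: rtranclD elim: rtranclE)
  have Ac: "y \<in> ?A" if "x \<in> ?A" "(x, y) \<in> E" for x y
    using that desc_child parent_notin_desc desc_self by blast
  have strip: "(\<Sum>\<beta>\<in>St. tree_weight q e \<beta> * h \<beta>) = (\<Sum>\<beta>\<in>St. tree_weight q st \<beta> * h \<beta>)"
    if "\<And>\<beta> x b. x \<in> ?A \<Longrightarrow> h (\<beta>(x := b)) = h \<beta>" for h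
    unfolding st_def by (rule tree_weight_strip[OF A]) (erule (1) Ac, erule (1) e, erule that)
  define R where "R \<beta> = q (\<beta> r) * (\<Prod>v \<in> V - {r} - {w}. st v (\<beta> v) (\<beta> (parent E v)))" for \<beta>
  have R: "R (\<beta>(w := b)) = R \<beta>" for \<beta> b
  proof -
    have "st v ((\<beta>(w := b)) v) ((\<beta>(w := b)) (parent E v)) = st v (\<beta> v) (\<beta> (parent E v))"
      if "v \<in> V - {r} - {w}" for v
      using that parent_edge[of v] desc_child[OF desc_self[of w], of v] by (cases "parent E v = w") (auto simp: st_def)
    then show ?thesis using w unfolding R_def by (auto intro!: prod.cong)
  qed
  have fin: "finite (V - {r})" using finite_V by simp
  have tw: "tree_weight q st \<beta> = e w (\<beta> w) (\<beta> ?u) * R \<beta>" for \<beta>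
    unfolding tree_weight_def R_def prod.remove[OF fin w] by (simp add: st_def)
  have "(\<Sum>\<beta>\<in>St. tree_weight q e \<beta> * (g (\<beta> w) * f \<beta>)) = (\<Sum>\<beta>\<in>St. tree_weight q st \<beta> * (g (\<beta> w) * f \<beta>))"
    by (rule strip) (auto simp: f)
  also have "\<dots> = (\<Sum>\<beta>\<in>St. tree_weight q st \<beta> * ((e w 0 (\<beta> ?u) * g 0 + e w 1 (\<beta> ?u) * g 1) * f \<beta>))"
  proof (rule sum_binary_states_cong_flip[of w])
    fix \<beta> assume b: "\<beta> \<in> St"
    have "e w 0 (\<beta> ?u) + e w 1 (\<beta> ?u) = 1"
      using e[OF w] binary_states_val[OF b u(2)] by auto
    then have *: "e w 0 (\<beta> ?u) * x + e w 1 (\<beta> ?u) * x = x" for x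
      by (simp flip: distrib_right)
    show "tree_weight q st (\<beta>(w := 0)) * (g ((\<beta>(w := 0)) w) * f (\<beta>(w := 0))) +
      tree_weight q st (\<beta>(w := 1)) * (g ((\<beta>(w := 1)) w) * f (\<beta>(w := 1))) =
      tree_weight q st (\<beta>(w := 0)) * ((e w 0 ((\<beta>(w := 0)) ?u) * g 0 + e w 1 ((\<beta>(w := 0)) ?u) * g 1) * f (\<beta>(w := 0))) +
      tree_weight q st (\<beta>(w := 1)) * ((e w 0 ((\<beta>(w := 1)) ?u) * g 0 + e w 1 ((\<beta>(w := 1)) ?u) * g 1) * f (\<beta>(w := 1)))"
      using u *[of "R \<beta> * ((e w 0 (\<beta> ?u) * g 0 + e w 1 (\<beta> ?u) * g 1) * f \<beta>)"]
      by (simp add: tw R f[OF desc_self] algebra_simps)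
  qed (use w in auto)
  also have "\<dots> = (\<Sum>\<beta>\<in>St. tree_weight q e \<beta> * ((e w 0 (\<beta> ?u) * g 0 + e w 1 (\<beta> ?u) * g 1) * f \<beta>))"
  proof (rule strip[symmetric])
    fix \<beta> x b assume "x \<in> ?A"
    then have "x \<in> desc w" "?u \<noteq> x" using u by auto
    then show "(e w 0 ((\<beta>(x := b)) ?u) * g 0 + e w 1 ((\<beta>(x := b)) ?u) * g 1) * f (\<beta>(x := b)) =
      (e w 0 (\<beta> ?u) * g 0 + e w 1 (\<beta> ?u) * g 1) * f \<beta>"
      by (simp add: f)
  qed
  finally show ?thesis .
qed

definition local_on :: "'v set \<Rightarrow> (('v \<Rightarrow> nat) \<Rightarrow> real) \<Rightarrow> bool" where
  "local_on A f \<longleftrightarrow> (\<forall>\<beta> \<gamma>. (\<forall>x\<in>A. \<beta> x = \<gamma> x) \<longrightarrow> f \<beta> = f \<gamma>)"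

text \<open>Factors whose node and parent lie on the same side of \<open>A\<close> are merely
  permuted between the two copies. A crossing factor does no harm if one of its two states agrees in
  both copies or if it ignores the state of the parent.\<close>

lemma tree_weight_swap:
  fixes A \<beta> \<gamma>
  defines "sw \<equiv> \<lambda>\<beta> \<gamma> v. if v \<in> A then \<gamma> v else (\<beta> v :: nat)"
  assumes cross: "\<And>x. x \<in> V - {r} \<Longrightarrow> (x \<in> A) \<noteq> (parent E x \<in> A) \<Longrightarrow>
      (\<beta> (parent E x) = \<gamma> (parent E x)) \<or> \<beta> x = \<gamma> x \<or>
      (e x (\<beta> x) (\<beta> (parent E x)) = e x (\<beta> x) (\<gamma> (parent E x)) \<and>
       e x (\<gamma> x) (\<beta> (parent E x)) = e x (\<gamma> x) (\<gamma> (parent E x)))"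
  shows "tree_weight q e (sw \<beta> \<gamma>) * tree_weight q e (sw \<gamma> \<beta>) = tree_weight q e \<beta> * tree_weight q e \<gamma>"
proof -
  let ?t = "\<lambda>\<beta> v. e v (\<beta> v) (\<beta> (parent E v))"
  have "(\<Prod>v \<in> V - {r}. ?t (sw \<beta> \<gamma>) v * ?t (sw \<gamma> \<beta>) v) = (\<Prod>v \<in> V - {r}. ?t \<beta> v * ?t \<gamma> v)"
  proof (rule prod.cong[OF refl])
    fix v assume "v \<in> V - {r}"
    then show "?t (sw \<beta> \<gamma>) v * ?t (sw \<gamma> \<beta>) v = ?t \<beta> v * ?t \<gamma> v"
      using cross[of v] by (cases "v \<in> A"; cases "parent E v \<in> A") (auto simp: sw_def)
  qed
  moreover have "q (sw \<beta> \<gamma> r) * q (sw \<gamma> \<beta> r) = q (\<beta> r) * q (\<gamma> r)"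
    by (auto simp: sw_def)
  ultimately have "(q (sw \<beta> \<gamma> r) * q (sw \<gamma> \<beta> r)) * (\<Prod>v \<in> V - {r}. ?t (sw \<beta> \<gamma>) v * ?t (sw \<gamma> \<beta>) v) =
      (q (\<beta> r) * q (\<gamma> r)) * (\<Prod>v \<in> V - {r}. ?t \<beta> v * ?t \<gamma> v)"
    by (simp only:)
  then show ?thesis
    unfolding tree_weight_def prod.distrib by (simp only: ac_simps)
qed

text \<open>Both copies have state \<open>b\<close> at \<open>v\<close>, which is an end of the only
  edge crossing \<open>side v u\<close>. The product form avoids dividing by the probability of
  \<open>b\<close>, which may be 0.\<close>

lemma sum_tree_weight_cond_indep:
  assumes vu: "adj v u" and F: "local_on (side v u) F" and G: "local_on (V - side v u) G"
  shows "(\<Sum>\<beta>\<in>St. tree_weight q e \<beta> * (F \<beta> * G \<beta> * of_bool (\<beta> v = b))) *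
      (\<Sum>\<beta>\<in>St. tree_weight q e \<beta> * of_bool (\<beta> v = b)) =
    (\<Sum>\<beta>\<in>St. tree_weight q e \<beta> * (F \<beta> * of_bool (\<beta> v = b))) *
      (\<Sum>\<beta>\<in>St. tree_weight q e \<beta> * (G \<beta> * of_bool (\<beta> v = b)))"
proof -
  let ?A = "side v u" and ?\<Omega> = "{\<beta> \<in> St. \<beta> v = b}"
  have restr: "(\<Sum>\<beta>\<in>St. h \<beta> * of_bool (\<beta> v = b)) = sum h ?\<Omega>" for h :: "_ \<Rightarrow> real"
    by (intro sum.mono_neutral_cong_right) (auto simp: finite_St)
  have "(\<Sum>\<beta>\<in>?\<Omega>. tree_weight q e \<beta> * (F \<beta> * G \<beta>)) * (\<Sum>\<beta>\<in>?\<Omega>. tree_weight q e \<beta>) =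
      (\<Sum>\<beta>\<in>?\<Omega>. tree_weight q e \<beta> * F \<beta>) * (\<Sum>\<beta>\<in>?\<Omega>. tree_weight q e \<beta> * G \<beta>)"
  proof (rule sum_exchange[where A = ?A])
    fix \<beta> \<gamma> assume h: "\<beta> \<in> ?\<Omega>" "\<gamma> \<in> ?\<Omega>"
    show "(\<lambda>v. if v \<in> ?A then \<gamma> v else \<beta> v) \<in> ?\<Omega>"
      using h side_sub[OF vu] by (auto simp: binary_states_def PiE_def Pi_def extensional_def)
    show "F (\<lambda>v. if v \<in> ?A then \<gamma> v else \<beta> v) = F \<gamma>" using F by (auto simp: local_on_def)
    show "G (\<lambda>v. if v \<in> ?A then \<gamma> v else \<beta> v) = G \<beta>" using G unfolding local_on_def by auto
    show "tree_weight q e (\<lambda>v. if v \<in> ?A then \<gamma> v else \<beta> v) * tree_weight q e (\<lambda>v. if v \<in> ?A then \<beta> v else \<gamma> v) =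
      tree_weight q e \<beta> * tree_weight q e \<gamma>"
    proof (rule tree_weight_swap)
      fix x assume x: "x \<in> V - {r}" "(x \<in> ?A) \<noteq> (parent E x \<in> ?A)"
      then have "{parent E x, x} = {u, v}" using side_crossing[OF vu parent_edge[OF x(1)]] by blast
      then have "v = x \<or> v = parent E x" by blast
      then show "(\<beta> (parent E x) = \<gamma> (parent E x)) \<or> \<beta> x = \<gamma> x \<or>
      (e x (\<beta> x) (\<beta> (parent E x)) = e x (\<beta> x) (\<gamma> (parent E x)) \<and>
       e x (\<gamma> x) (\<beta> (parent E x)) = e x (\<gamma> x) (\<gamma> (parent E x)))"
        using h by auto
    qed
  qed
  then show ?thesis by (simp add: mult.assoc[symmetric] restr)
qed

text \<open>An edge is named by its child \<open>w\<close>.\<close>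

lemma sum_tree_weight_indep:
  assumes w: "w \<in> V - {r}" and dead: "\<And>b. b \<in> {0, 1} \<Longrightarrow> e w b 0 = e w b 1"
    and F: "local_on (desc w) F" and G: "local_on (V - desc w) G"
  shows "(\<Sum>\<beta>\<in>St. tree_weight q e \<beta> * (F \<beta> * G \<beta>)) * (\<Sum>\<beta>\<in>St. tree_weight q e \<beta>) =
    (\<Sum>\<beta>\<in>St. tree_weight q e \<beta> * F \<beta>) * (\<Sum>\<beta>\<in>St. tree_weight q e \<beta> * G \<beta>)"
proof (rule sum_exchange[where A = "desc w"])
  fix \<beta> \<gamma> assume h: "\<beta> \<in> St" "\<gamma> \<in> St"
  have uw: "(parent E w, w) \<in> E" using w parent_edge by blast
  then have aw: "adj (parent E w) w" and sd: "side (parent E w) w = desc w" by (auto simp: adjacent_def side_def)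
  show "(\<lambda>v. if v \<in> desc w then \<gamma> v else \<beta> v) \<in> St"
    using h desc_sub w by (auto simp: binary_states_def PiE_def Pi_def extensional_def)
  show "F (\<lambda>v. if v \<in> desc w then \<gamma> v else \<beta> v) = F \<gamma>" using F by (auto simp: local_on_def)
  show "G (\<lambda>v. if v \<in> desc w then \<gamma> v else \<beta> v) = G \<beta>" using G unfolding local_on_def by auto
  show "tree_weight q e (\<lambda>v. if v \<in> desc w then \<gamma> v else \<beta> v) * tree_weight q e (\<lambda>v. if v \<in> desc w then \<beta> v else \<gamma> v) =
      tree_weight q e \<beta> * tree_weight q e \<gamma>"
  proof (rule tree_weight_swap)
    fix x assume x: "x \<in> V - {r}" "(x \<in> desc w) \<noteq> (parent E x \<in> desc w)"
    then have "{parent E x, x} = {w, parent E w}"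
      using side_crossing[OF aw parent_edge[OF x(1)]] by (simp add: sd)
    \<comment> \<open>The crossing edge is the one into \<open>w\<close>, whose transition ignores
      the state of the parent.\<close>
    then have xw: "x = w" using parent_edge[OF x(1)] uw not_parent_and_child by (auto simp: doubleton_eq_iff)
    have "e w b a = e w b a'" if "b \<in> {0, 1}" "a \<in> {0, 1}" "a' \<in> {0, 1}" for a a' b
      using dead that by auto
    then show "(\<beta> (parent E x) = \<gamma> (parent E x)) \<or> \<beta> x = \<gamma> x \<or>
      (e x (\<beta> x) (\<beta> (parent E x)) = e x (\<beta> x) (\<gamma> (parent E x)) \<and>
       e x (\<gamma> x) (\<beta> (parent E x)) = e x (\<gamma> x) (\<gamma> (parent E x)))"
      using h binary_states_val[of _ V w] binary_states_val[of _ V "parent E w"] parent_in_V w unfolding xw by auto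
  qed
qed

end


section \<open>The tree model\<close>

locale tree_model = rtree V E r for V :: "'v set" and E r +
  fixes coord :: "'v param \<Rightarrow> 'k::finite"
  assumes coord: "bij_betw coord (param_index V r) UNIV"
begin

section \<open>Expectations and moments of the node variables\<close>

definition wt :: "real ^ 'k \<Rightarrow> ('v \<Rightarrow> nat) \<Rightarrow> real" where
  "wt \<theta> = tree_weight (root_prob coord \<theta>) (edge_prob coord \<theta>)"

definition ex :: "real ^ 'k \<Rightarrow> (('v \<Rightarrow> nat) \<Rightarrow> real) \<Rightarrow> real" where
  "ex \<theta> f = (\<Sum>\<beta>\<in>St. wt \<theta> \<beta> * f \<beta>)"

definition mean :: "real ^ 'k \<Rightarrow> 'v \<Rightarrow> real" where
  "mean \<theta> v = ex \<theta> (\<lambda>\<beta>. real (\<beta> v))"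

definition var :: "real ^ 'k \<Rightarrow> 'v \<Rightarrow> real" where
  "var \<theta> v = mean \<theta> v * (1 - mean \<theta> v)"

definition cen :: "real ^ 'k \<Rightarrow> 'v \<Rightarrow> ('v \<Rightarrow> nat) \<Rightarrow> real" where
  "cen \<theta> v \<beta> = real (\<beta> v) - mean \<theta> v"

definition cov :: "real ^ 'k \<Rightarrow> 'v \<Rightarrow> 'v \<Rightarrow> real" where
  "cov \<theta> u v = ex \<theta> (\<lambda>\<beta>. cen \<theta> u \<beta> * cen \<theta> v \<beta>)"

definition third :: "real ^ 'k \<Rightarrow> 'v \<Rightarrow> 'v \<Rightarrow> 'v \<Rightarrow> real" where
  "third \<theta> u v w = ex \<theta> (\<lambda>\<beta>. cen \<theta> u \<beta> * cen \<theta> v \<beta> * cen \<theta> w \<beta>)"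

abbreviation tp :: "real ^ 'k \<Rightarrow> 'v \<Rightarrow> nat \<Rightarrow> real" where
  "tp \<theta> w a \<equiv> \<theta> $ coord (EdgeParam w a)"

lemma ex_add: "ex \<theta> (\<lambda>\<beta>. f \<beta> + g \<beta>) = ex \<theta> f + ex \<theta> g"
  by (simp add: ex_def sum.distrib algebra_simps)

lemma ex_diff: "ex \<theta> (\<lambda>\<beta>. f \<beta> - g \<beta>) = ex \<theta> f - ex \<theta> g"
  by (simp add: ex_def sum_subtractf algebra_simps)

lemma ex_cmult: "ex \<theta> (\<lambda>\<beta>. c * f \<beta>) = c * ex \<theta> f"
  by (simp add: ex_def sum_distrib_left algebra_simps)

lemma ex_cong: "(\<And>\<beta>. \<beta> \<in> St \<Longrightarrow> f \<beta> = g \<beta>) \<Longrightarrow> ex \<theta> f = ex \<theta> g"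
  by (simp add: ex_def)

lemma St_val: "\<beta> \<in> St \<Longrightarrow> v \<in> V \<Longrightarrow> \<beta> v = 0 \<or> \<beta> v = 1"
  by (rule binary_states_val)

lemma edge_prob_sum: "edge_prob coord \<theta> v 0 a + edge_prob coord \<theta> v 1 a = 1"
  by (simp add: edge_prob_def)

lemma ex_root: "ex \<theta> (\<lambda>\<beta>. g (\<beta> r)) = root_prob coord \<theta> 0 * g 0 + root_prob coord \<theta> 1 * g 1"
  unfolding ex_def wt_def by (rule sum_tree_weight_root) (rule edge_prob_sum)

lemma ex_1: "ex \<theta> (\<lambda>_. 1) = 1"
  using ex_root[of \<theta> "\<lambda>_. 1"] by (simp add: root_prob_def)

lemma ex_const: "ex \<theta> (\<lambda>_. c) = c"
  using ex_cmult[of \<theta> c "\<lambda>_. 1"] by (simp add: ex_1)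

lemma mean_root: "mean \<theta> r = \<theta> $ coord RootParam"
  using ex_root[of \<theta> real] by (simp add: mean_def root_prob_def)

lemma ex_edge:
  assumes w: "w \<in> V - {r}" and f: "\<And>\<beta> x b. x \<in> desc w \<Longrightarrow> f (\<beta>(x := b)) = f \<beta>"
  shows "ex \<theta> (\<lambda>\<beta>. real (\<beta> w) * f \<beta>) = ex \<theta> (\<lambda>\<beta>. tp \<theta> w (\<beta> (parent E w)) * f \<beta>)"
proof -
  have "ex \<theta> (\<lambda>\<beta>. real (\<beta> w) * f \<beta>) = ex \<theta> (\<lambda>\<beta>. (edge_prob coord \<theta> w 0 (\<beta> (parent E w)) * real 0 +
      edge_prob coord \<theta> w 1 (\<beta> (parent E w)) * real 1) * f \<beta>)"
    unfolding ex_def wt_def by (rule sum_tree_weight_edge[OF _ w f]) (rule edge_prob_sum)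
  then show ?thesis by (simp add: edge_prob_def)
qed

lemma ex_split:
  assumes "v \<in> V"
  shows "ex \<theta> f = ex \<theta> (\<lambda>\<beta>. f \<beta> * of_bool (\<beta> v = 0)) + ex \<theta> (\<lambda>\<beta>. f \<beta> * of_bool (\<beta> v = 1))"
  unfolding ex_add[symmetric] by (rule ex_cong) (auto dest: St_val[OF _ assms])

lemma ex_ind1: "v \<in> V \<Longrightarrow> ex \<theta> (\<lambda>\<beta>. f \<beta> * of_bool (\<beta> v = 1)) = ex \<theta> (\<lambda>\<beta>. f \<beta> * real (\<beta> v))"
  by (rule ex_cong) (auto dest: St_val)

lemma ex_ind0: "v \<in> V \<Longrightarrow> ex \<theta> (\<lambda>\<beta>. f \<beta> * of_bool (\<beta> v = 0)) = ex \<theta> f - ex \<theta> (\<lambda>\<beta>. f \<beta> * real (\<beta> v))"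
  using ex_split[of v \<theta> f] ex_ind1[of v \<theta> f] by simp

lemma prob_ind:
  assumes "v \<in> V"
  shows "ex \<theta> (\<lambda>\<beta>. of_bool (\<beta> v = 1)) = mean \<theta> v" "ex \<theta> (\<lambda>\<beta>. of_bool (\<beta> v = 0)) = 1 - mean \<theta> v"
  using ex_ind1[OF assms, of \<theta> "\<lambda>_. 1"] ex_ind0[OF assms, of \<theta> "\<lambda>_. 1"] by (auto simp: mean_def ex_1)

lemma ex_cen: "ex \<theta> (cen \<theta> v) = 0"
  unfolding cen_def by (simp add: ex_diff ex_const flip: mean_def)

lemma ex_cen_times: "ex \<theta> (\<lambda>\<beta>. cen \<theta> u \<beta> * real (\<beta> v)) = cov \<theta> u v"
proof -
  have "cov \<theta> u v = ex \<theta> (\<lambda>\<beta>. cen \<theta> u \<beta> * real (\<beta> v) - mean \<theta> v * cen \<theta> u \<beta>)"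
    unfolding cov_def by (rule ex_cong) (simp add: cen_def algebra_simps)
  then show ?thesis by (simp add: ex_diff ex_cmult ex_cen)
qed

lemma cov_eq: "cov \<theta> u v = ex \<theta> (\<lambda>\<beta>. real (\<beta> u) * real (\<beta> v)) - mean \<theta> u * mean \<theta> v"
proof -
  have "cov \<theta> u v = ex \<theta> (\<lambda>\<beta>. real (\<beta> u) * real (\<beta> v) - mean \<theta> u * real (\<beta> v))"
    unfolding ex_cen_times[symmetric] by (rule ex_cong) (simp add: cen_def algebra_simps)
  then show ?thesis by (simp add: ex_diff ex_cmult flip: mean_def)
qed

lemma cov_sym: "cov \<theta> u v = cov \<theta> v u"
  by (simp add: cov_def mult.commute)

lemma cov_self: "v \<in> V \<Longrightarrow> cov \<theta> v v = var \<theta> v"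
proof -
  assume v: "v \<in> V"
  have "ex \<theta> (\<lambda>\<beta>. real (\<beta> v) * real (\<beta> v)) = mean \<theta> v"
    unfolding mean_def by (rule ex_cong) (auto dest: St_val[OF _ v])
  then show ?thesis by (simp add: cov_eq var_def algebra_simps)
qed

lemma mean_edge:
  assumes w: "w \<in> V - {r}"
  shows "mean \<theta> w = tp \<theta> w 0 * (1 - mean \<theta> (parent E w)) + tp \<theta> w 1 * mean \<theta> (parent E w)"
proof -
  have u: "parent E w \<in> V" by (rule parent_in_V[OF w])
  have "mean \<theta> w = ex \<theta> (\<lambda>\<beta>. tp \<theta> w (\<beta> (parent E w)))"
    using ex_edge[OF w, where f = "\<lambda>_. 1"] by (simp add: mean_def)
  also have "\<dots> = ex \<theta> (\<lambda>\<beta>. tp \<theta> w 0 * of_bool (\<beta> (parent E w) = 0) + tp \<theta> w 1 * of_bool (\<beta> (parent E w) = 1))"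
    by (rule ex_cong) (auto dest: St_val[OF _ u])
  finally show ?thesis by (simp add: ex_add ex_cmult prob_ind[OF u] prob_ind(1)[OF u, unfolded One_nat_def])
qed

text \<open>Both sides are the probability that \<open>w\<close> and its parent have state 1.
  Together with \<open>mean_edge\<close> this determines the two transition probabilities from means
  and one covariance.\<close>

lemma cov_edge:
  assumes w: "w \<in> V - {r}"
  shows "cov \<theta> w (parent E w) + mean \<theta> w * mean \<theta> (parent E w) = tp \<theta> w 1 * mean \<theta> (parent E w)"
proof -
  let ?u = "parent E w"
  have u: "?u \<in> V" by (rule parent_in_V[OF w])
  have ud: "x \<in> desc w \<Longrightarrow> ?u \<noteq> x" for x using parent_notin_desc[OF parent_edge[OF w]] by auto
  have "ex \<theta> (\<lambda>\<beta>. real (\<beta> w) * real (\<beta> ?u)) = ex \<theta> (\<lambda>\<beta>. tp \<theta> w (\<beta> ?u) * real (\<beta> ?u))"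
    by (rule ex_edge[OF w]) (use ud in auto)
  also have "\<dots> = ex \<theta> (\<lambda>\<beta>. tp \<theta> w 1 * real (\<beta> ?u))"
    by (rule ex_cong) (auto dest: St_val[OF _ u])
  finally show ?thesis by (simp add: ex_cmult cov_eq flip: mean_def)
qed

section \<open>Moments across a separating node\<close>

lemma cond_indep:
  assumes "adj v u" "local_on (side v u) F" "local_on (V - side v u) G"
  shows "ex \<theta> (\<lambda>\<beta>. F \<beta> * G \<beta> * of_bool (\<beta> v = b)) * ex \<theta> (\<lambda>\<beta>. of_bool (\<beta> v = b)) =
    ex \<theta> (\<lambda>\<beta>. F \<beta> * of_bool (\<beta> v = b)) * ex \<theta> (\<lambda>\<beta>. G \<beta> * of_bool (\<beta> v = b))"
  unfolding ex_def wt_def using sum_tree_weight_cond_indep[OF assms] by simp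

lemma local_on_cen: "x \<in> A \<Longrightarrow> local_on A (cen \<theta> x)"
  by (auto simp: local_on_def cen_def)

lemma local_on_mult: "local_on A F \<Longrightarrow> local_on A G \<Longrightarrow> local_on A (\<lambda>\<beta>. F \<beta> * G \<beta>)"
  unfolding local_on_def by metis

text \<open>\<open>?T b\<close> is the contribution of state \<open>b\<close> of \<open>v\<close> to
  the covariance. Times the probability of \<open>b\<close> it is the same product for both states,
  because the contributions of the two states to a centred variable are opposite. Multiplying by the
  variance instead of dividing keeps the identity true if \<open>Y\<^sub>v\<close> is
  constant.\<close>

lemma cov_sep:
  assumes "adj v u" "i \<in> side v u" "j \<in> V - side v u"
  shows "cov \<theta> i j * var \<theta> v = cov \<theta> i v * cov \<theta> j v"
proof -
  have v: "v \<in> V" using assms adj_in_V by blast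
  let ?T = "\<lambda>b. ex \<theta> (\<lambda>\<beta>. cen \<theta> i \<beta> * cen \<theta> j \<beta> * of_bool (\<beta> v = b))"
  have ci: "?T b * ex \<theta> (\<lambda>\<beta>. of_bool (\<beta> v = b)) =
    ex \<theta> (\<lambda>\<beta>. cen \<theta> i \<beta> * of_bool (\<beta> v = b)) * ex \<theta> (\<lambda>\<beta>. cen \<theta> j \<beta> * of_bool (\<beta> v = b))" for b
    by (rule cond_indep[OF assms(1)]) (use assms local_on_cen in auto)
  have 1: "?T 1 * mean \<theta> v = cov \<theta> i v * cov \<theta> j v"
    using ci[of 1] unfolding prob_ind[OF v] ex_ind1[OF v] ex_cen_times .
  have 0: "?T 0 * (1 - mean \<theta> v) = cov \<theta> i v * cov \<theta> j v"
    using ci[of 0] by (simp add: prob_ind[OF v] ex_ind0[OF v] ex_cen_times ex_cen)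
  have "cov \<theta> i j = ?T 0 + ?T 1" unfolding cov_def by (rule ex_split[OF v])
  then have "cov \<theta> i j * var \<theta> v = (?T 0 * (1 - mean \<theta> v)) * mean \<theta> v + (?T 1 * mean \<theta> v) * (1 - mean \<theta> v)"
    by (simp add: var_def algebra_simps)
  also have "\<dots> = cov \<theta> i v * cov \<theta> j v" unfolding 0 1 by (simp add: algebra_simps)
  finally show ?thesis .
qed

text \<open>Conditional independence is used twice, through \<open>u\<close> to split
  \<open>i\<close> from \<open>j\<close> and \<open>k\<close>, then through \<open>u'\<close> to
  split \<open>j\<close> from \<open>k\<close>; hence the square of the variance. The contributions
  of states 1 and 0 have opposite signs, and \<open>(1 - m)^2 - m^2 = 1 - 2 * m\<close>
  remains.\<close>

lemma third_sep:
  assumes "adj v u" "i \<in> side v u" "j \<in> V - side v u" "k \<in> V - side v u"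
    and "adj v u'" "j \<in> side v u'" "k \<in> V - side v u'"
  shows "third \<theta> i j k * var \<theta> v ^ 2 = cov \<theta> i v * cov \<theta> j v * cov \<theta> k v * (1 - 2 * mean \<theta> v)"
proof -
  have v: "v \<in> V" using assms adj_in_V by blast
  let ?T = "\<lambda>b. ex \<theta> (\<lambda>\<beta>. cen \<theta> i \<beta> * (cen \<theta> j \<beta> * cen \<theta> k \<beta>) * of_bool (\<beta> v = b))"
  let ?P = "\<lambda>b. ex \<theta> (\<lambda>\<beta>. of_bool (\<beta> v = b))"
  let ?A = "\<lambda>i b. ex \<theta> (\<lambda>\<beta>. cen \<theta> i \<beta> * of_bool (\<beta> v = b))"
  have ci: "?T b * ?P b ^ 2 = ?A i b * (?A j b * ?A k b)" for b
  proof -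
    have "?T b * ?P b = ?A i b * ex \<theta> (\<lambda>\<beta>. cen \<theta> j \<beta> * cen \<theta> k \<beta> * of_bool (\<beta> v = b))"
      by (rule cond_indep[OF assms(1)]) (use assms local_on_cen local_on_mult in auto)
    moreover have "ex \<theta> (\<lambda>\<beta>. cen \<theta> j \<beta> * cen \<theta> k \<beta> * of_bool (\<beta> v = b)) * ?P b = ?A j b * ?A k b"
      by (rule cond_indep[OF assms(5)]) (use assms local_on_cen in auto)
    ultimately have "(?T b * ?P b) * ?P b = ?A i b * (?A j b * ?A k b)" by (simp only: mult.assoc)
    then show ?thesis by (simp only: power2_eq_square mult.assoc)
  qed
  let ?abc = "cov \<theta> i v * (cov \<theta> j v * cov \<theta> k v)"
  have 1: "?T 1 * mean \<theta> v ^ 2 = ?abc"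
    using ci[of 1] unfolding prob_ind[OF v] ex_ind1[OF v] ex_cen_times .
  have 0: "?T 0 * (1 - mean \<theta> v) ^ 2 = - ?abc"
    using ci[of 0] unfolding prob_ind[OF v] ex_ind0[OF v] ex_cen_times ex_cen by simp
  have "third \<theta> i j k = ?T 0 + ?T 1"
    using ex_split[OF v, of \<theta> "\<lambda>\<beta>. cen \<theta> i \<beta> * (cen \<theta> j \<beta> * cen \<theta> k \<beta>)"] by (simp only: third_def mult.assoc)
  moreover have "(x + y) * (m * (1 - m)) ^ 2 = (x * (1 - m) ^ 2) * m ^ 2 + (y * m ^ 2) * (1 - m) ^ 2" for x y m :: real
    by (simp add: power2_eq_square algebra_simps)
  ultimately have "third \<theta> i j k * var \<theta> v ^ 2 = (?T 0 * (1 - mean \<theta> v) ^ 2) * mean \<theta> v ^ 2 + (?T 1 * mean \<theta> v ^ 2) * (1 - mean \<theta> v) ^ 2"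
    by (simp only: var_def)
  also have "\<dots> = ?abc * (1 - 2 * mean \<theta> v)" unfolding 0 1 by (simp add: algebra_simps power2_eq_square)
  finally show ?thesis by (simp add: algebra_simps)
qed

section \<open>Bounds valid on the parameter space\<close>

lemma tp_bounds: "\<theta> \<in> param_space \<Longrightarrow> 0 \<le> \<theta> $ k \<and> \<theta> $ k \<le> 1"
  by (auto simp: param_space_def)

lemma wt_nonneg: "\<theta> \<in> param_space \<Longrightarrow> 0 \<le> wt \<theta> \<beta>"
  unfolding wt_def tree_weight_def root_prob_def edge_prob_def
  by (intro mult_nonneg_nonneg prod_nonneg) (auto simp: tp_bounds)

lemma ex_nonneg: "\<theta> \<in> param_space \<Longrightarrow> (\<And>\<beta>. \<beta> \<in> St \<Longrightarrow> 0 \<le> f \<beta>) \<Longrightarrow> 0 \<le> ex \<theta> f"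
  unfolding ex_def by (intro sum_nonneg mult_nonneg_nonneg wt_nonneg)

lemma ex_mono: "\<theta> \<in> param_space \<Longrightarrow> (\<And>\<beta>. \<beta> \<in> St \<Longrightarrow> f \<beta> \<le> g \<beta>) \<Longrightarrow> ex \<theta> f \<le> ex \<theta> g"
  unfolding ex_def by (intro sum_mono mult_left_mono wt_nonneg)

lemma mean_bounds: "\<theta> \<in> param_space \<Longrightarrow> v \<in> V \<Longrightarrow> 0 \<le> mean \<theta> v \<and> mean \<theta> v \<le> 1"
  using ex_nonneg[of \<theta> "\<lambda>\<beta>. real (\<beta> v)"] ex_mono[of \<theta> "\<lambda>\<beta>. real (\<beta> v)" "\<lambda>_. 1"] St_val[of _ v]
  unfolding mean_def ex_1 by fastforce

lemma var_bounds: "\<theta> \<in> param_space \<Longrightarrow> v \<in> V \<Longrightarrow> 0 \<le> var \<theta> v \<and> var \<theta> v \<le> 1"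
  using mean_bounds[of \<theta> v] unfolding var_def by (auto intro: mult_le_one)

text \<open>With the joint probabilities \<open>a\<close>, \<open>b\<close>, \<open>c\<close>,
  \<open>d\<close> of the two variables, the covariance is \<open>a * d - b * c\<close>, and the
  variance \<open>(b + d) * (a + c)\<close> contains both products. Unlike the Cauchy-Schwarz bound,
  this one involves only the variance of \<open>v\<close>.\<close>

lemma abs_cov_le:
  assumes \<theta>: "\<theta> \<in> param_space" and V: "x \<in> V" "v \<in> V"
  shows "\<bar>cov \<theta> x v\<bar> \<le> var \<theta> v"
proof -
  let ?p = "\<lambda>a b. ex \<theta> (\<lambda>\<beta>. of_bool (\<beta> x = a) * of_bool (\<beta> v = b))"
  have nn: "0 \<le> ?p a b" for a b by (rule ex_nonneg[OF \<theta>]) simp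
  have cs: "(\<beta> x = 0 \<or> \<beta> x = 1) \<and> (\<beta> v = 0 \<or> \<beta> v = 1)" if "\<beta> \<in> St" for \<beta>
    using St_val[OF that] V by blast
  have "?p 0 0 + ?p 0 1 + ?p 1 0 + ?p 1 1 = ex \<theta> (\<lambda>_. 1)"
    unfolding ex_add[symmetric] by (rule ex_cong) (auto dest!: cs)
  then have tot: "?p 0 0 + ?p 0 1 + ?p 1 0 + ?p 1 1 = 1" by (simp only: ex_1)
  have m: "mean \<theta> v = ?p 0 1 + ?p 1 1" "mean \<theta> x = ?p 1 0 + ?p 1 1"
    unfolding mean_def ex_add[symmetric] by (rule ex_cong; auto dest!: cs)+
  have c: "ex \<theta> (\<lambda>\<beta>. real (\<beta> x) * real (\<beta> v)) = ?p 1 1"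
    by (rule ex_cong) (auto dest!: cs)
  define a b c d where "a = ?p 0 0" and "b = ?p 0 1" and "c = ?p 1 0" and "d = ?p 1 1"
  have s: "a = 1 - b - c - d" and nn': "0 \<le> a" "0 \<le> b" "0 \<le> c" "0 \<le> d"
    using tot nn by (auto simp: a_def b_def c_def d_def)
  have e: "cov \<theta> x v = a * d - b * c" "var \<theta> v = (b + d) * (a + c)"
    unfolding cov_eq var_def c m unfolding a_def[symmetric] b_def[symmetric] c_def[symmetric] d_def[symmetric] s
    by (auto simp: algebra_simps)
  have "0 \<le> a * d" "0 \<le> b * c" "0 \<le> a * b" "0 \<le> c * d" using nn' by auto
  then show ?thesis unfolding e by (simp add: algebra_simps abs_if)
qed

text \<open>Here \<open>cov_sep\<close> says nothing about \<open>cov \<theta> i j\<close>. But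
  \<open>Y\<^sub>v\<close> is almost surely constant, so conditioning on it changes nothing, and
  conditional independence is independence.\<close>

lemma cov_sep_degenerate:
  assumes \<theta>: "\<theta> \<in> param_space" and h: "adj v u" "i \<in> side v u" "j \<in> V - side v u" and var: "var \<theta> v = 0"
  shows "cov \<theta> i j = 0"
proof -
  have v: "v \<in> V" and i: "i \<in> V" using h(2,3) adj_in_V[OF h(1)] side_sub[OF h(1)] by auto
  let ?F = "\<lambda>b \<beta>. of_bool (\<beta> v = b) :: real"
  have z: "ex \<theta> (\<lambda>\<beta>. f \<beta> * ?F b \<beta>) = 0" if "ex \<theta> (?F b) = 0" for f b
  proof -
    have "\<forall>\<beta>\<in>St. wt \<theta> \<beta> * ?F b \<beta> = 0"
      using that unfolding ex_def by (subst (asm) sum_nonneg_eq_0_iff) (auto simp: wt_nonneg[OF \<theta>] finite_St)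
    then show ?thesis unfolding ex_def by (intro sum.neutral) auto
  qed
  \<comment> \<open>\<open>b\<close> is the value that \<open>Y\<^sub>v\<close> takes with
    probability 0, \<open>b'\<close> the other one.\<close>
  have "\<exists>b b'. ex \<theta> (?F b) = 0 \<and> {b, b'} = {0, 1}"
  proof (cases "mean \<theta> v = 0")
    case True
    then show ?thesis using prob_ind(1)[OF v, of \<theta>] by (intro exI[of _ 1] exI[of _ 0]) auto
  next
    case False
    then have "mean \<theta> v = 1" using var by (simp add: var_def)
    then show ?thesis using prob_ind(2)[OF v, of \<theta>] by (intro exI[of _ 0] exI[of _ 1]) auto
  qed
  then obtain b b' where b: "ex \<theta> (?F b) = 0" "{b, b'} = {0, 1}" by blast
  have spl: "ex \<theta> f = ex \<theta> (\<lambda>\<beta>. f \<beta> * ?F b \<beta>) + ex \<theta> (\<lambda>\<beta>. f \<beta> * ?F b' \<beta>)" for f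
    using ex_split[OF v, of \<theta> f] b(2) by (auto simp: doubleton_eq_iff)
  have "ex \<theta> (?F b') = 1" using spl[of "\<lambda>_. 1"] b(1) by (simp add: ex_1)
  moreover have "ex \<theta> (\<lambda>\<beta>. cen \<theta> i \<beta> * ?F b' \<beta>) = 0"
    using spl[of "cen \<theta> i"] z[OF b(1)] ex_cen by simp
  ultimately have "ex \<theta> (\<lambda>\<beta>. cen \<theta> i \<beta> * cen \<theta> j \<beta> * ?F b' \<beta>) = 0"
    using cond_indep[OF h(1) local_on_cen[OF h(2)] local_on_cen[OF h(3)], where \<theta> = \<theta> and b = b'] by simp
  then show ?thesis unfolding cov_def using spl[of "\<lambda>\<beta>. cen \<theta> i \<beta> * cen \<theta> j \<beta>"] z[OF b(1)] by simp
qed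

text \<open>In \<open>cov_sep\<close> one factor on the right is at most the variance on the left
  and can be cancelled against it. This bounds moments of a hidden variable from below by an
  observable covariance.\<close>

lemma cov_lower:
  assumes \<theta>: "\<theta> \<in> param_space" and h: "adj v u" "i \<in> side v u" "j \<in> V - side v u"
  shows "\<bar>cov \<theta> i j\<bar> \<le> \<bar>cov \<theta> i v\<bar>" "\<bar>cov \<theta> i j\<bar> \<le> \<bar>cov \<theta> j v\<bar>" "\<bar>cov \<theta> i j\<bar> \<le> var \<theta> v"
proof -
  have V: "v \<in> V" "i \<in> V" "j \<in> V" using h(2,3) adj_in_V[OF h(1)] side_sub[OF h(1)] by auto
  have le: "\<bar>cov \<theta> i v\<bar> \<le> var \<theta> v" "\<bar>cov \<theta> j v\<bar> \<le> var \<theta> v" using abs_cov_le[OF \<theta>] V by auto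
  have "\<bar>cov \<theta> i j\<bar> \<le> \<bar>cov \<theta> i v\<bar> \<and> \<bar>cov \<theta> i j\<bar> \<le> \<bar>cov \<theta> j v\<bar>"
  proof (cases "var \<theta> v = 0")
    case True
    then show ?thesis using cov_sep_degenerate[OF \<theta> h] by simp
  next
    case False
    then have pos: "0 < var \<theta> v" using var_bounds[OF \<theta> V(1)] by simp
    have e: "\<bar>cov \<theta> i j\<bar> * var \<theta> v = \<bar>cov \<theta> i v\<bar> * \<bar>cov \<theta> j v\<bar>"
      using arg_cong[OF cov_sep[OF h, of \<theta>], of abs] pos by (simp add: abs_mult)
    have "\<bar>cov \<theta> i j\<bar> * var \<theta> v \<le> \<bar>cov \<theta> i v\<bar> * var \<theta> v" "\<bar>cov \<theta> i j\<bar> * var \<theta> v \<le> \<bar>cov \<theta> j v\<bar> * var \<theta> v"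
      unfolding e using mult_left_mono[OF le(2), of "\<bar>cov \<theta> i v\<bar>"] mult_right_mono[OF le(1), of "\<bar>cov \<theta> j v\<bar>"]
      by (simp_all add: mult.commute)
    then show ?thesis using pos by simp
  qed
  then show "\<bar>cov \<theta> i j\<bar> \<le> \<bar>cov \<theta> i v\<bar>" "\<bar>cov \<theta> i j\<bar> \<le> \<bar>cov \<theta> j v\<bar>" "\<bar>cov \<theta> i j\<bar> \<le> var \<theta> v"
    using le by auto
qed

section \<open>The leaf distribution and its moments\<close>

abbreviation L :: "'v set" where "L \<equiv> leaves V E"

abbreviation p :: "real ^ 'k \<Rightarrow> ('v \<Rightarrow> nat) \<Rightarrow> real" where "p \<equiv> tree_map V E r coord"

lemma p_eq: "\<alpha> \<in> leaf_states V E \<Longrightarrow> p \<theta> \<alpha> = ex \<theta> (\<lambda>\<beta>. of_bool (restrict \<beta> L = \<alpha>))"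
proof -
  assume a: "\<alpha> \<in> leaf_states V E"
  have "p \<theta> \<alpha> = (\<Sum>\<beta> \<in> {\<beta> \<in> St. restrict \<beta> L = \<alpha>}. wt \<theta> \<beta>)"
    using a by (simp add: tree_map_def wt_def tree_weight_def)
  also have "\<dots> = ex \<theta> (\<lambda>\<beta>. of_bool (restrict \<beta> L = \<alpha>))"
    unfolding ex_def by (rule sum.mono_neutral_cong_left) (auto simp: finite_St)
  finally show ?thesis .
qed

lemma finite_leaf_states: "finite (leaf_states V E)"
  using finite_V leaves_sub finite_subset finite_binary_states by blast

lemma restrict_leaf_state: "\<beta> \<in> St \<Longrightarrow> restrict \<beta> L \<in> leaf_states V E"
  using leaves_sub by (auto simp: binary_states_def PiE_def Pi_def)

lemma ex_leaf:
  assumes "\<And>\<beta>. \<beta> \<in> St \<Longrightarrow> f \<beta> = g (restrict \<beta> L)"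
  shows "ex \<theta> f = (\<Sum>\<alpha>\<in>leaf_states V E. p \<theta> \<alpha> * g \<alpha>)"
proof -
  have "(\<Sum>\<alpha>\<in>leaf_states V E. p \<theta> \<alpha> * g \<alpha>) = (\<Sum>\<alpha>\<in>leaf_states V E. \<Sum>\<beta>\<in>St. wt \<theta> \<beta> * of_bool (restrict \<beta> L = \<alpha>) * g \<alpha>)"
    by (intro sum.cong) (auto simp: p_eq ex_def sum_distrib_right)
  also have "\<dots> = (\<Sum>\<beta>\<in>St. \<Sum>\<alpha>\<in>leaf_states V E. wt \<theta> \<beta> * of_bool (restrict \<beta> L = \<alpha>) * g \<alpha>)"
    by (rule sum.swap)
  also have "\<dots> = (\<Sum>\<beta>\<in>St. wt \<theta> \<beta> * f \<beta>)"
  proof (rule sum.cong[OF refl])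
    fix \<beta> assume b: "\<beta> \<in> St"
    have "(\<Sum>\<alpha>\<in>leaf_states V E. wt \<theta> \<beta> * of_bool (restrict \<beta> L = \<alpha>) * g \<alpha>) =
      (\<Sum>\<alpha>\<in>leaf_states V E. if restrict \<beta> L = \<alpha> then wt \<theta> \<beta> * g \<alpha> else 0)"
      by (rule sum.cong) auto
    also have "\<dots> = wt \<theta> \<beta> * f \<beta>"
      using restrict_leaf_state[OF b] finite_leaf_states assms[OF b] by simp
    finally show "(\<Sum>\<alpha>\<in>leaf_states V E. wt \<theta> \<beta> * of_bool (restrict \<beta> L = \<alpha>) * g \<alpha>) = wt \<theta> \<beta> * f \<beta>" .
  qed
  finally show ?thesis by (simp add: ex_def)
qed

lemma sum_p: "(\<Sum>\<alpha>\<in>leaf_states V E. p \<theta> \<alpha>) = 1"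
  using ex_leaf[where f = "\<lambda>_. 1" and g = "\<lambda>_. 1" and \<theta> = \<theta>] by (simp add: ex_1)

lemma p_nonneg: "\<theta> \<in> param_space \<Longrightarrow> \<alpha> \<in> leaf_states V E \<Longrightarrow> 0 \<le> p \<theta> \<alpha>"
  by (simp add: p_eq ex_nonneg)

lemma p_le_1: "\<theta> \<in> param_space \<Longrightarrow> \<alpha> \<in> leaf_states V E \<Longrightarrow> p \<theta> \<alpha> \<le> 1"
  using sum_p[of \<theta>] member_le_sum[of \<alpha> "leaf_states V E" "p \<theta>"] p_nonneg finite_leaf_states by auto

lemma mean_leaf: "i \<in> L \<Longrightarrow> mean \<theta> i = (\<Sum>\<alpha>\<in>leaf_states V E. p \<theta> \<alpha> * real (\<alpha> i))"
  unfolding mean_def by (rule ex_leaf) simp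

lemma cov_leaf: "i \<in> L \<Longrightarrow> j \<in> L \<Longrightarrow> cov \<theta> i j = covariance L (p \<theta>) i j"
proof -
  assume "i \<in> L" "j \<in> L"
  then have "ex \<theta> (\<lambda>\<beta>. real (\<beta> i) * real (\<beta> j)) = (\<Sum>\<alpha>\<in>leaf_states V E. p \<theta> \<alpha> * (real (\<alpha> i) * real (\<alpha> j)))"
    by (intro ex_leaf) simp
  then show ?thesis
    using \<open>i \<in> L\<close> \<open>j \<in> L\<close> by (simp add: cov_eq mean_leaf covariance_def mult.assoc)
qed

lemma third_leaf:
  assumes "i \<in> L" "j \<in> L" "k \<in> L"
  shows "third \<theta> i j k = (\<Sum>\<alpha>\<in>leaf_states V E. p \<theta> \<alpha> * ((real (\<alpha> i) - mean \<theta> i) * (real (\<alpha> j) - mean \<theta> j) * (real (\<alpha> k) - mean \<theta> k)))"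
  unfolding third_def by (rule ex_leaf) (use assms in \<open>simp add: cen_def\<close>)

lemma param_cases:
  obtains "k = coord RootParam" | w a where "w \<in> V - {r}" "a \<in> {0, 1}" "k = coord (EdgeParam w a)"
proof -
  have "k \<in> coord ` param_index V r" using coord by (auto simp: bij_betw_def)
  then show ?thesis using that by (auto simp: param_index_def)
qed

text \<open>The source of \<open>card V + card E\<close> in the theorem: it is the number
  \<open>2 * card E + 1\<close> of free parameters, because
  \<open>card V = card E + 1\<close>.\<close>

lemma card_param: "CARD('k) = card V + card E"
proof -
  have "card (param_index V r) = 1 + 2 * card (V - {r})"
  proof -
    have e: "{EdgeParam v i | v i. v \<in> V - {r} \<and> i \<in> {0, 1::nat}} = (\<lambda>(v, i). EdgeParam v i) ` ((V - {r}) \<times> {0, 1})"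
      by auto
    have "card {EdgeParam v i | v i. v \<in> V - {r} \<and> i \<in> {0, 1::nat}} = card ((V - {r}) \<times> {0, 1::nat})"
      unfolding e by (rule card_image) (auto simp: inj_on_def)
    moreover have "finite {EdgeParam v i | v i. v \<in> V - {r} \<and> i \<in> {0, 1::nat}}"
      unfolding e using finite_V by auto
    ultimately show ?thesis unfolding param_index_def by (subst card_insert_disjoint) (auto simp: card_cartesian_product)
  qed
  moreover have "CARD('k) = card (param_index V r)" using coord by (metis bij_betw_same_card)
  ultimately show ?thesis using card_E card_Suc_Diff1[OF finite_V r_in_V] by simp
qed

end


section \<open>Bounded Lipschitz functions\<close>

text \<open>A relation \<open>R\<close> is used instead of a set because some estimates need both points on the same sheet.\<close>

definition blip :: "('a \<times> 'a) set \<Rightarrow> ('a \<Rightarrow> 'a \<Rightarrow> real) \<Rightarrow> ('a \<Rightarrow> real) \<Rightarrow> bool" where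
  "blip R d f \<longleftrightarrow>
    (\<exists>B C. \<forall>x y. (x, y) \<in> R \<longrightarrow> \<bar>f x\<bar> \<le> B \<and> \<bar>f y\<bar> \<le> B \<and> \<bar>f x - f y\<bar> \<le> C * d x y)"

text \<open>The condition under which reciprocals and square roots stay Lipschitz.\<close>

definition away :: "('a \<times> 'a) set \<Rightarrow> ('a \<Rightarrow> real) \<Rightarrow> bool" where
  "away R f \<longleftrightarrow> (\<exists>c>0. \<forall>x y. (x, y) \<in> R \<longrightarrow> c \<le> \<bar>f x\<bar> \<and> c \<le> \<bar>f y\<bar>)"

lemma blipI:
  "(\<And>x y. (x, y) \<in> R \<Longrightarrow> \<bar>f x\<bar> \<le> B \<and> \<bar>f y\<bar> \<le> B \<and> \<bar>f x - f y\<bar> \<le> C * d x y) \<Longrightarrow> blip R d f"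
  unfolding blip_def by blast

lemma blipE:
  assumes "blip R d f"
  obtains B C where "\<And>x y. (x, y) \<in> R \<Longrightarrow> \<bar>f x\<bar> \<le> B" "\<And>x y. (x, y) \<in> R \<Longrightarrow> \<bar>f y\<bar> \<le> B"
    "\<And>x y. (x, y) \<in> R \<Longrightarrow> \<bar>f x - f y\<bar> \<le> C * d x y"
  using assms unfolding blip_def by blast

lemma blip_const: "blip R d (\<lambda>_. c)"
  by (rule blipI[where B = "\<bar>c\<bar>" and C = 0]) simp

lemma blip_add:
  assumes "blip R d f" "blip R d g"
  shows "blip R d (\<lambda>x. f x + g x)"
proof -
  obtain B C where f: "\<And>x y. (x, y) \<in> R \<Longrightarrow> \<bar>f x\<bar> \<le> B" "\<And>x y. (x, y) \<in> R \<Longrightarrow> \<bar>f y\<bar> \<le> B"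
    "\<And>x y. (x, y) \<in> R \<Longrightarrow> \<bar>f x - f y\<bar> \<le> C * d x y" using blipE[OF assms(1)] by metis
  obtain B' C' where g: "\<And>x y. (x, y) \<in> R \<Longrightarrow> \<bar>g x\<bar> \<le> B'" "\<And>x y. (x, y) \<in> R \<Longrightarrow> \<bar>g y\<bar> \<le> B'"
    "\<And>x y. (x, y) \<in> R \<Longrightarrow> \<bar>g x - g y\<bar> \<le> C' * d x y" using blipE[OF assms(2)] by metis
  show ?thesis
  proof (rule blipI[where B = "B + B'" and C = "C + C'"])
    fix x y assume h: "(x, y) \<in> R"
    show "\<bar>f x + g x\<bar> \<le> B + B' \<and> \<bar>f y + g y\<bar> \<le> B + B' \<and> \<bar>f x + g x - (f y + g y)\<bar> \<le> (C + C') * d x y"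
      using f[OF h] g[OF h] unfolding distrib_right by linarith
  qed
qed

lemma blip_mult:
  assumes "blip R d f" "blip R d g"
  shows "blip R d (\<lambda>x. f x * g x)"
proof -
  obtain B C where f: "\<And>x y. (x, y) \<in> R \<Longrightarrow> \<bar>f x\<bar> \<le> B" "\<And>x y. (x, y) \<in> R \<Longrightarrow> \<bar>f y\<bar> \<le> B"
    "\<And>x y. (x, y) \<in> R \<Longrightarrow> \<bar>f x - f y\<bar> \<le> C * d x y" using blipE[OF assms(1)] by metis
  obtain B' C' where g: "\<And>x y. (x, y) \<in> R \<Longrightarrow> \<bar>g x\<bar> \<le> B'" "\<And>x y. (x, y) \<in> R \<Longrightarrow> \<bar>g y\<bar> \<le> B'"
    "\<And>x y. (x, y) \<in> R \<Longrightarrow> \<bar>g x - g y\<bar> \<le> C' * d x y" using blipE[OF assms(2)] by metis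
  show ?thesis
  proof (rule blipI[where B = "B * B'" and C = "B * C' + B' * C"])
    fix x y assume h: "(x, y) \<in> R"
    have nn: "0 \<le> B" "0 \<le> B'" using f(1)[OF h] g(1)[OF h] by linarith+
    have "f x * g x - f y * g y = f x * (g x - g y) + g y * (f x - f y)" by (simp add: algebra_simps)
    then have "\<bar>f x * g x - f y * g y\<bar> \<le> \<bar>f x\<bar> * \<bar>g x - g y\<bar> + \<bar>g y\<bar> * \<bar>f x - f y\<bar>"
      by (metis abs_mult abs_triangle_ineq)
    also have "\<dots> \<le> B * (C' * d x y) + B' * (C * d x y)"
      using f[OF h] g[OF h] nn by (intro add_mono mult_mono) auto
    finally have "\<bar>f x * g x - f y * g y\<bar> \<le> (B * C' + B' * C) * d x y" by (simp add: algebra_simps)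
    moreover have "\<bar>f x * g x\<bar> \<le> B * B'" "\<bar>f y * g y\<bar> \<le> B * B'"
      unfolding abs_mult using f[OF h] g[OF h] nn by (auto intro: mult_mono)
    ultimately show "\<bar>f x * g x\<bar> \<le> B * B' \<and> \<bar>f y * g y\<bar> \<le> B * B' \<and> \<bar>f x * g x - f y * g y\<bar> \<le> (B * C' + B' * C) * d x y"
      by blast
  qed
qed

lemma blip_uminus: "blip R d f \<Longrightarrow> blip R d (\<lambda>x. - f x)"
  using blip_mult[OF blip_const[of R d "-1"], of f] by simp

lemma blip_diff: "blip R d f \<Longrightarrow> blip R d g \<Longrightarrow> blip R d (\<lambda>x. f x - g x)"
  using blip_add[OF _ blip_uminus, of R d f g] by simp

lemma blip_power: "blip R d f \<Longrightarrow> blip R d (\<lambda>x. f x ^ n)"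
  by (induction n) (auto intro: blip_const blip_mult)

lemma blip_sum: "(\<And>a. a \<in> A \<Longrightarrow> blip R d (f a)) \<Longrightarrow> blip R d (\<lambda>x. \<Sum>a\<in>A. f a x)"
  by (induction A rule: infinite_finite_induct) (auto intro: blip_const blip_add)

lemma blip_prod: "(\<And>a. a \<in> A \<Longrightarrow> blip R d (f a)) \<Longrightarrow> blip R d (\<lambda>x. \<Prod>a\<in>A. f a x)"
  by (induction A rule: infinite_finite_induct) (auto intro: blip_const blip_mult)

lemma awayE:
  assumes "away R f"
  obtains c where "0 < c" "\<And>x y. (x, y) \<in> R \<Longrightarrow> c \<le> \<bar>f x\<bar>" "\<And>x y. (x, y) \<in> R \<Longrightarrow> c \<le> \<bar>f y\<bar>"
  using assms unfolding away_def by blast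

lemma awayI: "0 < c \<Longrightarrow> (\<And>x y. (x, y) \<in> R \<Longrightarrow> c \<le> \<bar>f x\<bar> \<and> c \<le> \<bar>f y\<bar>) \<Longrightarrow> away R f"
  unfolding away_def by blast

lemma away_mult:
  assumes "away R f" "away R g"
  shows "away R (\<lambda>x. f x * g x)"
proof -
  obtain c where c: "0 < c" "\<And>x y. (x, y) \<in> R \<Longrightarrow> c \<le> \<bar>f x\<bar>" "\<And>x y. (x, y) \<in> R \<Longrightarrow> c \<le> \<bar>f y\<bar>"
    using awayE[OF assms(1)] by metis
  obtain c' where c': "0 < c'" "\<And>x y. (x, y) \<in> R \<Longrightarrow> c' \<le> \<bar>g x\<bar>" "\<And>x y. (x, y) \<in> R \<Longrightarrow> c' \<le> \<bar>g y\<bar>"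
    using awayE[OF assms(2)] by metis
  show ?thesis
    by (rule awayI[of "c * c'"]) (use c c' in \<open>auto simp: abs_mult intro!: mult_mono\<close>)
qed

lemma away_mono: "away R f \<Longrightarrow> (\<And>x y. (x, y) \<in> R \<Longrightarrow> \<bar>f x\<bar> \<le> \<bar>g x\<bar> \<and> \<bar>f y\<bar> \<le> \<bar>g y\<bar>) \<Longrightarrow> away R g"
  unfolding away_def by (meson order_trans)

lemma blip_inverse:
  assumes "blip R d f" "away R f"
  shows "blip R d (\<lambda>x. inverse (f x))"
proof -
  obtain B C where f: "\<And>x y. (x, y) \<in> R \<Longrightarrow> \<bar>f x\<bar> \<le> B" "\<And>x y. (x, y) \<in> R \<Longrightarrow> \<bar>f y\<bar> \<le> B"
    "\<And>x y. (x, y) \<in> R \<Longrightarrow> \<bar>f x - f y\<bar> \<le> C * d x y" using blipE[OF assms(1)] by metis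
  obtain c where c: "0 < c" "\<And>x y. (x, y) \<in> R \<Longrightarrow> c \<le> \<bar>f x\<bar>" "\<And>x y. (x, y) \<in> R \<Longrightarrow> c \<le> \<bar>f y\<bar>"
    using awayE[OF assms(2)] by metis
  show ?thesis
  proof (rule blipI[where B = "inverse c" and C = "inverse c * inverse c * C"])
    fix x y assume h: "(x, y) \<in> R"
    have nz: "f x \<noteq> 0" "f y \<noteq> 0" using c(1) c(2)[OF h] c(3)[OF h] by auto
    have i: "\<bar>inverse (f x)\<bar> \<le> inverse c" "\<bar>inverse (f y)\<bar> \<le> inverse c"
      using c(1) c(2)[OF h] c(3)[OF h] by (auto simp: abs_inverse intro: le_imp_inverse_le)
    have "inverse (f x) - inverse (f y) = - (inverse (f x) * inverse (f y) * (f x - f y))"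
      using nz by (simp add: field_simps)
    then have "\<bar>inverse (f x) - inverse (f y)\<bar> = \<bar>inverse (f x)\<bar> * \<bar>inverse (f y)\<bar> * \<bar>f x - f y\<bar>"
      by (simp only: abs_minus_cancel abs_mult)
    also have "\<dots> \<le> inverse c * inverse c * (C * d x y)"
      using i f(3)[OF h] c(1) by (intro mult_mono) auto
    finally show "\<bar>inverse (f x)\<bar> \<le> inverse c \<and> \<bar>inverse (f y)\<bar> \<le> inverse c \<and>
      \<bar>inverse (f x) - inverse (f y)\<bar> \<le> inverse c * inverse c * C * d x y" using i by (simp add: mult.assoc)
  qed
qed

lemma blip_divide: "blip R d f \<Longrightarrow> blip R d g \<Longrightarrow> away R g \<Longrightarrow> blip R d (\<lambda>x. f x / g x)"
  unfolding divide_inverse by (intro blip_mult blip_inverse)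

text \<open>Since \<open>f x\<close> and \<open>f y\<close> have the same sign, their sum is bounded
  away from zero, and the difference of the squares can be divided by it.\<close>

lemma blip_of_square:
  assumes "blip R d (\<lambda>x. f x ^ 2)" "away R f" and sg: "\<And>x y. (x, y) \<in> R \<Longrightarrow> 0 < f x * f y"
  shows "blip R d f"
proof -
  obtain B C where f: "\<And>x y. (x, y) \<in> R \<Longrightarrow> \<bar>f x ^ 2\<bar> \<le> B" "\<And>x y. (x, y) \<in> R \<Longrightarrow> \<bar>f y ^ 2\<bar> \<le> B"
    "\<And>x y. (x, y) \<in> R \<Longrightarrow> \<bar>f x ^ 2 - f y ^ 2\<bar> \<le> C * d x y" using blipE[OF assms(1)] by metis
  obtain c where c: "0 < c" "\<And>x y. (x, y) \<in> R \<Longrightarrow> c \<le> \<bar>f x\<bar>" "\<And>x y. (x, y) \<in> R \<Longrightarrow> c \<le> \<bar>f y\<bar>"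
    using awayE[OF assms(2)] by metis
  have ab: "\<bar>t\<bar> \<le> 1 + B" if "\<bar>t ^ 2\<bar> \<le> B" for t :: real
  proof -
    have "0 \<le> (\<bar>t\<bar> - 1) ^ 2" "0 \<le> t ^ 2" by auto
    then show ?thesis using that by (simp add: power2_diff)
  qed
  show ?thesis
  proof (rule blipI[where B = "1 + B" and C = "C / c"])
    fix x y assume h: "(x, y) \<in> R"
    have s: "c \<le> \<bar>f x + f y\<bar>" using sg[OF h] c(1) c(2)[OF h] c(3)[OF h] by (auto simp: zero_less_mult_iff)
    have "\<bar>f x - f y\<bar> * c \<le> \<bar>f x - f y\<bar> * \<bar>f x + f y\<bar>" using s by (intro mult_left_mono) auto
    also have "\<dots> = \<bar>f x ^ 2 - f y ^ 2\<bar>" by (simp add: power2_eq_square algebra_simps flip: abs_mult)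
    also have "\<dots> \<le> C * d x y" by (rule f(3)[OF h])
    finally have "\<bar>f x - f y\<bar> \<le> C / c * d x y" using c(1) by (simp add: field_simps)
    then show "\<bar>f x\<bar> \<le> 1 + B \<and> \<bar>f y\<bar> \<le> 1 + B \<and> \<bar>f x - f y\<bar> \<le> C / c * d x y"
      using ab f(1)[OF h] f(2)[OF h] by blast
  qed
qed

text \<open>As \<open>d\<close> is nonnegative on \<open>R\<close>, the finitely many constants can
  be enlarged to a common one.\<close>

lemma blip_uniform:
  assumes "\<And>a. a \<in> A \<Longrightarrow> blip R d (f a)" "finite A" and d: "\<And>x y. (x, y) \<in> R \<Longrightarrow> 0 \<le> d x y"
  obtains C where "0 < C" "\<And>a x y. a \<in> A \<Longrightarrow> (x, y) \<in> R \<Longrightarrow> \<bar>f a x - f a y\<bar> \<le> C * d x y"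
proof -
  have "\<forall>a\<in>A. \<exists>C. \<forall>x y. (x, y) \<in> R \<longrightarrow> \<bar>f a x - f a y\<bar> \<le> C * d x y"
  proof
    fix a assume "a \<in> A"
    then obtain B C where "\<And>x y. (x, y) \<in> R \<Longrightarrow> \<bar>f a x - f a y\<bar> \<le> C * d x y"
      using assms(1) blipE by metis
    then show "\<exists>C. \<forall>x y. (x, y) \<in> R \<longrightarrow> \<bar>f a x - f a y\<bar> \<le> C * d x y" by blast
  qed
  then obtain C where "\<forall>a\<in>A. \<forall>x y. (x, y) \<in> R \<longrightarrow> \<bar>f a x - f a y\<bar> \<le> C a * d x y"
    by (rule bchoice[THEN exE])
  then have C: "\<And>a x y. a \<in> A \<Longrightarrow> (x, y) \<in> R \<Longrightarrow> \<bar>f a x - f a y\<bar> \<le> C a * d x y"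
    by blast
  have "\<bar>f a x - f a y\<bar> \<le> (1 + (\<Sum>a\<in>A. \<bar>C a\<bar>)) * d x y" if h: "a \<in> A" "(x, y) \<in> R" for a x y
  proof -
    have "\<bar>C a\<bar> \<le> (\<Sum>a\<in>A. \<bar>C a\<bar>)" using member_le_sum[of a A "\<lambda>a. \<bar>C a\<bar>"] h assms(2) by auto
    then have "C a \<le> 1 + (\<Sum>a\<in>A. \<bar>C a\<bar>)" by linarith
    then show ?thesis using C[OF h] d[OF h(2)] mult_right_mono[of "C a" "1 + (\<Sum>a\<in>A. \<bar>C a\<bar>)" "d x y"] by linarith
  qed
  moreover have "0 < 1 + (\<Sum>a\<in>A. \<bar>C a\<bar>)" by (intro add_pos_nonneg sum_nonneg) auto
  ultimately show ?thesis using that by blast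
qed

section \<open>Volumes of cubes and coverings by cubes\<close>

lemma emeasure_cube:
  fixes x :: "real ^ 'k::finite"
  assumes "0 \<le> r"
  shows "emeasure lborel (cbox (\<chi> k. x $ k - r) (\<chi> k. x $ k + r)) = ennreal ((2 * r) ^ CARD('k))"
proof -
  have i: "((\<chi> k. x $ k + r) - (\<chi> k. x $ k - r)) \<bullet> b = 2 * r" if b: "b \<in> Basis" for b
  proof -
    obtain k where "b = axis k 1" using b by (auto simp: Basis_vec_def)
    then show ?thesis by (simp add: inner_axis)
  qed
  then have "(\<chi> k. x $ k - r) \<bullet> b \<le> (\<chi> k. x $ k + r) \<bullet> b" if "b \<in> Basis" for b
    using i[OF that] assms by (simp add: inner_diff_left)
  then have "emeasure lborel (cbox (\<chi> k. x $ k - r) (\<chi> k. x $ k + r)) =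
      ennreal (\<Prod>b\<in>(Basis :: (real ^ 'k) set). ((\<chi> k. x $ k + r) - (\<chi> k. x $ k - r)) \<bullet> b)"
    by (rule emeasure_lborel_cbox)
  also have "(\<Prod>b\<in>(Basis :: (real ^ 'k) set). ((\<chi> k. x $ k + r) - (\<chi> k. x $ k - r)) \<bullet> b) = (2 * r) ^ CARD('k)"
    by (simp add: i)
  finally show ?thesis .
qed

text \<open>The points of \<open>S\<close> with a given value of \<open>f\<close> lie in the cube of
  side \<open>2 * r\<close> around any one of them.\<close>

lemma emeasure_cover:
  fixes S :: "(real ^ 'k::finite) set" and f :: "real ^ 'k \<Rightarrow> 'c"
  assumes fin: "finite (f ` S)" and M: "real (card (f ` S)) \<le> M" and r: "0 \<le> r"
    and close: "\<And>x y k. x \<in> S \<Longrightarrow> y \<in> S \<Longrightarrow> f x = f y \<Longrightarrow> \<bar>x $ k - y $ k\<bar> \<le> r"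
  shows "emeasure lborel S \<le> ennreal (M * (2 * r) ^ CARD('k))"
proof -
  define g where "g c = (SOME x. x \<in> S \<and> f x = c)" for c
  have g: "g c \<in> S \<and> f (g c) = c" if "c \<in> f ` S" for c
    unfolding g_def by (rule someI_ex) (use that in blast)
  let ?Q = "\<lambda>c. cbox (\<chi> k. g c $ k - r) (\<chi> k. g c $ k + r)"
  have "S \<subseteq> (\<Union>c\<in>f ` S. ?Q c)"
  proof
    fix x assume x: "x \<in> S"
    have "\<bar>x $ k - g (f x) $ k\<bar> \<le> r" for k using close[of x "g (f x)"] g[of "f x"] x by auto
    then have "x \<in> ?Q (f x)" by (simp add: mem_box_cart abs_le_iff) (smt (verit))
    then show "x \<in> (\<Union>c\<in>f ` S. ?Q c)" using x by blast
  qed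
  then have "emeasure lborel S \<le> emeasure lborel (\<Union>c\<in>f ` S. ?Q c)"
    by (rule emeasure_mono) (intro sets.finite_UN[OF fin], simp)
  also have "\<dots> \<le> (\<Sum>c\<in>f ` S. emeasure lborel (?Q c))"
    by (rule emeasure_subadditive_finite[OF fin]) (rule image_subsetI, simp)
  also have "\<dots> = ennreal (real (card (f ` S)) * (2 * r) ^ CARD('k))"
    unfolding emeasure_cube[OF r] using r by (simp add: ennreal_mult ennreal_of_nat_eq_real_of_nat)
  also have "\<dots> \<le> ennreal (M * (2 * r) ^ CARD('k))"
    using M r by (intro ennreal_leI mult_right_mono) auto
  finally show ?thesis .
qed


section \<open>Recovering the parameters\<close>

lemma blip_cong:
  "blip R d g \<Longrightarrow> (\<And>x y. (x, y) \<in> R \<Longrightarrow> f x = g x \<and> f y = g y) \<Longrightarrow> blip R d f"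
  unfolding blip_def by metis

lemma away_nonzero: "away R f \<Longrightarrow> (x, y) \<in> R \<Longrightarrow> f x \<noteq> 0 \<and> f y \<noteq> 0"
  unfolding away_def by fastforce

text \<open>The relations between moments are stated without division; this is the place where they
  are solved, with the divisor bounded away from zero.\<close>

lemma blip_solve:
  assumes "blip R d h" "blip R d g" "away R g" "\<And>x. f x * g x = h x"
  shows "blip R d f"
proof (rule blip_cong[OF blip_divide[OF assms(1-3)]])
  fix x y assume "(x, y) \<in> R"
  then have "g x \<noteq> 0" "g y \<noteq> 0" using away_nonzero[OF assms(3)] by auto
  then show "f x = h x / g x \<and> f y = h y / g y" using assms(4) by (simp add: field_simps)
qed

context tree_model
begin

text \<open>These moments are polynomials in the leaf probabilities.\<close>

lemma blip_leaf_moments: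
  assumes p': "\<forall>\<alpha>\<in>leaf_states V E. blip R d (\<lambda>\<theta>. p \<theta> \<alpha>)" and i: "i \<in> L"
  shows "blip R d (\<lambda>\<theta>. mean \<theta> i)"
    and "j \<in> L \<Longrightarrow> blip R d (\<lambda>\<theta>. cov \<theta> i j)"
    and "j \<in> L \<Longrightarrow> k \<in> L \<Longrightarrow> blip R d (\<lambda>\<theta>. third \<theta> i j k)"
proof -
  note p = p'[rule_format]
  have m: "blip R d (\<lambda>\<theta>. mean \<theta> i)" if "i \<in> L" for i
    using that by (simp add: mean_leaf) (intro blip_sum blip_mult p blip_const)
  show "blip R d (\<lambda>\<theta>. mean \<theta> i)" by (rule m[OF i])
  show "blip R d (\<lambda>\<theta>. cov \<theta> i j)" if "j \<in> L"
    using i that unfolding cov_leaf[OF i that] covariance_def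
    by (intro blip_diff blip_sum blip_mult p blip_const)
  show "blip R d (\<lambda>\<theta>. third \<theta> i j k)" if "j \<in> L" "k \<in> L"
    using i that by (simp add: third_leaf) (intro blip_diff blip_sum blip_mult p blip_const m)
qed

end

locale fitted_model = tree_model V E r coord
  for V :: "'v set" and E r and coord :: "'v param \<Rightarrow> 'k::finite" +
  fixes phat :: "('v \<Rightarrow> nat) \<Rightarrow> real"
  assumes phat_model: "phat \<in> markov_model V E r coord"
    and phat_pos: "\<And>\<alpha>. \<alpha> \<in> leaf_states V E \<Longrightarrow> phat \<alpha> > 0"
    and no_degenerate: "\<nexists>v. degenerate_node V E phat v"
begin

section \<open>Pairs and triples of leaves with nonzero covariance\<close>

abbreviation live :: "'v \<Rightarrow> 'v \<Rightarrow> bool" where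
  "live i j \<equiv> covariance L phat i j \<noteq> 0"

abbreviation l2 :: "'v set" where "l2 \<equiv> l2_nodes V E phat"

lemma l2_sub: "l2 \<subseteq> inner_nodes V E" "l2 \<subseteq> V" "finite l2"
  using finite_V by (auto simp: l2_nodes_def inner_nodes_def intro: finite_subset)

lemma phat_cov: "i \<in> L \<Longrightarrow> j \<in> L \<Longrightarrow> p \<theta> = phat \<Longrightarrow> cov \<theta> i j = covariance L phat i j"
  using cov_leaf by simp

text \<open>The states with all leaves 1 and with all leaves 0 have positive probability, so the
  mean of a leaf is neither 0 nor 1.\<close>

lemma live_self: "i \<in> L \<Longrightarrow> live i i"
proof -
  assume i: "i \<in> L"
  obtain \<theta> where \<theta>: "\<theta> \<in> param_space" "p \<theta> = phat" using phat_model by (auto simp: markov_model_def)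
  have st: "(\<lambda>x\<in>L. b) \<in> leaf_states V E" if "b \<in> {0, 1}" for b :: nat
    using that by (auto simp: binary_states_def)
  have "0 < (\<Sum>\<alpha>\<in>leaf_states V E. phat \<alpha> * real (\<alpha> i))"
    by (rule sum_pos2[OF finite_leaf_states st[of 1]]) (use i phat_pos[OF st[of 1]] phat_pos in \<open>auto intro!: mult_nonneg_nonneg intro: less_imp_le\<close>)
  then have m0: "0 < mean \<theta> i" using mean_leaf[OF i] \<theta> by simp
  have "0 < (\<Sum>\<alpha>\<in>leaf_states V E. phat \<alpha> * (1 - real (\<alpha> i)))"
    by (rule sum_pos2[OF finite_leaf_states st[of 0]])
      (use i phat_pos[OF st[of 0]] phat_pos in \<open>auto intro!: mult_nonneg_nonneg intro: less_imp_le dest: binary_states_val[OF _ i]\<close>)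
  also have "(\<Sum>\<alpha>\<in>leaf_states V E. phat \<alpha> * (1 - real (\<alpha> i))) = 1 - mean \<theta> i"
    using sum_p[of \<theta>] \<theta> mean_leaf[OF i, of \<theta>] by (simp add: algebra_simps sum_subtractf)
  finally have "0 < var \<theta> i" using m0 by (simp add: var_def)
  then show ?thesis using cov_self[of i \<theta>] phat_cov[OF i i \<theta>(2)] i leaves_sub by auto
qed

definition sep_pair :: "'v \<Rightarrow> 'v \<Rightarrow> 'v \<Rightarrow> 'v \<Rightarrow> bool" where
  "sep_pair v u i j \<longleftrightarrow> adj v u \<and> i \<in> L \<and> j \<in> L \<and> i \<in> side v u \<and> j \<in> V - side v u \<and> live i j"

lemma separates_sep_pair:
  assumes "v \<in> inner_nodes V E" "i \<in> L" "j \<in> L" "separates E v i j" "live i j"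
  obtains u where "sep_pair v u i j"
proof -
  have "i \<noteq> v" "j \<noteq> v" using assms by (auto simp: inner_nodes_def)
  then show ?thesis using separatesD[OF assms(4)] assms that unfolding sep_pair_def by metis
qed

lemma inner_pair:
  assumes "v \<in> inner_nodes V E"
  obtains u i j where "sep_pair v u i j"
proof -
  obtain i j where "i \<in> L" "j \<in> L" "separates E v i j" "live i j"
    using no_degenerate assms unfolding degenerate_node_def by blast
  then show ?thesis using separates_sep_pair[OF assms] that by metis
qed

text \<open>A non-degenerate node satisfies the second clause in the definition of
  \<open>l2_nodes\<close>; outside \<open>l2\<close> it is therefore the first clause that
  fails.\<close>

lemma inner_triple:
  assumes v: "v \<in> inner_nodes V E" "v \<notin> l2"
  obtains u u' i j k where "sep_pair v u i j" "sep_pair v u i k" "sep_pair v u' j k"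
proof -
  obtain a b where "a \<in> L" "b \<in> L" "separates E v a b" "live a b"
    using no_degenerate v unfolding degenerate_node_def by blast
  then obtain i j k where h: "i \<in> L" "j \<in> L" "k \<in> L"
      "separates E v i j" "separates E v i k" "separates E v j k" "live i j" "live i k" "live j k"
    using v unfolding l2_nodes_def by auto
  obtain u where u: "sep_pair v u i j" using separates_sep_pair[OF v(1)] h by metis
  obtain u1 where u1: "sep_pair v u1 i k" using separates_sep_pair[OF v(1)] h by metis
  obtain u' where u': "sep_pair v u' j k" using separates_sep_pair[OF v(1)] h by metis
  \<comment> \<open>\<open>i\<close> lies in only one of the disjoint components around
    \<open>v\<close>.\<close>
  have "u1 = u" using u u1 side_disjoint[of v u u1] unfolding sep_pair_def by blast
  then show ?thesis using that u u1 u' by blast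
qed

text \<open>The reference leaf of \<open>v\<close>: the sign of its covariance with \<open>v\<close>
  will label the two states of \<open>Y\<^sub>v\<close>, and outside \<open>l2\<close> it belongs to
  a triple that determines the law of \<open>Y\<^sub>v\<close>.\<close>

definition good_leaf :: "'v \<Rightarrow> 'v \<Rightarrow> bool" where
  "good_leaf v i \<longleftrightarrow> (\<exists>u j. sep_pair v u i j) \<and>
     (v \<notin> l2 \<longrightarrow> (\<exists>u u' j k. sep_pair v u i j \<and> sep_pair v u i k \<and> sep_pair v u' j k))"

definition lf :: "'v \<Rightarrow> 'v" where "lf v = (SOME i. good_leaf v i)"

lemma good_lf: "v \<in> inner_nodes V E \<Longrightarrow> good_leaf v (lf v)"
proof -
  assume v: "v \<in> inner_nodes V E"
  have "\<exists>i. good_leaf v i"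
  proof (cases "v \<in> l2")
    case True
    then show ?thesis using inner_pair[OF v] unfolding good_leaf_def by metis
  next
    case False
    then show ?thesis using inner_triple[OF v False] unfolding good_leaf_def by metis
  qed
  then show ?thesis unfolding lf_def by (rule someI_ex)
qed

definition dev :: "real ^ 'k \<Rightarrow> real" where
  "dev \<theta> = (\<Sum>\<alpha>\<in>leaf_states V E. \<bar>p \<theta> \<alpha> - phat \<alpha>\<bar>)"

text \<open>Keeps of the closeness to the fibre just what the recovery of the parameters needs: a
  uniform lower bound on the covariances that must not vanish.\<close>

definition near_fibre :: "real \<Rightarrow> (real ^ 'k) set" where
  "near_fibre e = {\<theta> \<in> param_space. \<forall>i\<in>L. \<forall>j\<in>L. live i j \<longrightarrow> e \<le> \<bar>cov \<theta> i j\<bar>}"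

text \<open>Leaf covariances are Lipschitz functions of the leaf distribution. The relation
  \<open>R\<close> compares every parameter with one fixed point of the fibre, so that
  \<open>d\<close> becomes \<open>dev\<close>.\<close>

lemma live_lower:
  obtains e where "0 < e" "\<And>\<theta>. \<theta> \<in> param_space \<Longrightarrow> dev \<theta> \<le> e \<Longrightarrow> \<theta> \<in> near_fibre e"
proof -
  obtain \<theta>s :: "real ^ 'k" where \<theta>s: "\<theta>s \<in> param_space" "p \<theta>s = phat" using phat_model by (auto simp: markov_model_def)
  define R where "R = {(\<theta>, \<theta>s) | \<theta> :: real ^ 'k. \<theta> \<in> param_space}"
  define d where "d \<theta> \<theta>' = (\<Sum>\<alpha>\<in>leaf_states V E. \<bar>p \<theta> \<alpha> - p \<theta>' \<alpha>\<bar>)" for \<theta> \<theta>' :: "real ^ 'k"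
  have finL: "finite L" using finite_V leaves_sub finite_subset by blast
  have p: "blip R d (\<lambda>\<theta>. p \<theta> \<alpha>)" if a: "\<alpha> \<in> leaf_states V E" for \<alpha>
  proof (rule blipI[where B = 1 and C = 1])
    fix \<theta> \<theta>' assume "(\<theta>, \<theta>') \<in> R"
    then have "\<theta> \<in> param_space" "\<theta>' \<in> param_space" using \<theta>s by (auto simp: R_def)
    moreover have "\<bar>p \<theta> \<alpha> - p \<theta>' \<alpha>\<bar> \<le> d \<theta> \<theta>'"
      unfolding d_def using member_le_sum[OF a, of "\<lambda>\<alpha>. \<bar>p \<theta> \<alpha> - p \<theta>' \<alpha>\<bar>"] finite_leaf_states by simp
    ultimately show "\<bar>p \<theta> \<alpha>\<bar> \<le> 1 \<and> \<bar>p \<theta>' \<alpha>\<bar> \<le> 1 \<and> \<bar>p \<theta> \<alpha> - p \<theta>' \<alpha>\<bar> \<le> 1 * d \<theta> \<theta>'"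
      using p_nonneg p_le_1 a by (simp add: abs_le_iff)
  qed
  obtain C where C: "0 < C" "\<And>ij \<theta> \<theta>'. ij \<in> L \<times> L \<Longrightarrow> (\<theta>, \<theta>') \<in> R \<Longrightarrow>
      \<bar>cov \<theta> (fst ij) (snd ij) - cov \<theta>' (fst ij) (snd ij)\<bar> \<le> C * d \<theta> \<theta>'"
    by (rule blip_uniform[of "L \<times> L" R d "\<lambda>ij \<theta>. cov \<theta> (fst ij) (snd ij)"])
      (use blip_leaf_moments(2)[of R d] p finL in \<open>auto simp: d_def sum_nonneg\<close>)
  \<comment> \<open>The inserted 1 gives a positive minimum also for an empty set of pairs.\<close>
  define S where "S = insert 1 ((\<lambda>ij. \<bar>covariance L phat (fst ij) (snd ij)\<bar>) ` {ij \<in> L \<times> L. live (fst ij) (snd ij)})"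
  have finS: "finite S" unfolding S_def using finL by auto
  have m: "0 < Min S" using finS by (subst Min_gr_iff) (auto simp: S_def)
  \<comment> \<open>A covariance changes by at most \<open>C * e\<close>, which is half of the
    minimum; the remaining half must still be at least \<open>e\<close>.\<close>
  define e where "e = min (Min S / 2) (Min S / (2 * C))"
  have e: "0 < e" "e \<le> Min S / 2" "C * e \<le> Min S / 2"
  proof -
    show "0 < e" "e \<le> Min S / 2" using m C(1) by (auto simp: e_def)
    have "C * e \<le> C * (Min S / (2 * C))" using C(1) by (intro mult_left_mono) (auto simp: e_def)
    then show "C * e \<le> Min S / 2" using C(1) by simp
  qed
  have lower: "e \<le> \<bar>cov \<theta> i j\<bar>"
    if h: "\<theta> \<in> param_space" "dev \<theta> \<le> e" "i \<in> L" "j \<in> L" "live i j" for \<theta> i j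
  proof -
    have "\<bar>cov \<theta> i j - cov \<theta>s i j\<bar> \<le> C * d \<theta> \<theta>s" using C(2)[of "(i, j)" \<theta> \<theta>s] h by (simp add: R_def)
    also have "d \<theta> \<theta>s = dev \<theta>" by (simp add: d_def dev_def \<theta>s(2))
    also have "C * dev \<theta> \<le> C * e" using h C(1) by (intro mult_left_mono) auto
    finally have "\<bar>cov \<theta> i j - cov \<theta>s i j\<bar> \<le> Min S / 2" using e(3) by linarith
    moreover have "Min S \<le> \<bar>cov \<theta>s i j\<bar>"
      unfolding phat_cov[OF h(3,4) \<theta>s(2)] by (rule Min_le[OF finS]) (use h in \<open>force simp: S_def\<close>)
    ultimately show ?thesis using e(2) by linarith
  qed
  show ?thesis by (rule that[OF e(1)]) (use lower in \<open>auto simp: near_fibre_def\<close>)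
qed

lemma pair_away:
  assumes near: "R \<subseteq> near_fibre e \<times> near_fibre e" and e: "0 < e"
    and s: "sep_pair v u i j"
  shows "away R (\<lambda>\<theta>. cov \<theta> i v)" "away R (\<lambda>\<theta>. cov \<theta> j v)" "away R (\<lambda>\<theta>. var \<theta> v)" "away R (\<lambda>\<theta>. cov \<theta> i j)"
proof -
  have s': "adj v u" "i \<in> side v u" "j \<in> V - side v u" and l: "i \<in> L" "j \<in> L" "live i j"
    using s by (auto simp: sep_pair_def)
  have *: "\<theta> \<in> param_space" "\<theta>' \<in> param_space" "e \<le> \<bar>cov \<theta> i j\<bar>" "e \<le> \<bar>cov \<theta>' i j\<bar>" if "(\<theta>, \<theta>') \<in> R" for \<theta> \<theta>'
    using that l near by (auto simp: near_fibre_def)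
  note cl = cov_lower[OF _ s']
  show "away R (\<lambda>\<theta>. cov \<theta> i j)" by (rule awayI[OF e]) (use * in blast)
  show "away R (\<lambda>\<theta>. cov \<theta> i v)" by (rule awayI[OF e]) (use * cl(1) order_trans in blast)
  show "away R (\<lambda>\<theta>. cov \<theta> j v)" by (rule awayI[OF e]) (use * cl(2) order_trans in blast)
  show "away R (\<lambda>\<theta>. var \<theta> v)" by (rule awayI[OF e]) (use * cl(3) order_trans abs_ge_self in meson)
qed

text \<open>The parameters are recovered from the leaf distribution and, at every \<open>l\<^sub>2\<close>-node, the mean of
  \<open>Y\<^sub>v\<close> and its covariance with one leaf; at the other inner nodes the labels of the two hidden states
  are fixed by the sign of such a covariance.\<close>

lemma blip_param:
  assumes near: "R \<subseteq> near_fibre e \<times> near_fibre e" and e: "0 < e"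
    and sg: "\<And>\<theta> \<theta>' v. (\<theta>, \<theta>') \<in> R \<Longrightarrow> v \<in> inner_nodes V E \<Longrightarrow> 0 < cov \<theta> (lf v) v * cov \<theta>' (lf v) v"
    and p: "\<And>\<alpha>. \<alpha> \<in> leaf_states V E \<Longrightarrow> blip R d (\<lambda>\<theta>. p \<theta> \<alpha>)"
    and l2: "\<And>v. v \<in> l2 \<Longrightarrow> blip R d (\<lambda>\<theta>. mean \<theta> v) \<and> blip R d (\<lambda>\<theta>. cov \<theta> (lf v) v)"
  shows "blip R d (\<lambda>\<theta>. \<theta> $ k)"
proof -
  have R: "\<theta> \<in> param_space \<and> \<theta>' \<in> param_space \<and> e \<le> \<bar>cov \<theta> i j\<bar> \<and> e \<le> \<bar>cov \<theta>' i j\<bar>"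
    if "(\<theta>, \<theta>') \<in> R" "i \<in> L" "j \<in> L" "live i j" for \<theta> \<theta>' i j
    using that near by (auto simp: near_fibre_def)
  have R': "\<theta> \<in> param_space \<and> \<theta>' \<in> param_space" if "(\<theta>, \<theta>') \<in> R" for \<theta> \<theta>'
    using that near by (auto simp: near_fibre_def)
  have "\<forall>\<alpha>\<in>leaf_states V E. blip R d (\<lambda>\<theta>. p \<theta> \<alpha>)" using p by blast
  note lm = blip_leaf_moments[OF this]
  note aw = pair_away[OF near e]
  have basic: "blip R d (\<lambda>\<theta>. mean \<theta> v) \<and> blip R d (\<lambda>\<theta>. cov \<theta> (lf v) v)" if v: "v \<in> inner_nodes V E" for v
  proof (cases "v \<in> l2")
    case True
    then show ?thesis by (rule l2)
  next
    case False
    let ?i = "lf v"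
    obtain u u' j k where s: "sep_pair v u ?i j" "sep_pair v u ?i k" "sep_pair v u' j k"
      using good_lf[OF v] False unfolding good_leaf_def by blast
    have l: "?i \<in> L" "j \<in> L" "k \<in> L" using s by (auto simp: sep_pair_def)
    let ?ij = "\<lambda>\<theta>. cov \<theta> ?i j" and ?ik = "\<lambda>\<theta>. cov \<theta> ?i k" and ?jk = "\<lambda>\<theta>. cov \<theta> j k" and ?t = "\<lambda>\<theta>. third \<theta> ?i j k"
    \<comment> \<open>With \<open>a\<close>, \<open>b\<close>, \<open>c\<close> the covariances of
      the three leaves with \<open>v\<close>, and \<open>\<sigma>\<close> and \<open>m\<close> the
      variance and mean of \<open>Y\<^sub>v\<close>, \<open>D\<close> is
      \<open>(a * b * c)^2 / \<sigma>^3\<close>. As \<open>(1 - 2 * m)^2 + 4 * \<sigma> = 1\<close>,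
      the sum \<open>?t^2 + 4 * D\<close> is \<open>(a * b * c)^2 / \<sigma>^4\<close>. So leaf
      moments give the variance, then the square of \<open>a\<close> and, once its sign is fixed,
      the mean.\<close>
    define D where "D \<theta> = ?ij \<theta> * ?ik \<theta> * ?jk \<theta>" for \<theta>
    have facts: "0 < D \<theta>" "var \<theta> v = D \<theta> / (?t \<theta> ^ 2 + 4 * D \<theta>)"
      "cov \<theta> ?i v ^ 2 = ?ij \<theta> * ?ik \<theta> * var \<theta> v / ?jk \<theta>"
      "1 - 2 * mean \<theta> v = ?t \<theta> * var \<theta> v / (cov \<theta> ?i v * ?jk \<theta>)"
      if \<theta>: "\<theta> \<in> param_space" and nz: "?ij \<theta> \<noteq> 0" "?ik \<theta> \<noteq> 0" "?jk \<theta> \<noteq> 0" for \<theta>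
    proof -
      define a b c \<sigma> m where "a = cov \<theta> ?i v" and "b = cov \<theta> j v" and "c = cov \<theta> k v" and "\<sigma> = var \<theta> v" and "m = mean \<theta> v"
      have adj: "adj v u" "adj v u'" using s by (auto simp: sep_pair_def)
      have "0 < \<bar>?ij \<theta>\<bar>" "\<bar>?ij \<theta>\<bar> \<le> var \<theta> v" using s(1) nz cov_lower(3)[OF \<theta>] by (auto simp: sep_pair_def)
      then have \<sigma>: "0 < \<sigma>" unfolding \<sigma>_def by linarith
      have e1: "?ij \<theta> * \<sigma> = a * b" "?ik \<theta> * \<sigma> = a * c" "?jk \<theta> * \<sigma> = b * c"
        using s cov_sep unfolding a_def b_def c_def \<sigma>_def sep_pair_def by blast+
      have e2: "?t \<theta> * \<sigma> ^ 2 = a * b * c * (1 - 2 * m)"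
        unfolding a_def b_def c_def \<sigma>_def m_def by (rule third_sep[of v u _ _ _ u']) (use s in \<open>auto simp: sep_pair_def\<close>)
      have sm: "\<sigma> = m * (1 - m)" by (simp add: \<sigma>_def m_def var_def)
      have abc: "a \<noteq> 0" "b \<noteq> 0" "c \<noteq> 0" using e1 nz \<sigma> by auto
      have ij: "?ij \<theta> = a * b / \<sigma>" "?ik \<theta> = a * c / \<sigma>" "?jk \<theta> = b * c / \<sigma>"
        using e1 \<sigma> by (auto simp: field_simps)
      have t: "?t \<theta> = a * b * c * (1 - 2 * m) / \<sigma> ^ 2" using e2 \<sigma> by (auto simp: field_simps)
      have D: "D \<theta> = (a * b * c) ^ 2 / \<sigma> ^ 3" unfolding D_def ij by (simp add: power2_eq_square power3_eq_cube)
      show "0 < D \<theta>" unfolding D using abc \<sigma> by simp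
      have "?t \<theta> ^ 2 + 4 * D \<theta> = (a * b * c) ^ 2 / \<sigma> ^ 4 * ((1 - 2 * m) ^ 2 + 4 * \<sigma>)"
        unfolding D t using \<sigma> by (simp add: field_simps power2_eq_square power3_eq_cube power4_eq_xxxx)
      also have "(1 - 2 * m) ^ 2 + 4 * \<sigma> = 1" unfolding sm by (simp add: power2_eq_square algebra_simps)
      finally have "D \<theta> / (?t \<theta> ^ 2 + 4 * D \<theta>) = ((a * b * c) ^ 2 / \<sigma> ^ 3) / ((a * b * c) ^ 2 / \<sigma> ^ 4)"
        unfolding D by simp
      also have "\<dots> = \<sigma>" using abc \<sigma> by (simp add: field_simps power3_eq_cube power4_eq_xxxx)
      finally show "var \<theta> v = D \<theta> / (?t \<theta> ^ 2 + 4 * D \<theta>)" unfolding \<sigma>_def by simp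
      show "cov \<theta> ?i v ^ 2 = ?ij \<theta> * ?ik \<theta> * var \<theta> v / ?jk \<theta>"
        unfolding ij a_def[symmetric] \<sigma>_def[symmetric] using abc \<sigma> by (simp add: field_simps power2_eq_square)
      show "1 - 2 * mean \<theta> v = ?t \<theta> * var \<theta> v / (cov \<theta> ?i v * ?jk \<theta>)"
        unfolding ij t a_def[symmetric] \<sigma>_def[symmetric] m_def[symmetric] using abc \<sigma> by (simp add: field_simps power2_eq_square)
    qed
    have Rf: "\<theta> \<in> param_space" "?ij \<theta> \<noteq> 0" "?ik \<theta> \<noteq> 0" "?jk \<theta> \<noteq> 0"
      "\<theta>' \<in> param_space" "?ij \<theta>' \<noteq> 0" "?ik \<theta>' \<noteq> 0" "?jk \<theta>' \<noteq> 0" if "(\<theta>, \<theta>') \<in> R" for \<theta> \<theta>'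
      using R[OF that, of ?i j] R[OF that, of ?i k] R[OF that, of j k] s e unfolding sep_pair_def by auto
    have Dl: "blip R d D" unfolding D_def by (intro blip_mult lm(2) l)
    have aD: "away R D" unfolding D_def by (intro away_mult aw(4)[OF s(1)] aw(4)[OF s(2)] aw(4)[OF s(3)])
    have bt: "blip R d ?t" by (intro lm(3) l)
    \<comment> \<open>Since \<open>D\<close> is positive, adding a square and multiplying
      \<open>D\<close> by 4 only enlarges it.\<close>
    have aE: "away R (\<lambda>\<theta>. ?t \<theta> ^ 2 + 4 * D \<theta>)"
    proof (rule away_mono[OF aD])
      have "\<bar>D \<theta>\<bar> \<le> \<bar>?t \<theta> ^ 2 + 4 * D \<theta>\<bar>" if "0 < D \<theta>" for \<theta>
        using that zero_le_power2[of "?t \<theta>"] by linarith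
      then show "\<bar>D \<theta>\<bar> \<le> \<bar>?t \<theta> ^ 2 + 4 * D \<theta>\<bar> \<and> \<bar>D \<theta>'\<bar> \<le> \<bar>?t \<theta>' ^ 2 + 4 * D \<theta>'\<bar>" if "(\<theta>, \<theta>') \<in> R" for \<theta> \<theta>'
        using facts(1)[OF Rf(1-4)[OF that]] facts(1)[OF Rf(5-8)[OF that]] by blast
    qed
    have bv: "blip R d (\<lambda>\<theta>. var \<theta> v)"
    proof (rule blip_cong)
      show "blip R d (\<lambda>\<theta>. D \<theta> / (?t \<theta> ^ 2 + 4 * D \<theta>))"
        by (intro blip_divide blip_add blip_mult blip_const blip_power bt Dl aE)
    qed (use facts(2) Rf in blast)
    have bi2: "blip R d (\<lambda>\<theta>. cov \<theta> ?i v ^ 2)"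
    proof (rule blip_cong)
      show "blip R d (\<lambda>\<theta>. ?ij \<theta> * ?ik \<theta> * var \<theta> v / ?jk \<theta>)"
        by (intro blip_divide blip_mult lm(2) l bv aw(4)[OF s(3)])
    qed (use facts(3) Rf in blast)
    have bi: "blip R d (\<lambda>\<theta>. cov \<theta> ?i v)"
      by (rule blip_of_square[OF bi2 aw(1)[OF s(1)] sg[OF _ v]])
    have bm: "blip R d (\<lambda>\<theta>. 1 - 2 * mean \<theta> v)"
    proof (rule blip_cong)
      show "blip R d (\<lambda>\<theta>. ?t \<theta> * var \<theta> v / (cov \<theta> ?i v * ?jk \<theta>))"
        by (intro blip_divide blip_mult bt lm(2) l bv bi away_mult aw(4)[OF s(3)] aw(1)[OF s(1)])
    qed (use facts(4) Rf in blast)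
    show ?thesis
      using blip_mult[OF blip_const[of R d "1 / 2"] blip_diff[OF blip_const[of R d 1] bm]] bi by simp
  qed
  have bm: "blip R d (\<lambda>\<theta>. mean \<theta> v)" if "v \<in> V" for v
    using that basic[of v] lm(1)[of v] inner_iff by blast
  have bv: "blip R d (\<lambda>\<theta>. var \<theta> v)" if "v \<in> V" for v
    unfolding var_def by (intro blip_mult blip_diff blip_const bm[OF that])
  have av: "away R (\<lambda>\<theta>. var \<theta> v)" if v: "v \<in> V" for v
  proof (cases "v \<in> L")
    case True
    show ?thesis
      by (rule awayI[OF e]) (use R[OF _ True True live_self[OF True]] cov_self[OF v] in auto)
  next
    case False
    then show ?thesis using inner_pair[of v] aw(3) v inner_iff by metis
  qed
  have bc: "blip R d (\<lambda>\<theta>. cov \<theta> j v)" if j: "j \<in> L" and v: "v \<in> V" for j v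
  proof (cases "v \<in> L")
    case True
    then show ?thesis using lm(2) j by blast
  next
    case False
    then have vi: "v \<in> inner_nodes V E" using v inner_iff by blast
    let ?i = "lf v"
    obtain u i' where s: "sep_pair v u ?i i'" using good_lf[OF vi] unfolding good_leaf_def by blast
    have l: "?i \<in> L" "i' \<in> L" and adj: "adj v u" and sd: "?i \<in> side v u" "i' \<in> V - side v u" using s by (auto simp: sep_pair_def)
    \<comment> \<open>\<open>key\<close> moves across \<open>u\<close> from one leaf to another:
      from the reference leaf to \<open>i'\<close>, and from one of these two to any given
      leaf.\<close>
    have key: "blip R d (\<lambda>\<theta>. cov \<theta> x v)"
      if x: "x \<in> L" "y \<in> L" "blip R d (\<lambda>\<theta>. cov \<theta> y v)" "away R (\<lambda>\<theta>. cov \<theta> y v)"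
        "y \<in> side v u \<and> x \<in> V - side v u \<or> x \<in> side v u \<and> y \<in> V - side v u" for x y
    proof -
      have "cov \<theta> x v * cov \<theta> y v = cov \<theta> x y * var \<theta> v" for \<theta>
        using x(5) cov_sep[OF adj, of x y \<theta>] cov_sep[OF adj, of y x \<theta>] cov_sym[of \<theta> x y] by (auto simp: mult.commute)
      then show ?thesis
        by (rule blip_solve[where f = "\<lambda>\<theta>. cov \<theta> x v" and g = "\<lambda>\<theta>. cov \<theta> y v" and h = "\<lambda>\<theta>. cov \<theta> x y * var \<theta> v", rotated 3])
          (intro blip_mult lm(2) bv x v x(3,4))+
    qed
    have bi: "blip R d (\<lambda>\<theta>. cov \<theta> ?i v)" using basic[OF vi] by blast
    have bi': "blip R d (\<lambda>\<theta>. cov \<theta> i' v)" by (rule key[OF l(2,1) bi aw(1)[OF s]]) (use sd in blast)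
    show ?thesis
    proof (cases "j \<in> side v u")
      case True
      show ?thesis by (rule key[OF j l(2) bi' aw(2)[OF s]]) (use sd True in blast)
    next
      case f: False
      show ?thesis by (rule key[OF j l(1) bi aw(1)[OF s]]) (use sd f j leaves_sub in blast)
    qed
  qed
  have be: "blip R d (\<lambda>\<theta>. cov \<theta> u w)" if uw: "adj u w" for u w
  proof (cases "w \<in> L")
    case True
    then show ?thesis using bc[of w u] uw adj_in_V cov_sym by simp
  next
    case False
    have wV: "w \<in> V" "u \<in> V" using uw adj_in_V by auto
    then have wi: "w \<in> inner_nodes V E" using False inner_iff by blast
    have wu: "adj w u" using uw adj_sym by blast
    obtain u' i j where s: "sep_pair w u' i j" using inner_pair[OF wi] by metis
    \<comment> \<open>The two leaves of a live pair at \<open>w\<close> lie in different components,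
      so at least one of them is not beyond \<open>u\<close>.\<close>
    have "\<exists>x. x \<in> L \<and> x \<in> V - side w u \<and> away R (\<lambda>\<theta>. cov \<theta> x w)"
    proof (cases "u' = u")
      case True
      then show ?thesis using s aw(2)[OF s] by (auto simp: sep_pair_def)
    next
      case f: False
      then have "i \<in> V - side w u" using side_disjoint[OF wu, of u'] s leaves_sub by (auto simp: sep_pair_def)
      then show ?thesis using s aw(1)[OF s] by (auto simp: sep_pair_def)
    qed
    then obtain x where x: "x \<in> L" "x \<in> V - side w u" "away R (\<lambda>\<theta>. cov \<theta> x w)" by blast
    have "cov \<theta> u w * cov \<theta> x w = cov \<theta> x u * var \<theta> w" for \<theta>
      using cov_sep[OF wu side_self(1)[OF wu] x(2), of \<theta>] cov_sym[of \<theta> x u] by simp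
    then show ?thesis
      by (rule blip_solve[where f = "\<lambda>\<theta>. cov \<theta> u w" and g = "\<lambda>\<theta>. cov \<theta> x w" and h = "\<lambda>\<theta>. cov \<theta> x u * var \<theta> w", rotated 3])
        (intro blip_mult bc bv x wV)+
  qed
  \<comment> \<open>Both factors of the variance are at most 1, so each of them is at least their
    product.\<close>
  have am: "away R (\<lambda>\<theta>. mean \<theta> v)" "away R (\<lambda>\<theta>. 1 - mean \<theta> v)" if v: "v \<in> V" for v
  proof -
    have h: "\<bar>var \<theta> v\<bar> \<le> \<bar>mean \<theta> v\<bar>"  "\<bar>var \<theta> v\<bar> \<le> \<bar>1 - mean \<theta> v\<bar>" if "\<theta> \<in> param_space" for \<theta>
      using mean_bounds[OF that v] unfolding var_def abs_mult by (auto simp: mult_left_le mult_left_le_one_le)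
    show "away R (\<lambda>\<theta>. mean \<theta> v)"
    proof (rule away_mono[OF av[OF v]])
      fix x y assume "(x, y) \<in> R"
      then have "x \<in> param_space" "y \<in> param_space" using R' by blast+
      then show "\<bar>var x v\<bar> \<le> \<bar>mean x v\<bar> \<and> \<bar>var y v\<bar> \<le> \<bar>mean y v\<bar>" using h by blast
    qed
    show "away R (\<lambda>\<theta>. 1 - mean \<theta> v)"
    proof (rule away_mono[OF av[OF v]])
      fix x y assume "(x, y) \<in> R"
      then have "x \<in> param_space" "y \<in> param_space" using R' by blast+
      then show "\<bar>var x v\<bar> \<le> \<bar>1 - mean x v\<bar> \<and> \<bar>var y v\<bar> \<le> \<bar>1 - mean y v\<bar>" using h by blast
    qed
  qed
  consider "k = coord RootParam" | w a where "w \<in> V - {r}" "a \<in> {0, 1::nat}" "k = coord (EdgeParam w a)"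
    by (rule param_cases)
  then show ?thesis
  proof cases
    case 1
    then show ?thesis using bm[OF r_in_V] by (simp add: mean_root)
  next
    case (2 w a)
    let ?u = "parent E w"
    have u: "?u \<in> V" and w: "w \<in> V" using 2(1) parent_in_V by auto
    have uw: "adj w ?u" using parent_edge[OF 2(1)] by (auto simp: adjacent_def)
    \<comment> \<open>\<open>cov_edge\<close> gives the transition probability from state 1, then
      \<open>mean_edge\<close> the one from state 0.\<close>
    have b1: "blip R d (\<lambda>\<theta>. tp \<theta> w 1)"
    proof (rule blip_solve[where f = "\<lambda>\<theta>. tp \<theta> w 1" and g = "\<lambda>\<theta>. mean \<theta> ?u", OF _ bm[OF u] am(1)[OF u] cov_edge[OF 2(1), symmetric]])
      show "blip R d (\<lambda>\<theta>. cov \<theta> w ?u + mean \<theta> w * mean \<theta> ?u)"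
        by (intro blip_add blip_mult be uw bm u w)
    qed
    have b0: "blip R d (\<lambda>\<theta>. tp \<theta> w 0)"
    proof (rule blip_solve[where f = "\<lambda>\<theta>. tp \<theta> w 0" and g = "\<lambda>\<theta>. 1 - mean \<theta> ?u", OF _ _ am(2)[OF u]])
      show "blip R d (\<lambda>\<theta>. mean \<theta> w - tp \<theta> w 1 * mean \<theta> ?u)" "blip R d (\<lambda>\<theta>. 1 - mean \<theta> ?u)"
        by (intro blip_diff blip_mult b1 bm u w blip_const)+
      show "tp \<theta> w 0 * (1 - mean \<theta> ?u) = mean \<theta> w - tp \<theta> w 1 * mean \<theta> ?u" for \<theta>
        using mean_edge[OF 2(1), of \<theta>] by simp
    qed
    show ?thesis using b0 b1 2 by auto
  qed
qed

end


section \<open>Upper bound for the volume\<close>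

lemma abs_diff_le_of_floor_eq:
  fixes x y :: real
  assumes "0 < \<epsilon>" "\<lfloor>x / \<epsilon>\<rfloor> = \<lfloor>y / \<epsilon>\<rfloor>"
  shows "\<bar>x - y\<bar> \<le> \<epsilon>"
proof -
  have "\<bar>x / \<epsilon> - y / \<epsilon>\<bar> < 1" using assms(2) by linarith
  then have "\<bar>x - y\<bar> / \<epsilon> < 1" using assms(1) by (simp flip: diff_divide_distrib)
  then show ?thesis using assms(1) by (simp add: field_simps)
qed

lemma floor_in_range:
  fixes x :: real
  assumes "0 < \<epsilon>" "\<bar>x\<bar> \<le> 1"
  shows "\<lfloor>x / \<epsilon>\<rfloor> \<in> {- \<lceil>1 / \<epsilon>\<rceil>..\<lceil>1 / \<epsilon>\<rceil>}"
proof -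
  have "x / \<epsilon> \<le> 1 / \<epsilon>" "- (1 / \<epsilon>) \<le> x / \<epsilon>"
    using divide_right_mono[of x 1 \<epsilon>] divide_right_mono[of "- 1" x \<epsilon>] assms by simp_all
  then have "- real_of_int \<lceil>1 / \<epsilon>\<rceil> \<le> x / \<epsilon>"
    using le_of_int_ceiling[of "1 / \<epsilon>"] by linarith
  moreover have "real_of_int \<lfloor>x / \<epsilon>\<rfloor> \<le> real_of_int \<lceil>1 / \<epsilon>\<rceil>"
    using of_int_floor_le[of "x / \<epsilon>"] \<open>x / \<epsilon> \<le> 1 / \<epsilon>\<close> le_of_int_ceiling[of "1 / \<epsilon>"] by (meson order_trans)
  ultimately show ?thesis by (simp add: le_floor_iff)
qed

context fitted_model
begin

lemma leaf_node_cov_le_1: "\<theta> \<in> param_space \<Longrightarrow> v \<in> inner_nodes V E \<Longrightarrow> \<bar>cov \<theta> (lf v) v\<bar> \<le> 1"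
  using good_lf[of v] abs_cov_le[of \<theta> "lf v" v] var_bounds[of \<theta> v] leaves_sub
  unfolding good_leaf_def sep_pair_def inner_iff by force

lemma emeasure_param_space_le: "emeasure lborel (param_space :: (real ^ 'k) set) \<le> ennreal (2 ^ CARD('k))"
proof -
  have "(param_space :: (real ^ 'k) set) \<subseteq> cbox (\<chi> k. (0 :: real ^ 'k) $ k - 1) (\<chi> k. (0 :: real ^ 'k) $ k + 1)"
  proof
    fix x :: "real ^ 'k" assume "x \<in> param_space"
    then have "0 \<le> x $ k \<and> x $ k \<le> 1" for k by (simp add: param_space_def)
    then have "- 1 \<le> x $ k \<and> x $ k \<le> 1" for k by (meson neg_le_0_iff_le order_trans zero_le_one)
    then show "x \<in> cbox (\<chi> k. (0 :: real ^ 'k) $ k - 1) (\<chi> k. (0 :: real ^ 'k) $ k + 1)"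
      by (simp add: mem_box_cart)
  qed
  then have "emeasure lborel (param_space :: (real ^ 'k) set) \<le>
      emeasure lborel (cbox (\<chi> k. (0 :: real ^ 'k) $ k - 1) (\<chi> k. (0 :: real ^ 'k) $ k + 1))"
    by (rule emeasure_mono) simp
  then show ?thesis by (simp only: emeasure_cube[OF zero_le_one]) simp
qed

definition fibre_nbhd :: "real \<Rightarrow> (real ^ 'k) set" where
  "fibre_nbhd \<epsilon> = {\<theta> \<in> param_space. \<forall>\<alpha>\<in>leaf_states V E. \<bar>p \<theta> \<alpha> - phat \<alpha>\<bar> \<le> \<epsilon>}"

text \<open>A parameter is labelled by its signs at all inner nodes and by the
  \<open>\<epsilon>\<close>-cells of the two free numbers at each \<open>l2\<close> node. Equal
  labels force closeness of order \<open>\<epsilon>\<close> by \<open>blip_param\<close>, so the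
  labels are counted and \<open>emeasure_cover\<close> applies.\<close>

lemma volume_upper_small:
  obtains C \<epsilon>1 where "0 < C" "0 < \<epsilon>1" "\<And>\<epsilon>. 0 < \<epsilon> \<Longrightarrow> \<epsilon> \<le> 1 \<Longrightarrow> \<epsilon> \<le> \<epsilon>1 \<Longrightarrow>
    emeasure lborel (fibre_nbhd \<epsilon>) \<le> ennreal (C * \<epsilon> ^ CARD('k) * (1 / \<epsilon>) ^ (2 * card l2))"
proof -
  obtain e where e: "0 < e" "\<And>\<theta>. \<theta> \<in> param_space \<Longrightarrow> dev \<theta> \<le> e \<Longrightarrow> \<theta> \<in> near_fibre e"
    using live_lower by metis
  define R where "R = {(\<theta>, \<theta>'). \<theta> \<in> near_fibre e \<and> \<theta>' \<in> near_fibre e \<and>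
    (\<forall>v\<in>inner_nodes V E. 0 < cov \<theta> (lf v) v * cov \<theta>' (lf v) v)}"
  define d where "d \<theta> \<theta>' = (\<Sum>\<alpha>\<in>leaf_states V E. \<bar>p \<theta> \<alpha> - p \<theta>' \<alpha>\<bar>) +
    (\<Sum>v\<in>l2. \<bar>mean \<theta> v - mean \<theta>' v\<bar> + \<bar>cov \<theta> (lf v) v - cov \<theta>' (lf v) v\<bar>)" for \<theta> \<theta>'
  have nf: "\<theta> \<in> param_space" "\<theta>' \<in> param_space" if "(\<theta>, \<theta>') \<in> R" for \<theta> \<theta>'
    using that by (auto simp: R_def near_fibre_def)
  have dp: "\<bar>p \<theta> \<alpha> - p \<theta>' \<alpha>\<bar> \<le> d \<theta> \<theta>'" if a: "\<alpha> \<in> leaf_states V E" for \<alpha> \<theta> \<theta>'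
  proof -
    have "\<bar>p \<theta> \<alpha> - p \<theta>' \<alpha>\<bar> \<le> (\<Sum>\<alpha>\<in>leaf_states V E. \<bar>p \<theta> \<alpha> - p \<theta>' \<alpha>\<bar>)"
      using member_le_sum[OF a, of "\<lambda>\<alpha>. \<bar>p \<theta> \<alpha> - p \<theta>' \<alpha>\<bar>"] finite_leaf_states by simp
    then show ?thesis unfolding d_def by (rule order_trans) (simp add: sum_nonneg)
  qed
  have dl: "\<bar>mean \<theta> v - mean \<theta>' v\<bar> \<le> d \<theta> \<theta>'" "\<bar>cov \<theta> (lf v) v - cov \<theta>' (lf v) v\<bar> \<le> d \<theta> \<theta>'" if v: "v \<in> l2" for v \<theta> \<theta>'
  proof -
    have "\<bar>mean \<theta> v - mean \<theta>' v\<bar> + \<bar>cov \<theta> (lf v) v - cov \<theta>' (lf v) v\<bar> \<le>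
      (\<Sum>v\<in>l2. \<bar>mean \<theta> v - mean \<theta>' v\<bar> + \<bar>cov \<theta> (lf v) v - cov \<theta>' (lf v) v\<bar>)"
      using member_le_sum[OF v, of "\<lambda>v. \<bar>mean \<theta> v - mean \<theta>' v\<bar> + \<bar>cov \<theta> (lf v) v - cov \<theta>' (lf v) v\<bar>"] l2_sub(3) by simp
    moreover have "0 \<le> (\<Sum>\<alpha>\<in>leaf_states V E. \<bar>p \<theta> \<alpha> - p \<theta>' \<alpha>\<bar>)" by (simp add: sum_nonneg)
    ultimately show "\<bar>mean \<theta> v - mean \<theta>' v\<bar> \<le> d \<theta> \<theta>'" "\<bar>cov \<theta> (lf v) v - cov \<theta>' (lf v) v\<bar> \<le> d \<theta> \<theta>'"
      unfolding d_def by linarith+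
  qed
  have "blip R d (\<lambda>\<theta>. \<theta> $ k)" for k
  proof (rule blip_param)
    show "R \<subseteq> near_fibre e \<times> near_fibre e" by (auto simp: R_def)
    show "0 < cov \<theta> (lf v) v * cov \<theta>' (lf v) v" if "(\<theta>, \<theta>') \<in> R" "v \<in> inner_nodes V E" for \<theta> \<theta>' v
      using that by (auto simp: R_def)
    show "blip R d (\<lambda>\<theta>. p \<theta> \<alpha>)" if "\<alpha> \<in> leaf_states V E" for \<alpha>
      by (rule blipI[where B = 1 and C = 1])
        (use nf p_nonneg[OF _ that] p_le_1[OF _ that] dp[OF that] in \<open>auto simp: abs_le_iff intro: order_trans[of "-1" 0]\<close>)
    show "blip R d (\<lambda>\<theta>. mean \<theta> v) \<and> blip R d (\<lambda>\<theta>. cov \<theta> (lf v) v)" if v: "v \<in> l2" for v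
    proof
      have vi: "v \<in> inner_nodes V E" "v \<in> V" using v l2_sub by auto
      show "blip R d (\<lambda>\<theta>. mean \<theta> v)"
        by (rule blipI[where B = 1 and C = 1])
          (use nf mean_bounds[OF _ vi(2)] dl(1)[OF v] in \<open>auto simp: abs_le_iff intro: order_trans[of "-1" 0]\<close>)
      show "blip R d (\<lambda>\<theta>. cov \<theta> (lf v) v)"
        by (rule blipI[where B = 1 and C = 1]) (use nf leaf_node_cov_le_1[OF _ vi(1)] dl(2)[OF v] in auto)
    qed
  qed (rule e(1))
  then obtain C where C: "0 < C" "\<And>k \<theta> \<theta>'. (\<theta>, \<theta>') \<in> R \<Longrightarrow> \<bar>\<theta> $ k - \<theta>' $ k\<bar> \<le> C * d \<theta> \<theta>'"
    using blip_uniform[of UNIV R d "\<lambda>k \<theta>. \<theta> $ k"] by (auto simp: d_def sum_nonneg)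
  define n where "n = real (card (leaf_states V E))"
  define l where "l = real (card l2)"
  let ?ci = "card (inner_nodes V E)"
  \<comment> \<open>Two signs per inner node; \<open>5 / \<epsilon>\<close> cells for each of the
    two numbers at an \<open>l2\<close> node, hence 25; the last factor is the side of the covering
    cubes divided by \<open>\<epsilon>\<close>.\<close>
  define C1 where "C1 = 2 ^ ?ci * 25 ^ card l2 * (2 * C * (2 * n + 2 * l)) ^ CARD('k)"
  have n0: "0 \<le> n" "0 \<le> l" by (auto simp: n_def l_def)
  have fin_inner: "finite (inner_nodes V E)" using finite_V by (simp add: inner_nodes_def)
  show ?thesis
  \<comment> \<open>The radius bound turns an entrywise deviation of at most
    \<open>\<epsilon>\<close> into \<open>dev \<theta> \<le> e\<close>. The 1 in
    \<open>1 + C1\<close> makes the constant positive.\<close>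
  proof (rule that[of "1 + C1" "e / (n + 1)"])
    show "0 < 1 + C1" unfolding C1_def using C(1) n0 by (intro add_pos_nonneg) auto
    show "0 < e / (n + 1)" using e(1) n0 by simp
    fix \<epsilon> :: real assume \<epsilon>: "0 < \<epsilon>" "\<epsilon> \<le> 1" "\<epsilon> \<le> e / (n + 1)"
    define K where "K = \<lceil>1 / \<epsilon>\<rceil>"
    define f where "f \<theta> = ((\<lambda>v\<in>inner_nodes V E. 0 < cov \<theta> (lf v) v),
      (\<lambda>v\<in>l2. (\<lfloor>mean \<theta> v / \<epsilon>\<rfloor>, \<lfloor>cov \<theta> (lf v) v / \<epsilon>\<rfloor>)))" for \<theta>
    let ?F = "(inner_nodes V E \<rightarrow>\<^sub>E (UNIV :: bool set)) \<times> (l2 \<rightarrow>\<^sub>E ({- K..K} \<times> {- K..K}))"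
    have finF: "finite ?F" using fin_inner l2_sub(3) by (auto intro!: finite_PiE)
    have sub: "f ` fibre_nbhd \<epsilon> \<subseteq> ?F"
    proof -
      have "\<lfloor>mean \<theta> v / \<epsilon>\<rfloor> \<in> {- K..K} \<and> \<lfloor>cov \<theta> (lf v) v / \<epsilon>\<rfloor> \<in> {- K..K}" if "\<theta> \<in> fibre_nbhd \<epsilon>" "v \<in> l2" for \<theta> v
        unfolding K_def using that l2_sub mean_bounds[of \<theta> v] leaf_node_cov_le_1[of \<theta> v]
        by (intro conjI floor_in_range \<epsilon>(1)) (auto simp: fibre_nbhd_def)
      then show ?thesis by (auto simp: f_def PiE_iff)
    qed
    have K: "1 \<le> K" "real_of_int K \<le> 1 / \<epsilon> + 1" using \<epsilon> unfolding K_def by (auto simp: le_ceiling_iff)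
    have "real (card (f ` fibre_nbhd \<epsilon>)) \<le> real (card ?F)"
      using card_mono[OF finF sub] by simp
    also have "card ?F = 2 ^ ?ci * (nat (2 * K + 1) * nat (2 * K + 1)) ^ card l2"
      using fin_inner l2_sub(3) K by (simp add: card_cartesian_product card_PiE algebra_simps)
    also have "real \<dots> \<le> 2 ^ ?ci * ((5 / \<epsilon>) * (5 / \<epsilon>)) ^ card l2"
    proof -
      have "real (nat (2 * K + 1)) \<le> 2 * (1 / \<epsilon> + 1) + 1" using K by simp
      also have "\<dots> \<le> 5 / \<epsilon>" using \<epsilon> by (simp add: field_simps)
      finally have "real (nat (2 * K + 1)) \<le> 5 / \<epsilon>" .
      then have "(real (nat (2 * K + 1)) * real (nat (2 * K + 1))) ^ card l2 \<le> ((5 / \<epsilon>) * (5 / \<epsilon>)) ^ card l2"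
        using \<epsilon> by (intro power_mono mult_mono) auto
      then show ?thesis by simp
    qed
    also have "2 ^ ?ci * ((5 / \<epsilon>) * (5 / \<epsilon>)) ^ card l2 = 2 ^ ?ci * 25 ^ card l2 * (1 / \<epsilon>) ^ (2 * card l2)"
      by (simp add: power_mult power2_eq_square power_divide flip: power_mult_distrib)
    finally have M: "real (card (f ` fibre_nbhd \<epsilon>)) \<le> 2 ^ ?ci * 25 ^ card l2 * (1 / \<epsilon>) ^ (2 * card l2)" .
    let ?r = "C * (2 * n + 2 * l) * \<epsilon>"
    have close: "\<bar>\<theta> $ k - \<theta>' $ k\<bar> \<le> ?r" if h: "\<theta> \<in> fibre_nbhd \<epsilon>" "\<theta>' \<in> fibre_nbhd \<epsilon>" "f \<theta> = f \<theta>'" for \<theta> \<theta>' k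
    proof -
      have ps: "\<theta> \<in> param_space" "\<theta>' \<in> param_space" using h by (auto simp: fibre_nbhd_def)
      have dev: "dev \<theta> \<le> e" if "\<theta> \<in> fibre_nbhd \<epsilon>" for \<theta>
      proof -
        have "dev \<theta> \<le> n * \<epsilon>"
          unfolding dev_def n_def by (rule sum_bounded_above) (use that in \<open>auto simp: fibre_nbhd_def\<close>)
        also have "\<dots> \<le> (n + 1) * (e / (n + 1))" using \<epsilon> n0 by (intro mult_mono) auto
        finally show ?thesis using n0 by simp
      qed
      have near: "\<theta> \<in> near_fibre e" "\<theta>' \<in> near_fibre e"
        using e(2)[OF ps(1) dev[OF h(1)]] e(2)[OF ps(2) dev[OF h(2)]] by auto
      have "0 < cov \<theta> (lf v) v * cov \<theta>' (lf v) v" if v: "v \<in> inner_nodes V E" for v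
      proof -
        obtain u j where s: "sep_pair v u (lf v) j" using good_lf[OF v] unfolding good_leaf_def by blast
        have nz: "cov \<theta> (lf v) v \<noteq> 0" if "\<theta> \<in> near_fibre e" for \<theta>
          using cov_lower(1)[of \<theta> v u "lf v" j] s e(1) that unfolding near_fibre_def sep_pair_def by fastforce
        have "0 < cov \<theta> (lf v) v \<longleftrightarrow> 0 < cov \<theta>' (lf v) v"
          using fun_cong[OF arg_cong[OF h(3), of fst], of v] v by (simp add: f_def)
        then show ?thesis using nz[OF near(1)] nz[OF near(2)] by (auto simp: zero_less_mult_iff)
      qed
      then have "(\<theta>, \<theta>') \<in> R" using near by (auto simp: R_def)
      then have "\<bar>\<theta> $ k - \<theta>' $ k\<bar> \<le> C * d \<theta> \<theta>'" by (rule C(2))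
      also have "d \<theta> \<theta>' \<le> n * (2 * \<epsilon>) + l * (2 * \<epsilon>)"
        unfolding d_def n_def l_def
      proof (intro add_mono sum_bounded_above)
        fix \<alpha> assume "\<alpha> \<in> leaf_states V E"
        then have "\<bar>p \<theta> \<alpha> - phat \<alpha>\<bar> \<le> \<epsilon>" "\<bar>p \<theta>' \<alpha> - phat \<alpha>\<bar> \<le> \<epsilon>" using h by (auto simp: fibre_nbhd_def)
        then show "\<bar>p \<theta> \<alpha> - p \<theta>' \<alpha>\<bar> \<le> 2 * \<epsilon>" by linarith
      next
        fix v assume v: "v \<in> l2"
        have "\<lfloor>mean \<theta> v / \<epsilon>\<rfloor> = \<lfloor>mean \<theta>' v / \<epsilon>\<rfloor>" "\<lfloor>cov \<theta> (lf v) v / \<epsilon>\<rfloor> = \<lfloor>cov \<theta>' (lf v) v / \<epsilon>\<rfloor>"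
          using fun_cong[OF arg_cong[OF h(3), of snd], of v] v by (auto simp: f_def)
        then show "\<bar>mean \<theta> v - mean \<theta>' v\<bar> + \<bar>cov \<theta> (lf v) v - cov \<theta>' (lf v) v\<bar> \<le> 2 * \<epsilon>"
          using abs_diff_le_of_floor_eq[OF \<epsilon>(1), of "mean \<theta> v" "mean \<theta>' v"]
            abs_diff_le_of_floor_eq[OF \<epsilon>(1), of "cov \<theta> (lf v) v" "cov \<theta>' (lf v) v"] by linarith
      qed
      finally show ?thesis using C(1) by (simp add: algebra_simps)
    qed
    have "emeasure lborel (fibre_nbhd \<epsilon>) \<le> ennreal ((2 ^ ?ci * 25 ^ card l2 * (1 / \<epsilon>) ^ (2 * card l2)) * (2 * ?r) ^ CARD('k))"
      by (rule emeasure_cover[OF finite_subset[OF sub finF] M]) (use close C(1) n0 \<epsilon> in auto)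
    also have "(2 ^ ?ci * 25 ^ card l2 * (1 / \<epsilon>) ^ (2 * card l2)) * (2 * ?r) ^ CARD('k) =
      C1 * \<epsilon> ^ CARD('k) * (1 / \<epsilon>) ^ (2 * card l2)"
      by (simp add: C1_def power_mult_distrib)
    also have "ennreal \<dots> \<le> ennreal ((1 + C1) * \<epsilon> ^ CARD('k) * (1 / \<epsilon>) ^ (2 * card l2))"
      using \<epsilon> by (intro ennreal_leI mult_right_mono) auto
    finally show "emeasure lborel (fibre_nbhd \<epsilon>) \<le> ennreal ((1 + C1) * \<epsilon> ^ CARD('k) * (1 / \<epsilon>) ^ (2 * card l2))" .
  qed
qed

lemma volume_upper:
  obtains C where "0 < C" "\<And>\<epsilon>. 0 < \<epsilon> \<Longrightarrow> \<epsilon> \<le> 1 \<Longrightarrow>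
    emeasure lborel (fibre_nbhd \<epsilon>) \<le> ennreal (C * \<epsilon> ^ CARD('k) * (1 / \<epsilon>) ^ (2 * card l2))"
proof -
  obtain C \<epsilon>1 where C: "0 < C" "0 < \<epsilon>1" "\<And>\<epsilon>. 0 < \<epsilon> \<Longrightarrow> \<epsilon> \<le> 1 \<Longrightarrow> \<epsilon> \<le> \<epsilon>1 \<Longrightarrow>
    emeasure lborel (fibre_nbhd \<epsilon>) \<le> ennreal (C * \<epsilon> ^ CARD('k) * (1 / \<epsilon>) ^ (2 * card l2))"
    by (rule volume_upper_small) metis
  \<comment> \<open>For \<open>\<epsilon>\<close> above \<open>\<epsilon>1\<close> the volume is at
    most \<open>2 ^ CARD('k)\<close>, and the second summand makes this at most
    \<open>?D * \<epsilon> ^ CARD('k)\<close>.\<close>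
  let ?D = "C + (2 / \<epsilon>1) ^ CARD('k)"
  show ?thesis
  proof (rule that[of ?D])
    show "0 < ?D" using C by (intro add_pos_nonneg) auto
    fix \<epsilon> :: real assume \<epsilon>: "0 < \<epsilon>" "\<epsilon> \<le> 1"
    show "emeasure lborel (fibre_nbhd \<epsilon>) \<le> ennreal (?D * \<epsilon> ^ CARD('k) * (1 / \<epsilon>) ^ (2 * card l2))"
    proof (cases "\<epsilon> \<le> \<epsilon>1")
      case True
      have "C * \<epsilon> ^ CARD('k) * (1 / \<epsilon>) ^ (2 * card l2) \<le> ?D * \<epsilon> ^ CARD('k) * (1 / \<epsilon>) ^ (2 * card l2)"
        using \<epsilon> C by (intro mult_right_mono) auto
      then show ?thesis using C(3)[OF \<epsilon> True] ennreal_leI order_trans by blast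
    next
      case False
      have "emeasure lborel (fibre_nbhd \<epsilon>) \<le> emeasure lborel (param_space :: (real ^ 'k) set)"
      proof (rule emeasure_mono)
        have e: "(param_space :: (real ^ 'k) set) = cbox 0 1" by (auto simp: param_space_def mem_box_cart)
        show "(param_space :: (real ^ 'k) set) \<in> sets lborel" unfolding e by simp
      qed (auto simp: fibre_nbhd_def)
      also have "\<dots> \<le> ennreal (2 ^ CARD('k))" by (rule emeasure_param_space_le)
      also have "2 ^ CARD('k) \<le> ?D * \<epsilon> ^ CARD('k) * (1 / \<epsilon>) ^ (2 * card l2)"
      proof -
        have "(2::real) ^ CARD('k) = (2 / \<epsilon>1) ^ CARD('k) * \<epsilon>1 ^ CARD('k)" using C(2) by (simp add: power_divide)
        also have "\<dots> \<le> ?D * \<epsilon> ^ CARD('k)" using False C by (intro mult_mono power_mono) auto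
        also have "\<dots> = ?D * \<epsilon> ^ CARD('k) * 1" by simp
        also have "\<dots> \<le> ?D * \<epsilon> ^ CARD('k) * (1 / \<epsilon>) ^ (2 * card l2)"
          using \<epsilon> C by (intro mult_left_mono one_le_power) (auto simp: field_simps)
        finally show ?thesis .
      qed
      finally show ?thesis by (simp add: ennreal_leI)
    qed
  qed
qed

end


section \<open>Parameters with prescribed means and covariances\<close>

text \<open>For a binary \<open>Y\<close> of mean \<open>m\<close> and
  \<open>X = (Y - m) / (m * (1 - m))\<close>, the left side is the expectation of
  \<open>(1 + c1 * X * y1) * (1 + c2 * X * y2)\<close>. The mean of \<open>X\<close> is 0 and that
  of \<open>X^2\<close> is \<open>1 / (m * (1 - m))\<close>.\<close>

lemma two_point_sum:
  fixes m c1 c2 y1 y2 :: real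
  assumes "m * (1 - m) \<noteq> 0"
  shows "(1 - m) * ((1 + c1 * ((0 - m) / (m * (1 - m))) * y1) * (1 + c2 * ((0 - m) / (m * (1 - m))) * y2)) +
    m * ((1 + c1 * ((1 - m) / (m * (1 - m))) * y1) * (1 + c2 * ((1 - m) / (m * (1 - m))) * y2)) =
    1 + c1 * c2 / (m * (1 - m)) * y1 * y2"
proof -
  have nz: "m \<noteq> 0" "1 - m \<noteq> 0" using assms by auto
  have s: "(0 - m) / (m * (1 - m)) = - (1 / (1 - m))" "(1 - m) / (m * (1 - m)) = 1 / m"
    using nz by auto
  have i: "(1 - m) * (1 / (1 - m)) = 1" "m * (1 / m) = 1" using nz by auto
  define a b where "a = 1 / (1 - m)" and "b = 1 / m"
  have i': "(1 - m) * a = 1" "m * b = 1" using i by (simp_all add: a_def b_def)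
  have ab: "1 / (m * (1 - m)) = a + b" using nz by (simp add: a_def b_def field_simps)
  have "(1 - m) * ((1 + c1 * (- a) * y1) * (1 + c2 * (- a) * y2)) + m * ((1 + c1 * b * y1) * (1 + c2 * b * y2)) =
    ((1 - m) + m) + (m * b - (1 - m) * a) * (c1 * y1 + c2 * y2) + (((1 - m) * a) * a + (m * b) * b) * (c1 * c2 * y1 * y2)"
    by (simp add: algebra_simps)
  also have "\<dots> = 1 + (a + b) * (c1 * c2 * y1 * y2)" unfolding i' by simp
  also have "\<dots> = 1 + c1 * c2 / (m * (1 - m)) * y1 * y2"
    by (simp add: ab[symmetric])
  finally show ?thesis unfolding s a_def b_def .
qed

context tree_model
begin

text \<open>The parameter with node means \<open>m\<close> and covariance \<open>c w\<close> along the edge into \<open>w\<close>.\<close>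

definition par :: "('v \<Rightarrow> real) \<Rightarrow> ('v \<Rightarrow> real) \<Rightarrow> real ^ 'k" where
  "par m c = (\<chi> k. case inv_into (param_index V r) coord k of
     RootParam \<Rightarrow> m r
   | EdgeParam w a \<Rightarrow> m w + c w * (real a - m (parent E w)) / (m (parent E w) * (1 - m (parent E w))))"

lemma par_root: "par m c $ coord RootParam = m r"
  using bij_betw_inv_into_left[OF coord, of RootParam] by (simp add: par_def param_index_def)

lemma par_edge:
  assumes "w \<in> V - {r}" "a \<in> {0, 1}"
  shows "tp (par m c) w a = m w + c w * (real a - m (parent E w)) / (m (parent E w) * (1 - m (parent E w)))"
proof -
  have "EdgeParam w a \<in> param_index V r" using assms by (auto simp: param_index_def)
  then show ?thesis using bij_betw_inv_into_left[OF coord, of "EdgeParam w a"] by (simp add: par_def)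
qed

lemma mean_par: "v \<in> V \<Longrightarrow> mean (par m c) v = m v"
proof (induction v rule: wf_induct_rule[OF wf_E])
  case (1 v)
  show ?case
  proof (cases "v = r")
    case True
    then show ?thesis by (simp add: mean_root par_root)
  next
    case False
    then have v: "v \<in> V - {r}" using 1 by simp
    let ?u = "parent E v"
    have u: "mean (par m c) ?u = m ?u" using 1 parent_edge[OF v] parent_in_V[OF v] by blast
    \<comment> \<open>Also valid if \<open>m ?u\<close> is 0 or 1, where the quotients are
      0.\<close>
    have "c v * (0 - m ?u) / (m ?u * (1 - m ?u)) * (1 - m ?u) + c v * (1 - m ?u) / (m ?u * (1 - m ?u)) * m ?u = 0"
      by simp
    then show ?thesis
      using mean_edge[OF v, of "par m c"] par_edge[OF v, of 0 m c] par_edge[OF v, of 1 m c] u by (simp add: algebra_simps)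
  qed
qed

lemma cov_par:
  assumes w: "w \<in> V - {r}" and nz: "m (parent E w) * (1 - m (parent E w)) \<noteq> 0"
  shows "cov (par m c) w (parent E w) = c w"
proof -
  let ?u = "parent E w"
  have u: "?u \<in> V" by (rule parent_in_V[OF w])
  have "cov (par m c) w ?u + m w * m ?u = (m w + c w * (1 - m ?u) / (m ?u * (1 - m ?u))) * m ?u"
    using cov_edge[OF w, of "par m c"] mean_par[of w m c] mean_par[OF u, of m c] par_edge[OF w, of 1 m c] w by simp
  also have "\<dots> = m w * m ?u + c w" using nz by (simp add: field_simps)
  finally show ?thesis by simp
qed

lemma par_mean_cov:
  assumes nz: "\<And>v. v \<in> V \<Longrightarrow> var \<theta> v \<noteq> 0"
  shows "par (mean \<theta>) (\<lambda>w. cov \<theta> w (parent E w)) = \<theta>"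
proof -
  have "par (mean \<theta>) (\<lambda>w. cov \<theta> w (parent E w)) $ k = \<theta> $ k" for k
  proof -
    consider "k = coord RootParam" | w a where "w \<in> V - {r}" "a \<in> {0, 1::nat}" "k = coord (EdgeParam w a)"
      by (rule param_cases)
    then show ?thesis
    proof cases
      case 1
      then show ?thesis by (simp add: par_root mean_root)
    next
      case (2 w a)
      let ?u = "parent E w"
      define m n c t0 t1 where "m = mean \<theta> ?u" and "n = mean \<theta> w" and "c = cov \<theta> w ?u"
        and "t0 = tp \<theta> w 0" and "t1 = tp \<theta> w 1"
      have m: "m \<noteq> 0" "1 - m \<noteq> 0" using nz[OF parent_in_V[OF 2(1)]] by (auto simp: var_def m_def)
      have e1: "c + n * m = t1 * m" using cov_edge[OF 2(1), of \<theta>] by (simp add: m_def n_def c_def t1_def)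
      have e0: "n = t0 * (1 - m) + t1 * m" using mean_edge[OF 2(1), of \<theta>] by (simp add: m_def n_def t0_def t1_def)
      have c: "c = (t1 - n) * m" using e1 by (simp add: algebra_simps)
      have "n + c * (1 - m) / (m * (1 - m)) = t1" using m by (simp add: c)
      moreover have "n + c * (0 - m) / (m * (1 - m)) = t0"
      proof -
        have "(1 - m) * (n + c * (0 - m) / (m * (1 - m))) = (1 - m) * n - c"
          using m by (simp add: field_simps)
        also have "\<dots> = (1 - m) * t0" using e0 c by (simp add: algebra_simps)
        finally show ?thesis using m by simp
      qed
      ultimately show ?thesis
        using 2 par_edge[OF 2(1,2), of "mean \<theta>" "\<lambda>w. cov \<theta> w (parent E w)"]
        by (auto simp: m_def n_def c_def t0_def t1_def)
    qed
  qed
  then show ?thesis by (simp add: vec_eq_iff)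
qed

text \<open>The law as a density with respect to independent node variables of the same means. An
  edge contributes one factor, symmetric in its two ends, so the direction of the edges no longer
  matters.\<close>

lemma wt_par:
  fixes m c
  defines "x \<equiv> \<lambda>v b. (real b - m v) / (m v * (1 - m v))" and "\<pi> \<equiv> \<lambda>v b. if b = 1 then m v else 1 - m v"
  assumes nz: "\<And>v. v \<in> V \<Longrightarrow> m v * (1 - m v) \<noteq> 0" and \<beta>: "\<beta> \<in> St"
  shows "wt (par m c) \<beta> = (\<Prod>v\<in>V. \<pi> v (\<beta> v)) *
    (\<Prod>w\<in>V - {r}. 1 + c w * x w (\<beta> w) * x (parent E w) (\<beta> (parent E w)))"
proof -
  have e: "edge_prob coord (par m c) w (\<beta> w) (\<beta> (parent E w)) =
    \<pi> w (\<beta> w) * (1 + c w * x w (\<beta> w) * x (parent E w) (\<beta> (parent E w)))" if w: "w \<in> V - {r}" for w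
  proof -
    let ?u = "parent E w"
    have nw: "m w \<noteq> 0" "1 - m w \<noteq> 0" using nz[of w] w by auto
    have u: "\<beta> ?u \<in> {0, 1}" using St_val[OF \<beta> parent_in_V[OF w]] by blast
    have t: "tp (par m c) w (\<beta> ?u) = m w + c w * x ?u (\<beta> ?u)"
      using par_edge[OF w u, of m c] by (simp add: x_def)
    have x: "x w 1 = 1 / m w" "x w 0 = - 1 / (1 - m w)" using nw by (auto simp: x_def)
    have "\<beta> w = 0 \<or> \<beta> w = 1" using St_val[OF \<beta>] w by blast
    then show ?thesis
    proof
      assume b: "\<beta> w = 0"
      show ?thesis unfolding b using nw by (simp add: edge_prob_def t \<pi>_def x field_simps)
    next
      assume b: "\<beta> w = 1"
      show ?thesis unfolding b using nw x(1) by (simp add: edge_prob_def t \<pi>_def field_simps)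
    qed
  qed
  have "wt (par m c) \<beta> = \<pi> r (\<beta> r) * (\<Prod>w\<in>V - {r}. \<pi> w (\<beta> w) * (1 + c w * x w (\<beta> w) * x (parent E w) (\<beta> (parent E w))))"
    unfolding wt_def tree_weight_def by (simp add: e root_prob_def par_root \<pi>_def)
  also have "\<dots> = (\<pi> r (\<beta> r) * (\<Prod>w\<in>V - {r}. \<pi> w (\<beta> w))) *
      (\<Prod>w\<in>V - {r}. 1 + c w * x w (\<beta> w) * x (parent E w) (\<beta> (parent E w)))"
    by (simp add: prod.distrib)
  also have "\<pi> r (\<beta> r) * (\<Prod>w\<in>V - {r}. \<pi> w (\<beta> w)) = (\<Prod>v\<in>V. \<pi> v (\<beta> v))"
    by (rule prod.remove[OF finite_V r_in_V, symmetric])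
  finally show ?thesis .
qed

text \<open>The edges incident to \<open>v\<close>, each named by its child.\<close>

definition inc :: "'v \<Rightarrow> 'v set" where
  "inc v = {w \<in> V - {r}. w = v \<or> parent E w = v}"

text \<open>Since \<open>v\<close> is hidden, leaf probabilities can be compared after summing over
  \<open>Y\<^sub>v\<close>. All but two edges at \<open>v\<close> have covariance 0 and hence factor
  1, so the sum is that of \<open>two_point_sum\<close>, and only the quotient in the last
  assumption enters.\<close>

lemma p_par_update:
  assumes nz: "\<And>v. v \<in> V \<Longrightarrow> m v * (1 - m v) \<noteq> 0" and nz': "\<mu> * (1 - \<mu>) \<noteq> 0"
    and v: "v \<in> V" "v \<notin> L" and e: "e1 \<in> inc v" "e2 \<in> inc v" "e1 \<noteq> e2"
    and dead: "\<And>w. w \<in> inc v \<Longrightarrow> w \<noteq> e1 \<Longrightarrow> w \<noteq> e2 \<Longrightarrow> c w = 0"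
    and c': "\<And>w. w \<noteq> e1 \<Longrightarrow> w \<noteq> e2 \<Longrightarrow> c' w = c w"
    and prod: "c' e1 * c' e2 / (\<mu> * (1 - \<mu>)) = c e1 * c e2 / (m v * (1 - m v))"
  shows "p (par (m(v := \<mu>)) c') = p (par m c)"
proof -
  \<comment> \<open>For an edge \<open>w\<close> at \<open>v\<close>, \<open>?o w\<close> is its end
    other than \<open>v\<close>.\<close>
  let ?o = "\<lambda>w. if w = v then parent E v else w"
  have eV: "e1 \<in> V - {r}" "e2 \<in> V - {r}" using e by (auto simp: inc_def)
  define x where "x m v b = (real b - m v) / (m v * (1 - m v))" for m :: "'v \<Rightarrow> real" and v b
  define \<pi> where "\<pi> m v b = (if b = 1 then m v else 1 - m v)" for m :: "'v \<Rightarrow> real" and v and b :: nat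
  define fac where "fac m c \<beta> w = 1 + c w * x m w (\<beta> w) * x m (parent E w) (\<beta> (parent E w))" for m c and \<beta> :: "'v \<Rightarrow> nat" and w
  \<comment> \<open>\<open>A\<close> collects the factors that do not involve
    \<open>\<beta> v\<close>; the two live edges at \<open>v\<close> and the node factor of
    \<open>v\<close> are treated apart.\<close>
  define A where "A \<beta> = (\<Prod>u\<in>V - {v}. \<pi> m u (\<beta> u)) * (\<Prod>w\<in>V - {r} - {e1} - {e2}. if w \<in> inc v then 1 else fac m c \<beta> w)" for \<beta>
  have pe: "w \<noteq> parent E w" if "w \<in> V - {r}" for w using edge_neq[OF parent_edge[OF that]] by auto
  define y where "y \<beta> w = x m (?o w) (\<beta> (?o w))" for \<beta> :: "'v \<Rightarrow> nat" and w
  have both: "wt (par m1 c1) (\<beta>(v := 0)) + wt (par m1 c1) (\<beta>(v := 1)) =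
      A \<beta> * (1 + c1 e1 * c1 e2 / (m1 v * (1 - m1 v)) * y \<beta> e1 * y \<beta> e2)"
    if \<beta>: "\<beta> \<in> St" and m1: "\<And>u. u \<noteq> v \<Longrightarrow> m1 u = m u" "m1 v * (1 - m1 v) \<noteq> 0"
      and c1: "\<And>w. w \<noteq> e1 \<Longrightarrow> w \<noteq> e2 \<Longrightarrow> c1 w = c w" for \<beta> m1 c1
  proof -
    have nz1: "m1 u * (1 - m1 u) \<noteq> 0" if "u \<in> V" for u using nz[OF that] m1 by (cases "u = v") auto
    have w: "wt (par m1 c1) (\<beta>(v := b)) = \<pi> m1 v b * A \<beta> * ((1 + c1 e1 * x m1 v b * y \<beta> e1) * (1 + c1 e2 * x m1 v b * y \<beta> e2))"
      if b: "b \<in> {0, 1}" for b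
    proof -
      let ?\<beta> = "\<beta>(v := b)"
      have bs: "?\<beta> \<in> St" by (rule binary_states_upd[OF \<beta> v(1) b])
      have facE: "fac m1 c1 ?\<beta> e = 1 + c1 e * x m1 v b * y \<beta> e" if e: "e \<in> inc v" for e
      proof (cases "e = v")
        case True
        then have "parent E v \<noteq> v" using e pe[of v] by (auto simp: inc_def)
        then show ?thesis using True m1(1) by (simp add: fac_def y_def x_def)
      next
        case False
        then have "parent E e = v" using e by (auto simp: inc_def)
        then show ?thesis using False m1(1) by (simp add: fac_def y_def x_def mult_ac)
      qed
      have "wt (par m1 c1) ?\<beta> = (\<Prod>u\<in>V. \<pi> m1 u (?\<beta> u)) * (\<Prod>w\<in>V - {r}. fac m1 c1 ?\<beta> w)"
        unfolding \<pi>_def fac_def x_def by (rule wt_par[OF nz1 bs])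
      also have "(\<Prod>u\<in>V. \<pi> m1 u (?\<beta> u)) = \<pi> m1 v b * (\<Prod>u\<in>V - {v}. \<pi> m u (\<beta> u))"
      proof -
        have "(\<Prod>u\<in>V - {v}. \<pi> m1 u (?\<beta> u)) = (\<Prod>u\<in>V - {v}. \<pi> m u (\<beta> u))"
          by (rule prod.cong[OF refl]) (auto simp: \<pi>_def m1(1))
        then show ?thesis unfolding prod.remove[OF finite_V v(1)] by simp
      qed
      also have "(\<Prod>w\<in>V - {r}. fac m1 c1 ?\<beta> w) = fac m1 c1 ?\<beta> e1 * (fac m1 c1 ?\<beta> e2 * (\<Prod>w\<in>V - {r} - {e1} - {e2}. fac m1 c1 ?\<beta> w))"
      proof -
        have f: "finite (V - {r})" "finite (V - {r} - {e1})" using finite_V by auto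
        have "e2 \<in> V - {r} - {e1}" using eV e(3) by auto
        then show ?thesis by (simp only: prod.remove[OF f(1) eV(1)] prod.remove[OF f(2)])
      qed
      also have "(\<Prod>w\<in>V - {r} - {e1} - {e2}. fac m1 c1 ?\<beta> w) = (\<Prod>w\<in>V - {r} - {e1} - {e2}. if w \<in> inc v then 1 else fac m c \<beta> w)"
      proof (rule prod.cong[OF refl])
        fix w assume w: "w \<in> V - {r} - {e1} - {e2}"
        show "fac m1 c1 ?\<beta> w = (if w \<in> inc v then 1 else fac m c \<beta> w)"
        proof (cases "w \<in> inc v")
          case True
          then show ?thesis using dead[OF True] c1[of w] w by (simp add: fac_def)
        next
          case False
          then have "w \<noteq> v" "parent E w \<noteq> v" using w by (auto simp: inc_def)
          then show ?thesis using False c1[of w] w m1(1) by (simp add: fac_def x_def)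
        qed
      qed
      also note facE[OF e(1)]
      also note facE[OF e(2)]
      finally show ?thesis unfolding A_def by (simp only: ac_simps)
    qed
    have "wt (par m1 c1) (\<beta>(v := 0)) + wt (par m1 c1) (\<beta>(v := 1)) = A \<beta> *
      ((1 - m1 v) * ((1 + c1 e1 * ((0 - m1 v) / (m1 v * (1 - m1 v))) * y \<beta> e1) * (1 + c1 e2 * ((0 - m1 v) / (m1 v * (1 - m1 v))) * y \<beta> e2)) +
       m1 v * ((1 + c1 e1 * ((1 - m1 v) / (m1 v * (1 - m1 v))) * y \<beta> e1) * (1 + c1 e2 * ((1 - m1 v) / (m1 v * (1 - m1 v))) * y \<beta> e2)))"
      using w[of 0] w[of 1] by (simp add: \<pi>_def x_def distrib_left mult_ac)
    then show ?thesis unfolding two_point_sum[OF m1(2)] .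
  qed
  have "p (par (m(v := \<mu>)) c') \<alpha> = p (par m c) \<alpha>" if \<alpha>: "\<alpha> \<in> leaf_states V E" for \<alpha>
    unfolding p_eq[OF \<alpha>] ex_def
  proof (rule sum_binary_states_cong_flip[OF v(1)])
    fix \<beta> assume \<beta>: "\<beta> \<in> St"
    have r: "restrict (\<beta>(v := b)) L = restrict \<beta> L" for b using v(2) by (auto simp: restrict_def)
    have "wt (par (m(v := \<mu>)) c') (\<beta>(v := 0)) + wt (par (m(v := \<mu>)) c') (\<beta>(v := 1)) =
      wt (par m c) (\<beta>(v := 0)) + wt (par m c) (\<beta>(v := 1))"
      using both[OF \<beta>, of "m(v := \<mu>)" c'] both[OF \<beta>, of m c] nz' nz[OF v(1)] c' prod by simp
    then show "wt (par (m(v := \<mu>)) c') (\<beta>(v := 0)) * of_bool (restrict (\<beta>(v := 0)) L = \<alpha>) +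
      wt (par (m(v := \<mu>)) c') (\<beta>(v := 1)) * of_bool (restrict (\<beta>(v := 1)) L = \<alpha>) =
      wt (par m c) (\<beta>(v := 0)) * of_bool (restrict (\<beta>(v := 0)) L = \<alpha>) +
      wt (par m c) (\<beta>(v := 1)) * of_bool (restrict (\<beta>(v := 1)) L = \<alpha>)"
      unfolding r by (simp flip: distrib_right)
  qed
  then show ?thesis by (auto simp: tree_map_def fun_eq_iff restrict_def)
qed

end


section \<open>Live edges\<close>

context fitted_model
begin

text \<open>Turns a neighbour of \<open>v\<close> into the name of the connecting edge.\<close>

definition edge_index :: "'v \<Rightarrow> 'v \<Rightarrow> 'v" where
  "edge_index v u = (if (v, u) \<in> E then u else v)"

lemma edge_index_inc: "adj v u \<Longrightarrow> edge_index v u \<in> inc v"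
  using edge_target parent_eq by (auto simp: edge_index_def inc_def adjacent_def)

lemma inc_edge_index:
  assumes "w \<in> inc v"
  obtains u where "adj v u" "w = edge_index v u"
proof (cases "w = v")
  case True
  then have "(parent E v, v) \<in> E" using assms parent_edge by (auto simp: inc_def)
  then show ?thesis using that[of "parent E v"] True not_parent_and_child by (auto simp: edge_index_def adjacent_def)
next
  case False
  then have "(v, w) \<in> E" using assms parent_edge[of w] by (auto simp: inc_def)
  then show ?thesis using that[of w] by (auto simp: edge_index_def adjacent_def)
qed

lemma edge_index_inj: "adj v u \<Longrightarrow> adj v u' \<Longrightarrow> edge_index v u = edge_index v u' \<Longrightarrow> u = u'"
  using edge_neq parent_unique by (auto simp: edge_index_def adjacent_def split: if_splits)

lemma cov_edge_index: "adj v u \<Longrightarrow> cov \<theta> (edge_index v u) (parent E (edge_index v u)) = cov \<theta> u v"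
  using parent_eq by (auto simp: edge_index_def adjacent_def cov_sym)

text \<open>If the covariance on an edge vanishes and the parent is not constant, both transition
  probabilities equal the mean of the child. The transition then ignores the parent, and the two
  components of the tree are independent.\<close>

lemma cov_dead_edge:
  assumes nz: "\<And>v. v \<in> V \<Longrightarrow> var \<theta> v \<noteq> 0" and vu: "adj v u" and dead: "cov \<theta> u v = 0"
    and ij: "i \<in> side v u" "j \<in> V - side v u"
  shows "cov \<theta> i j = 0"
proof -
  let ?w = "edge_index v u"
  have w: "?w \<in> V - {r}" using edge_index_inc[OF vu] by (simp add: inc_def)
  have c0: "cov \<theta> ?w (parent E ?w) = 0" using cov_edge_index[OF vu] dead by simp
  have m: "mean \<theta> (parent E ?w) \<noteq> 0" "1 - mean \<theta> (parent E ?w) \<noteq> 0"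
    using nz[OF parent_in_V[OF w]] by (auto simp: var_def)
  have t1: "tp \<theta> ?w 1 = mean \<theta> ?w" using cov_edge[OF w, of \<theta>] c0 m by simp
  have "mean \<theta> ?w * (1 - mean \<theta> (parent E ?w)) = tp \<theta> ?w 0 * (1 - mean \<theta> (parent E ?w))"
    using mean_edge[OF w, of \<theta>] unfolding t1 by (simp add: algebra_simps)
  then have t0: "tp \<theta> ?w 0 = mean \<theta> ?w" using m by simp
  have dead': "edge_prob coord \<theta> ?w b 0 = edge_prob coord \<theta> ?w b 1" for b
    using t0 t1 by (simp add: edge_prob_def)
  have z: "cov \<theta> x y = 0" if "x \<in> desc ?w" "y \<in> V - desc ?w" for x y
    using sum_tree_weight_indep[where e = "edge_prob coord \<theta>" and q = "root_prob coord \<theta>",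
        OF w dead' local_on_cen[OF that(1), of \<theta>] local_on_cen[OF that(2), of \<theta>]]
      ex_cen[of \<theta> x] ex_1[of \<theta>]
    unfolding cov_def ex_def wt_def by simp
  show ?thesis
  proof (cases "(v, u) \<in> E")
    case True
    then show ?thesis using z[of i j] ij by (simp add: edge_index_def side_def)
  next
    case False
    have "v \<in> V" using vu adj_in_V by blast
    then show ?thesis using z[of j i] ij False desc_sub[of v] cov_sym[of \<theta> i j] by (auto simp: edge_index_def side_def)
  qed
qed

lemma fitted_sep_pair:
  assumes \<theta>: "\<theta> \<in> param_space" "p \<theta> = phat" and s: "sep_pair v u i j"
  shows "cov \<theta> i j \<noteq> 0" "cov \<theta> i v \<noteq> 0" "cov \<theta> j v \<noteq> 0" "0 < var \<theta> v"
proof -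
  have s': "adj v u" "i \<in> side v u" "j \<in> V - side v u" "i \<in> L" "j \<in> L" "live i j" using s by (auto simp: sep_pair_def)
  show "cov \<theta> i j \<noteq> 0" using phat_cov[OF s'(4,5) \<theta>(2)] s' by simp
  then show "cov \<theta> i v \<noteq> 0" "cov \<theta> j v \<noteq> 0" "0 < var \<theta> v" using cov_lower[OF \<theta>(1) s'(1-3)] by auto
qed

lemma fitted_var_pos:
  assumes \<theta>: "\<theta> \<in> param_space" "p \<theta> = phat" and v: "v \<in> V"
  shows "0 < var \<theta> v"
proof (cases "v \<in> L")
  case True
  then have "var \<theta> v \<noteq> 0" using live_self[OF True] phat_cov[OF True True \<theta>(2)] cov_self[OF v, of \<theta>] by simp
  then show ?thesis using var_bounds[OF \<theta>(1) v] by simp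
next
  case False
  then show ?thesis using inner_pair[of v] fitted_sep_pair(4)[OF \<theta>] v inner_iff by metis
qed

text \<open>If \<open>u\<close> is inner, it separates a live pair, and at least one leaf of the
  pair is not on the side of \<open>v\<close>. Its covariance with \<open>u\<close> is carried over
  to \<open>v\<close> by \<open>cov_sep\<close> at \<open>u\<close>.\<close>

lemma live_leaf_beyond:
  assumes \<theta>: "\<theta> \<in> param_space" "p \<theta> = phat" and vu: "adj v u" and c: "cov \<theta> u v \<noteq> 0"
  obtains j where "j \<in> L" "j \<in> side v u" "cov \<theta> j v \<noteq> 0"
proof (cases "u \<in> L")
  case True
  then show ?thesis using that[of u] c side_self[OF vu] by blast
next
  case False
  have uV: "u \<in> V" using vu adj_in_V by blast
  then have ui: "u \<in> inner_nodes V E" using False inner_iff by blast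
  have uv: "adj u v" using vu adj_sym by blast
  obtain u' i j where s: "sep_pair u u' i j" using inner_pair[OF ui] by metis
  have "\<exists>x. x \<in> L \<and> x \<in> V - side u v \<and> cov \<theta> x u \<noteq> 0"
  proof (cases "u' = v")
    case True
    then show ?thesis using s fitted_sep_pair(3)[OF \<theta> s] by (auto simp: sep_pair_def)
  next
    case f: False
    then have "i \<in> V - side u v" using side_disjoint[OF uv, of u'] s leaves_sub by (auto simp: sep_pair_def)
    then show ?thesis using s fitted_sep_pair(2)[OF \<theta> s] by (auto simp: sep_pair_def)
  qed
  then obtain x where x: "x \<in> L" "x \<in> V - side u v" "cov \<theta> x u \<noteq> 0" by blast
  have "cov \<theta> v x * var \<theta> u = cov \<theta> v u * cov \<theta> x u" by (rule cov_sep[OF uv side_self(1)[OF uv] x(2)])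
  then have "cov \<theta> x v \<noteq> 0" using x(3) c cov_sym[of \<theta> v x] cov_sym[of \<theta> v u] by auto
  moreover have "x \<in> side v u" using x(2) side_compl[OF uv] by simp
  ultimately show ?thesis using that x(1) by blast
qed

text \<open>A live pair separated by \<open>v\<close> makes two edges at \<open>v\<close> live. A
  third live edge would give leaves in three components with nonzero pairwise covariances, which the
  definition of \<open>l2_nodes\<close> excludes. As \<open>v\<close> has only one parent, the first
  of the two edges can be taken to lead to a child.\<close>

lemma l2_live_edges:
  assumes \<theta>: "\<theta> \<in> param_space" "p \<theta> = phat" and v: "v \<in> l2"
  obtains e1 e2 where "e1 \<in> inc v" "e2 \<in> inc v" "e1 \<noteq> e2" "parent E e1 = v"
    "cov \<theta> e1 (parent E e1) \<noteq> 0" "cov \<theta> e2 (parent E e2) \<noteq> 0"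
    "\<And>w. w \<in> inc v \<Longrightarrow> w \<noteq> e1 \<Longrightarrow> w \<noteq> e2 \<Longrightarrow> cov \<theta> w (parent E w) = 0"
proof -
  have vi: "v \<in> inner_nodes V E" and vV: "v \<in> V" and vL: "v \<notin> L" using v l2_sub inner_iff by auto
  have nz: "var \<theta> v \<noteq> 0" if "v \<in> V" for v using fitted_var_pos[OF \<theta> that] by simp
  obtain u i j where s: "sep_pair v u i j" using inner_pair[OF vi] by metis
  then have s': "adj v u" "i \<in> side v u" "j \<in> V - side v u" "i \<in> L" "j \<in> L" by (auto simp: sep_pair_def)
  have cu: "cov \<theta> u v \<noteq> 0" using cov_dead_edge[OF nz s'(1) _ s'(2,3)] fitted_sep_pair(1)[OF \<theta> s] by blast
  obtain u' where u': "adj v u'" "j \<in> side v u'" using side_exists[OF vV, of j] s' vL by blast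
  have ne: "u \<noteq> u'" using u' s' by blast
  then have "i \<in> V - side v u'" using side_disjoint[OF s'(1) u'(1)] s' leaves_sub by blast
  then have cu': "cov \<theta> u' v \<noteq> 0" using cov_dead_edge[OF nz u'(1) _ u'(2)] fitted_sep_pair(1)[OF \<theta> s] cov_sym by metis
  have dead: "cov \<theta> u3 v = 0" if u3: "adj v u3" "u3 \<noteq> u" "u3 \<noteq> u'" for u3
  proof (rule ccontr)
    assume c3: "cov \<theta> u3 v \<noteq> 0"
    have l: "live x y \<and> separates E v x y"
      if "adj v a" "adj v b" "a \<noteq> b" "x \<in> L" "y \<in> L" "x \<in> side v a" "y \<in> side v b" "cov \<theta> x v \<noteq> 0" "cov \<theta> y v \<noteq> 0" for a b x y
    proof -
      have y: "y \<in> V - side v a" using that side_disjoint[of v a b] leaves_sub by blast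
      have "cov \<theta> x y * var \<theta> v = cov \<theta> x v * cov \<theta> y v" by (rule cov_sep[OF that(1,6) y])
      then have "cov \<theta> x y \<noteq> 0" using that by auto
      then show ?thesis using phat_cov[OF that(4,5) \<theta>(2)] separatesI[OF that(1,6) y] by simp
    qed
    obtain x1 where x1: "x1 \<in> L" "x1 \<in> side v u" "cov \<theta> x1 v \<noteq> 0" using live_leaf_beyond[OF \<theta> s'(1) cu] by metis
    obtain x2 where x2: "x2 \<in> L" "x2 \<in> side v u'" "cov \<theta> x2 v \<noteq> 0" using live_leaf_beyond[OF \<theta> u'(1) cu'] by metis
    obtain x3 where x3: "x3 \<in> L" "x3 \<in> side v u3" "cov \<theta> x3 v \<noteq> 0" using live_leaf_beyond[OF \<theta> u3(1) c3] by metis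
    have "live x1 x2 \<and> separates E v x1 x2" using l[OF s'(1) u'(1) ne] x1 x2 by blast
    moreover have "live x1 x3 \<and> separates E v x1 x3" using l[OF s'(1) u3(1)] u3(2) x1 x3 by metis
    moreover have "live x2 x3 \<and> separates E v x2 x3" using l[OF u'(1) u3(1)] u3(3) x2 x3 by metis
    moreover have "covariance L phat x1 x2 * covariance L phat x1 x3 * covariance L phat x2 x3 = 0"
      using v calculation x1(1) x2(1) x3(1) unfolding l2_nodes_def by blast
    ultimately show False by simp
  qed
  define a b where "a = edge_index v u" and "b = edge_index v u'"
  have ab: "a \<in> inc v" "b \<in> inc v" "a \<noteq> b"
    using edge_index_inc s'(1) u'(1) edge_index_inj ne unfolding a_def b_def by blast+
  have cab: "cov \<theta> a (parent E a) \<noteq> 0" "cov \<theta> b (parent E b) \<noteq> 0"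
    using cu cu' s'(1) u'(1) by (simp_all add: a_def b_def cov_edge_index)
  have rest: "cov \<theta> w (parent E w) = 0" if w: "w \<in> inc v" "w \<noteq> a" "w \<noteq> b" for w
  proof -
    obtain x where "adj v x" "w = edge_index v x" using inc_edge_index[OF w(1)] by metis
    then show ?thesis using dead[of x] w by (auto simp: a_def b_def cov_edge_index)
  qed
  show ?thesis
  proof (cases "a = v")
    case True
    then have "parent E b = v" using ab by (auto simp: inc_def)
    then show ?thesis using that[of b a] ab cab rest by blast
  next
    case False
    then have "parent E a = v" using ab by (auto simp: inc_def)
    then show ?thesis using that[of a b] ab cab rest by blast
  qed
qed

end


section \<open>A family in the fibre\<close>

text \<open>\<open>e1 v\<close> and \<open>e2 v\<close> name the two live edges at \<open>v\<close>.
  That \<open>e1 v\<close> always leads to a child makes \<open>e1\<close> injective on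
  \<open>l2\<close>.\<close>

locale fibre_point = fitted_model V E r coord phat
  for V :: "'v set" and E r and coord :: "'v param \<Rightarrow> 'k::finite" and phat +
  fixes \<theta>s :: "real ^ 'k" and e1 e2 :: "'v \<Rightarrow> 'v"
  assumes \<theta>s: "\<theta>s \<in> param_space" "p \<theta>s = phat"
    and interior: "\<And>w a. w \<in> V - {r} \<Longrightarrow> a \<in> {0, 1} \<Longrightarrow> w \<in> l2 \<or> parent E w \<in> l2 \<Longrightarrow> 0 < tp \<theta>s w a \<and> tp \<theta>s w a < 1"
    and e: "\<And>v. v \<in> l2 \<Longrightarrow> e1 v \<in> inc v \<and> e2 v \<in> inc v \<and> e1 v \<noteq> e2 v \<and> parent E (e1 v) = v \<and>
      cov \<theta>s (e1 v) (parent E (e1 v)) \<noteq> 0 \<and> cov \<theta>s (e2 v) (parent E (e2 v)) \<noteq> 0 \<and>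
      (\<forall>w\<in>inc v. w \<noteq> e1 v \<longrightarrow> w \<noteq> e2 v \<longrightarrow> cov \<theta>s w (parent E w) = 0)"
begin

abbreviation m :: "'v \<Rightarrow> real" where "m \<equiv> mean \<theta>s"

definition c :: "'v \<Rightarrow> real" where "c w = cov \<theta>s w (parent E w)"

text \<open>The family has two coordinates for each \<open>v\<close> in \<open>l2\<close>:
  \<open>s (v, False)\<close> moves the mean of \<open>Y\<^sub>v\<close>, and
  \<open>s (v, True)\<close> rescales the covariance on the edge \<open>e1 v\<close>.\<close>

definition new_mean :: "('v \<times> bool \<Rightarrow> real) \<Rightarrow> 'v \<Rightarrow> real" where
  "new_mean s v = m v + s (v, False)"

definition new_var :: "('v \<times> bool \<Rightarrow> real) \<Rightarrow> 'v \<Rightarrow> real" where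
  "new_var s v = new_mean s v * (1 - new_mean s v)"

definition scale :: "('v \<times> bool \<Rightarrow> real) \<Rightarrow> 'v \<Rightarrow> real" where
  "scale s v = 1 + s (v, True)"

text \<open>The set \<open>S\<close> of nodes already moved allows an induction over the nodes of
  \<open>l2\<close>.\<close>

definition mm :: "'v set \<Rightarrow> ('v \<times> bool \<Rightarrow> real) \<Rightarrow> 'v \<Rightarrow> real" where
  "mm S s v = (if v \<in> S then new_mean s v else m v)"

text \<open>Summing out \<open>Y\<^sub>v\<close> at an \<open>l\<^sub>2\<close>-node leaves only the product of the covariances on its two live
  edges over the variance of \<open>Y\<^sub>v\<close>, which the two factors below preserve.\<close>

definition cc :: "'v set \<Rightarrow> ('v \<times> bool \<Rightarrow> real) \<Rightarrow> 'v \<Rightarrow> real" where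
  "cc S s w = c w * (\<Prod>v\<in>{v \<in> S. e1 v = w}. scale s v) *
     (\<Prod>v\<in>{v \<in> S. e2 v = w}. new_var s v / (var \<theta>s v * scale s v))"

definition fam :: "('v \<times> bool \<Rightarrow> real) \<Rightarrow> real ^ 'k" where
  "fam s = par (mm l2 s) (cc l2 s)"

lemma var_nz: "v \<in> V \<Longrightarrow> 0 < var \<theta>s v"
  by (rule fitted_var_pos[OF \<theta>s])

lemma mm_nz:
  assumes "\<And>v. v \<in> l2 \<Longrightarrow> new_var s v \<noteq> 0" "S \<subseteq> l2" "v \<in> V"
  shows "mm S s v * (1 - mm S s v) \<noteq> 0"
  using assms var_nz[OF assms(3)] unfolding mm_def new_var_def var_def by auto

text \<open>Each node is moved by \<open>p_par_update\<close>. An edge may be live for both of its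
  ends; its covariance then carries a factor from each, which does no harm because a move multiplies
  the covariances reached so far.\<close>

lemma p_par_mm_cc:
  assumes nz: "\<And>v. v \<in> l2 \<Longrightarrow> scale s v \<noteq> 0 \<and> new_var s v \<noteq> 0"
    and fin: "finite S" and S: "S \<subseteq> l2"
  shows "p (par (mm S s) (cc S s)) = phat"
  using fin S
proof (induction S rule: finite_induct)
  case empty
  have "par m c = \<theta>s" unfolding c_def using par_mean_cov[of \<theta>s] var_nz by (metis less_irrefl)
  moreover have "mm {} s = m" "cc {} s = c" by (auto simp: mm_def cc_def)
  ultimately show ?case using \<theta>s(2) by simp
next
  case (insert v S)
  have v: "v \<in> l2" and S: "S \<subseteq> l2" and vV: "v \<in> V" "v \<notin> L" using insert l2_sub inner_iff by auto
  note ev = e[OF v]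
  have s1: "{x \<in> insert v S. e1 x = w} = (if e1 v = w then insert v {x \<in> S. e1 x = w} else {x \<in> S. e1 x = w})" for w by auto
  have s2: "{x \<in> insert v S. e2 x = w} = (if e2 v = w then insert v {x \<in> S. e2 x = w} else {x \<in> S. e2 x = w})" for w by auto
  have ne: "e1 v \<noteq> e2 v" "e2 v \<noteq> e1 v" using ev by auto
  have fin: "finite {x \<in> S. e1 x = w}" "finite {x \<in> S. e2 x = w}" for w using insert.hyps by auto
  have cc1: "cc (insert v S) s (e1 v) = cc S s (e1 v) * scale s v"
    unfolding cc_def s1 s2 using ne fin insert.hyps(2) by simp
  have cc2: "cc (insert v S) s (e2 v) = cc S s (e2 v) * (new_var s v / (var \<theta>s v * scale s v))"
    unfolding cc_def s1 s2 using ne fin insert.hyps(2) by simp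
  have mv: "mm S s v = m v" using insert.hyps by (simp add: mm_def)
  have "p (par ((mm S s)(v := new_mean s v)) (cc (insert v S) s)) = p (par (mm S s) (cc S s))"
  proof (rule p_par_update[where v = v and ?e1.0 = "e1 v" and ?e2.0 = "e2 v"])
    show "mm S s u * (1 - mm S s u) \<noteq> 0" if "u \<in> V" for u using mm_nz[OF _ S that] nz by blast
    show "new_mean s v * (1 - new_mean s v) \<noteq> 0" using nz[OF v] by (simp add: new_var_def)
    show "cc S s w = 0" if "w \<in> inc v" "w \<noteq> e1 v" "w \<noteq> e2 v" for w
      using ev that by (simp add: cc_def c_def)
    show "cc (insert v S) s w = cc S s w" if "w \<noteq> e1 v" "w \<noteq> e2 v" for w
      unfolding cc_def s1 s2 using that by auto
    show "cc (insert v S) s (e1 v) * cc (insert v S) s (e2 v) / (new_mean s v * (1 - new_mean s v)) =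
      cc S s (e1 v) * cc S s (e2 v) / (mm S s v * (1 - mm S s v))"
      unfolding cc1 cc2 mv new_var_def[symmetric] var_def[symmetric] using nz[OF v] var_nz[OF vV(1)] by (simp add: field_simps)
  qed (use ev vV in auto)
  moreover have "(mm S s)(v := new_mean s v) = mm (insert v S) s" by (auto simp: mm_def)
  ultimately show ?case using insert S by simp
qed

lemma p_fam:
  assumes "\<And>v. v \<in> l2 \<Longrightarrow> scale s v \<noteq> 0 \<and> new_var s v \<noteq> 0"
  shows "p (fam s) = phat"
  unfolding fam_def by (rule p_par_mm_cc[OF assms l2_sub(3) subset_refl])

text \<open>The neighbourhoods of 0 in the supremum norm, so that a suitable size of
  \<open>s\<close> can be taken from limits instead of explicit estimates.\<close>

definition F :: "('v \<times> bool \<Rightarrow> real) filter" where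
  "F = (INF \<delta>\<in>{0<..}. principal {s. \<forall>x. \<bar>s x\<bar> \<le> \<delta>})"

lemma eventually_F: "eventually P F \<longleftrightarrow> (\<exists>\<delta>>0. \<forall>s. (\<forall>x. \<bar>s x\<bar> \<le> \<delta>) \<longrightarrow> P s)"
proof -
  have "eventually P F \<longleftrightarrow> (\<exists>\<delta>\<in>{0<..}. eventually P (principal {s. \<forall>x. \<bar>s x\<bar> \<le> \<delta>}))"
    unfolding F_def
  proof (rule eventually_INF_base)
    fix a b :: real assume "a \<in> {0<..}" "b \<in> {0<..}"
    then show "\<exists>x\<in>{0<..}. principal {s. \<forall>y :: 'v \<times> bool. \<bar>s y\<bar> \<le> x} \<le> inf (principal {s. \<forall>y. \<bar>s y\<bar> \<le> a}) (principal {s. \<forall>y. \<bar>s y\<bar> \<le> b})"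
      by (intro bexI[of _ "min a b"]) auto
  qed (auto intro: exI[of _ 1])
  then show ?thesis by (auto simp: eventually_principal)
qed

lemma tendsto_F: "((\<lambda>s. s x) \<longlongrightarrow> 0) F"
proof (rule tendstoI)
  fix e :: real assume e: "0 < e"
  have "dist (s x) 0 < e" if "\<forall>y. \<bar>s y\<bar> \<le> e / 2" for s :: "'v \<times> bool \<Rightarrow> real"
    using spec[OF that, of x] e by (simp add: dist_real_def)
  then show "\<forall>\<^sub>F s in F. dist (s x) 0 < e"
    unfolding eventually_F using e by (intro exI[of _ "e / 2"]) auto
qed

lemma tendsto_new_mean: "((\<lambda>s. new_mean s v) \<longlongrightarrow> m v) F"
  unfolding new_mean_def by (rule tendsto_eq_intros tendsto_F | simp)+

lemma tendsto_scale: "((\<lambda>s. scale s v) \<longlongrightarrow> 1) F"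
  unfolding scale_def by (rule tendsto_eq_intros tendsto_F | simp)+

lemma tendsto_mm: "((\<lambda>s. mm S s v) \<longlongrightarrow> m v) F"
  by (cases "v \<in> S") (simp_all add: mm_def tendsto_new_mean)

lemma tendsto_new_var: "((\<lambda>s. new_var s v) \<longlongrightarrow> var \<theta>s v) F"
  unfolding new_var_def var_def by (intro tendsto_intros tendsto_new_mean)

lemma tendsto_cc: "((\<lambda>s. cc l2 s w) \<longlongrightarrow> c w) F"
proof -
  have "((\<lambda>s. new_var s v / (var \<theta>s v * scale s v)) \<longlongrightarrow> var \<theta>s v / (var \<theta>s v * 1)) F" if "v \<in> l2" for v
    using var_nz[of v] that l2_sub by (intro tendsto_intros tendsto_new_var tendsto_scale) auto
  then have 2: "((\<lambda>s. new_var s v / (var \<theta>s v * scale s v)) \<longlongrightarrow> 1) F" if "v \<in> l2" for v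
    using var_nz[of v] that l2_sub by fastforce
  have "((\<lambda>s. cc l2 s w) \<longlongrightarrow> c w * (\<Prod>v\<in>{v \<in> l2. e1 v = w}. 1) * (\<Prod>v\<in>{v \<in> l2. e2 v = w}. 1)) F"
    unfolding cc_def by (intro tendsto_mult tendsto_const tendsto_prod tendsto_scale 2) auto
  then show ?thesis by simp
qed

lemma tendsto_fam: "((\<lambda>s. fam s $ k) \<longlongrightarrow> \<theta>s $ k) F"
proof -
  have id: "par m c = \<theta>s" unfolding c_def using par_mean_cov[of \<theta>s] var_nz by (metis less_irrefl)
  consider "k = coord RootParam" | w a where "w \<in> V - {r}" "a \<in> {0, 1::nat}" "k = coord (EdgeParam w a)"
    by (rule param_cases)
  then show ?thesis
  proof cases
    case 1
    then show ?thesis using tendsto_mm[of l2 r] by (simp add: fam_def par_root mean_root)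
  next
    case (2 w a)
    let ?u = "parent E w"
    have nz: "m ?u * (1 - m ?u) \<noteq> 0" using var_nz[OF parent_in_V[OF 2(1)]] unfolding var_def by (metis less_irrefl)
    have "((\<lambda>s. mm l2 s w + cc l2 s w * (real a - mm l2 s ?u) / (mm l2 s ?u * (1 - mm l2 s ?u))) \<longlongrightarrow>
        m w + c w * (real a - m ?u) / (m ?u * (1 - m ?u))) F"
      by (intro tendsto_intros tendsto_mm tendsto_cc nz)
    then show ?thesis
      unfolding 2(3) fam_def par_edge[OF 2(1,2)] using par_edge[OF 2(1,2), of m c] id by simp
  qed
qed

text \<open>A coordinate that moves lies strictly between 0 and 1 at \<open>\<theta>s\<close>: by
  assumption for edges at an \<open>l2\<close> node, by positive variance for the root. All other
  coordinates are constant in \<open>s\<close>.\<close>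

lemma fam_in_param_space: "\<forall>\<^sub>F s in F. fam s \<in> param_space"
proof -
  have "\<forall>\<^sub>F s in F. 0 \<le> fam s $ k \<and> fam s $ k \<le> 1" for k
  proof -
    have int: "\<forall>\<^sub>F s in F. 0 \<le> fam s $ k \<and> fam s $ k \<le> 1" if "0 < \<theta>s $ k" "\<theta>s $ k < 1"
      using order_tendstoD(1)[OF tendsto_fam that(1)] order_tendstoD(2)[OF tendsto_fam that(2)]
      by eventually_elim auto
    have const: "\<forall>\<^sub>F s in F. 0 \<le> fam s $ k \<and> fam s $ k \<le> 1" if "\<And>s. fam s $ k = \<theta>s $ k"
      using \<theta>s(1) that by (simp add: param_space_def)
    consider "k = coord RootParam" | w a where "w \<in> V - {r}" "a \<in> {0, 1::nat}" "k = coord (EdgeParam w a)"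
      by (rule param_cases)
    then show ?thesis
    proof cases
      case 1
      show ?thesis
      proof (cases "r \<in> l2")
        case True
        have "0 < m r" "m r < 1"
          using var_nz[OF r_in_V] mean_bounds[OF \<theta>s(1) r_in_V] by (auto simp: var_def zero_less_mult_iff)
        then show ?thesis using int 1 by (simp add: mean_root)
      next
        case False
        then show ?thesis using const 1 by (simp add: fam_def par_root mm_def mean_root)
      qed
    next
      case (2 w a)
      let ?u = "parent E w"
      show ?thesis
      proof (cases "w \<in> l2 \<or> ?u \<in> l2")
        case True
        then show ?thesis using int interior[OF 2(1,2) True] 2 by simp
      next
        case False
        have "e1 v \<noteq> w" "e2 v \<noteq> w" if "v \<in> l2" for v
          using e[OF that] that False by (auto simp: inc_def)
        then have n1: "{v \<in> l2. e1 v = w} = {}" and n2: "{v \<in> l2. e2 v = w} = {}" by auto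
        have "cc l2 s w = c w" for s by (simp add: cc_def n1 n2)
        moreover have "mm l2 s w = m w" "mm l2 s ?u = m ?u" for s using False by (auto simp: mm_def)
        moreover have "par m c = \<theta>s" unfolding c_def using par_mean_cov[of \<theta>s] var_nz by (metis less_irrefl)
        ultimately have "fam s $ k = \<theta>s $ k" for s
          unfolding 2(3) fam_def using par_edge[OF 2(1,2), of m c] par_edge[OF 2(1,2), of "mm l2 s" "cc l2 s"] by simp
        then show ?thesis by (rule const)
      qed
    qed
  qed
  then have "\<forall>\<^sub>F s in F. \<forall>k. 0 \<le> fam s $ k \<and> fam s $ k \<le> 1" by (rule eventually_all_finite)
  then show ?thesis by (simp add: param_space_def)
qed

lemma fam_good:
  obtains \<delta> where "0 < \<delta>" "\<And>s. (\<And>x. \<bar>s x\<bar> \<le> \<delta>) \<Longrightarrow> fam s \<in> param_space \<and> p (fam s) = phat \<and>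
      (\<forall>v\<in>l2. 0 < scale s v \<and> scale s v \<le> 2 \<and> var \<theta>s v / 2 \<le> new_var s v)"
proof -
  have 1: "\<forall>\<^sub>F s in F. 0 < scale s v \<and> scale s v < 2" for v
    using order_tendstoD(1)[OF tendsto_scale zero_less_one, of v] order_tendstoD(2)[OF tendsto_scale one_less_numeral_iff[THEN iffD2], of "num.Bit0 num.One" v]
    by (simp add: eventually_conj_iff)
  have 2: "\<forall>\<^sub>F s in F. var \<theta>s v / 2 < new_var s v" if "v \<in> l2" for v
    using order_tendstoD(1)[OF tendsto_new_var, of "var \<theta>s v / 2" v] var_nz[of v] that l2_sub by auto
  have "\<forall>\<^sub>F s in F. \<forall>v\<in>l2. (0 < scale s v \<and> scale s v < 2) \<and> var \<theta>s v / 2 < new_var s v"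
    using l2_sub(3) 1 2 by (simp add: eventually_ball_finite_distrib eventually_conj_iff)
  then have "\<forall>\<^sub>F s in F. fam s \<in> param_space \<and> (\<forall>v\<in>l2. (0 < scale s v \<and> scale s v < 2) \<and> var \<theta>s v / 2 < new_var s v)"
    using fam_in_param_space by (simp add: eventually_conj_iff)
  then obtain \<delta> where \<delta>: "0 < \<delta>" "\<And>s. (\<forall>x. \<bar>s x\<bar> \<le> \<delta>) \<Longrightarrow> fam s \<in> param_space \<and>
      (\<forall>v\<in>l2. (0 < scale s v \<and> scale s v < 2) \<and> var \<theta>s v / 2 < new_var s v)"
    unfolding eventually_F by blast
  show ?thesis
  proof (rule that[OF \<delta>(1)])
    fix s :: "'v \<times> bool \<Rightarrow> real" assume s: "\<And>x. \<bar>s x\<bar> \<le> \<delta>"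
    have g: "fam s \<in> param_space" "\<And>v. v \<in> l2 \<Longrightarrow> 0 < scale s v \<and> scale s v < 2 \<and> var \<theta>s v / 2 < new_var s v"
      using \<delta>(2)[of s] s by auto
    have "p (fam s) = phat"
    proof (rule p_fam)
      fix v assume v: "v \<in> l2"
      then show "scale s v \<noteq> 0 \<and> new_var s v \<noteq> 0" using g(2)[OF v] var_nz[of v] l2_sub by fastforce
    qed
    then show "fam s \<in> param_space \<and> p (fam s) = phat \<and>
      (\<forall>v\<in>l2. 0 < scale s v \<and> scale s v \<le> 2 \<and> var \<theta>s v / 2 \<le> new_var s v)"
      using g by (auto intro: less_imp_le)
  qed
qed

end


section \<open>Lower bound for the volume\<close>

context tree_model
begin

lemma continuous_on_p: "continuous_on A (\<lambda>\<theta>. p \<theta> \<alpha>)"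
proof (cases "\<alpha> \<in> leaf_states V E")
  case True
  have r: "continuous_on A (\<lambda>\<theta>. root_prob coord \<theta> b)" for b
    unfolding root_prob_def by (cases "b = 1") (auto intro!: continuous_intros)
  have e: "continuous_on A (\<lambda>\<theta>. edge_prob coord \<theta> v b a)" for v b a
    unfolding edge_prob_def by (cases "b = 1") (auto intro!: continuous_intros)
  show ?thesis
    unfolding p_eq[OF True] ex_def wt_def tree_weight_def by (intro continuous_intros r e)
next
  case False
  then show ?thesis by (simp add: tree_map_def)
qed

lemma blip_ex_param:
  assumes "\<forall>k. blip R d (\<lambda>\<theta>. \<theta> $ k)"
  shows "blip R d (\<lambda>\<theta>. ex \<theta> f)"
proof -
  note k = assms[rule_format]
  have r: "blip R d (\<lambda>\<theta>. root_prob coord \<theta> b)" for b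
    unfolding root_prob_def by (cases "b = 1") (auto intro!: blip_diff blip_const k)
  have e: "blip R d (\<lambda>\<theta>. edge_prob coord \<theta> v b a)" for v b a
    unfolding edge_prob_def by (cases "b = 1") (auto intro!: blip_diff blip_const k)
  show ?thesis
    unfolding ex_def wt_def tree_weight_def by (intro blip_sum blip_mult blip_prod blip_const r e)
qed

text \<open>All three are polynomials in the coordinates, which are bounded on the cube.\<close>

lemma lipschitz_on_param_space:
  obtains C where "0 < C"
    "\<And>\<theta> \<theta>' v. \<theta> \<in> param_space \<Longrightarrow> \<theta>' \<in> param_space \<Longrightarrow> v \<in> V \<Longrightarrow>
      \<bar>mean \<theta> v - mean \<theta>' v\<bar> \<le> C * (\<Sum>k\<in>UNIV. \<bar>\<theta> $ k - \<theta>' $ k\<bar>)"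
    "\<And>\<theta> \<theta>' w. \<theta> \<in> param_space \<Longrightarrow> \<theta>' \<in> param_space \<Longrightarrow> w \<in> V \<Longrightarrow>
      \<bar>cov \<theta> w (parent E w) - cov \<theta>' w (parent E w)\<bar> \<le> C * (\<Sum>k\<in>UNIV. \<bar>\<theta> $ k - \<theta>' $ k\<bar>)"
    "\<And>\<theta> \<theta>' \<alpha>. \<theta> \<in> param_space \<Longrightarrow> \<theta>' \<in> param_space \<Longrightarrow> \<alpha> \<in> leaf_states V E \<Longrightarrow>
      \<bar>p \<theta> \<alpha> - p \<theta>' \<alpha>\<bar> \<le> C * (\<Sum>k\<in>UNIV. \<bar>\<theta> $ k - \<theta>' $ k\<bar>)"
proof -
  define R where "R = (param_space :: (real ^ 'k) set) \<times> (param_space :: (real ^ 'k) set)"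
  define d where "d \<theta> \<theta>' = (\<Sum>k\<in>UNIV. \<bar>\<theta> $ k - \<theta>' $ k\<bar>)" for \<theta> \<theta>' :: "real ^ 'k"
  have d0: "0 \<le> d \<theta> \<theta>'" for \<theta> \<theta>' by (simp add: d_def sum_nonneg)
  have k: "\<forall>k. blip R d (\<lambda>\<theta>. \<theta> $ k)"
  proof
    fix k
    show "blip R d (\<lambda>\<theta>. \<theta> $ k)"
    proof (rule blipI[where B = 1 and C = 1])
      fix x y assume "(x, y) \<in> R"
      then have "0 \<le> x $ k \<and> x $ k \<le> 1" "0 \<le> y $ k \<and> y $ k \<le> 1" by (auto simp: R_def param_space_def)
      moreover have "\<bar>x $ k - y $ k\<bar> \<le> d x y"
        unfolding d_def by (rule member_le_sum[of k UNIV "\<lambda>k. \<bar>x $ k - y $ k\<bar>"]) auto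
      ultimately show "\<bar>x $ k\<bar> \<le> 1 \<and> \<bar>y $ k\<bar> \<le> 1 \<and> \<bar>x $ k - y $ k\<bar> \<le> 1 * d x y" by auto
    qed
  qed
  note ex = blip_ex_param[OF k]
  have mean: "blip R d (\<lambda>\<theta>. mean \<theta> v)" for v unfolding mean_def by (rule ex)
  have cov: "blip R d (\<lambda>\<theta>. cov \<theta> u v)" for u v
    unfolding cov_eq by (intro blip_diff blip_mult mean ex)
  have p: "blip R d (\<lambda>\<theta>. p \<theta> \<alpha>)" if "\<alpha> \<in> leaf_states V E" for \<alpha>
    unfolding p_eq[OF that] by (rule ex)
  obtain C1 where C1: "0 < C1" "\<And>v \<theta> \<theta>'. v \<in> V \<Longrightarrow> (\<theta>, \<theta>') \<in> R \<Longrightarrow> \<bar>mean \<theta> v - mean \<theta>' v\<bar> \<le> C1 * d \<theta> \<theta>'"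
    using blip_uniform[of V R d "\<lambda>v \<theta>. mean \<theta> v"] mean finite_V d0 by blast
  obtain C2 where C2: "0 < C2" "\<And>w \<theta> \<theta>'. w \<in> V \<Longrightarrow> (\<theta>, \<theta>') \<in> R \<Longrightarrow>
      \<bar>cov \<theta> w (parent E w) - cov \<theta>' w (parent E w)\<bar> \<le> C2 * d \<theta> \<theta>'"
    using blip_uniform[of V R d "\<lambda>w \<theta>. cov \<theta> w (parent E w)"] cov finite_V d0 by blast
  obtain C3 where C3: "0 < C3" "\<And>\<alpha> \<theta> \<theta>'. \<alpha> \<in> leaf_states V E \<Longrightarrow> (\<theta>, \<theta>') \<in> R \<Longrightarrow> \<bar>p \<theta> \<alpha> - p \<theta>' \<alpha>\<bar> \<le> C3 * d \<theta> \<theta>'"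
    using blip_uniform[of "leaf_states V E" R d "\<lambda>\<alpha> \<theta>. p \<theta> \<alpha>"] p finite_leaf_states d0 by blast
  have le: "C1 * d \<theta> \<theta>' \<le> (C1 + C2 + C3) * d \<theta> \<theta>'" "C2 * d \<theta> \<theta>' \<le> (C1 + C2 + C3) * d \<theta> \<theta>'"
    "C3 * d \<theta> \<theta>' \<le> (C1 + C2 + C3) * d \<theta> \<theta>'" for \<theta> \<theta>'
    using C1(1) C2(1) C3(1) d0 by (auto intro!: mult_right_mono)
  show ?thesis
  proof (rule that[of "C1 + C2 + C3"])
    show "0 < C1 + C2 + C3" using C1(1) C2(1) C3(1) by simp
  next
    fix \<theta> \<theta>' :: "real ^ 'k" and v assume "\<theta> \<in> param_space" "\<theta>' \<in> param_space" "v \<in> V"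
    then show "\<bar>mean \<theta> v - mean \<theta>' v\<bar> \<le> (C1 + C2 + C3) * (\<Sum>k\<in>UNIV. \<bar>\<theta> $ k - \<theta>' $ k\<bar>)"
      "\<bar>cov \<theta> v (parent E v) - cov \<theta>' v (parent E v)\<bar> \<le> (C1 + C2 + C3) * (\<Sum>k\<in>UNIV. \<bar>\<theta> $ k - \<theta>' $ k\<bar>)"
      using C1(2)[of v \<theta> \<theta>'] C2(2)[of v \<theta> \<theta>'] le[of \<theta> \<theta>'] unfolding d_def R_def by auto
  next
    fix \<theta> \<theta>' :: "real ^ 'k" and \<alpha> assume "\<theta> \<in> param_space" "\<theta>' \<in> param_space" "\<alpha> \<in> leaf_states V E"
    then show "\<bar>p \<theta> \<alpha> - p \<theta>' \<alpha>\<bar> \<le> (C1 + C2 + C3) * (\<Sum>k\<in>UNIV. \<bar>\<theta> $ k - \<theta>' $ k\<bar>)"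
      using C3(2)[of \<alpha> \<theta> \<theta>'] le[of \<theta> \<theta>'] unfolding d_def R_def by auto
  qed
qed

end

context fitted_model
begin

lemma closed_fibre_nbhd: "closed (fibre_nbhd \<epsilon>)"
proof -
  have "fibre_nbhd \<epsilon> = cbox 0 1 \<inter> (\<Inter>\<alpha>\<in>leaf_states V E. {\<theta>. \<bar>p \<theta> \<alpha> - phat \<alpha>\<bar> \<le> \<epsilon>})"
    by (auto simp: fibre_nbhd_def param_space_def mem_box_cart)
  moreover have "closed {\<theta>. \<bar>p \<theta> \<alpha> - phat \<alpha>\<bar> \<le> \<epsilon>}" for \<alpha>
    by (intro closed_Collect_le continuous_intros continuous_on_p)
  ultimately show ?thesis by (metis (no_types, lifting) closed_INT closed_Int closed_cbox)
qed

end

context fibre_point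
begin

lemma mean_fam: "v \<in> V \<Longrightarrow> mean (fam s) v = mm l2 s v"
  unfolding fam_def by (rule mean_par)

text \<open>The edge \<open>e1 v\<close> leads to a child, so it is the first live edge of no node
  but \<open>v\<close>; the second live edge it can be only of that child.\<close>

lemma cov_fam_e1:
  assumes v: "v \<in> l2" and nz: "\<And>v. v \<in> l2 \<Longrightarrow> new_var s v \<noteq> 0"
  shows "cov (fam s) (e1 v) (parent E (e1 v)) = c (e1 v) * scale s v *
    (if e1 v \<in> l2 \<and> e2 (e1 v) = e1 v then new_var s (e1 v) / (var \<theta>s (e1 v) * scale s (e1 v)) else 1)"
proof -
  have ev: "e1 v \<in> V - {r}" "parent E (e1 v) = v" "v \<in> V" using e[OF v] v l2_sub by (auto simp: inc_def)
  have pe: "parent E (e1 x) = x" if "x \<in> l2" for x using e[OF that] by blast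
  have "x = v" if "x \<in> l2" "e1 x = e1 v" for x
    using arg_cong[OF that(2), of "parent E"] unfolding pe[OF that(1)] pe[OF v] .
  then have s1: "{x \<in> l2. e1 x = e1 v} = {v}" using v by auto
  have "x = e1 v" if "x \<in> l2" "e2 x = e1 v" for x
  proof (rule ccontr)
    assume "x \<noteq> e1 v"
    then have "parent E (e1 v) = x" using e[OF that(1)] that(2) by (auto simp: inc_def)
    then show False using e[OF v] that ev by auto
  qed
  then have s2: "{x \<in> l2. e2 x = e1 v} = (if e1 v \<in> l2 \<and> e2 (e1 v) = e1 v then {e1 v} else {})" by auto
  have "cov (fam s) (e1 v) (parent E (e1 v)) = cc l2 s (e1 v)"
    unfolding fam_def using mm_nz[OF nz subset_refl, of "parent E (e1 v)"] ev by (intro cov_par) auto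
  then show ?thesis by (simp add: cc_def s1 s2)
qed

text \<open>Means and covariances are Lipschitz in the parameter, so it is enough to find one of
  them that differs by a multiple of \<open>\<epsilon>\<close>. If the means agree, a lowest node
  whose scale differs is used: the child at the end of its edge \<open>e1 v\<close> contributes the
  same factor to both covariances.\<close>

lemma fam_separated:
  obtains \<delta> \<kappa> where "0 < \<delta>" "0 < \<kappa>"
    "\<And>s. (\<And>x. \<bar>s x\<bar> \<le> \<delta>) \<Longrightarrow> fam s \<in> param_space \<and> p (fam s) = phat"
    "\<And>s s' \<epsilon>. (\<And>x. \<bar>s x\<bar> \<le> \<delta>) \<Longrightarrow> (\<And>x. \<bar>s' x\<bar> \<le> \<delta>) \<Longrightarrow> 0 < \<epsilon> \<Longrightarrow>
      (\<exists>x\<in>l2 \<times> UNIV. s x \<noteq> s' x) \<Longrightarrow> (\<And>x. x \<in> l2 \<times> UNIV \<Longrightarrow> s x \<noteq> s' x \<Longrightarrow> \<epsilon> \<le> \<bar>s x - s' x\<bar>) \<Longrightarrow>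
      \<exists>k. \<kappa> * \<epsilon> \<le> \<bar>fam s $ k - fam s' $ k\<bar>"
proof -
  obtain \<delta> where \<delta>: "0 < \<delta>" "\<And>s. (\<And>x. \<bar>s x\<bar> \<le> \<delta>) \<Longrightarrow> fam s \<in> param_space \<and> p (fam s) = phat \<and>
      (\<forall>v\<in>l2. 0 < scale s v \<and> scale s v \<le> 2 \<and> var \<theta>s v / 2 \<le> new_var s v)"
    using fam_good by blast
  obtain C where C: "0 < C"
    "\<And>\<theta> \<theta>' v. \<theta> \<in> param_space \<Longrightarrow> \<theta>' \<in> param_space \<Longrightarrow> v \<in> V \<Longrightarrow>
      \<bar>mean \<theta> v - mean \<theta>' v\<bar> \<le> C * (\<Sum>k\<in>UNIV. \<bar>\<theta> $ k - \<theta>' $ k\<bar>)"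
    "\<And>\<theta> \<theta>' w. \<theta> \<in> param_space \<Longrightarrow> \<theta>' \<in> param_space \<Longrightarrow> w \<in> V \<Longrightarrow>
      \<bar>cov \<theta> w (parent E w) - cov \<theta>' w (parent E w)\<bar> \<le> C * (\<Sum>k\<in>UNIV. \<bar>\<theta> $ k - \<theta>' $ k\<bar>)"
    by (rule lipschitz_on_param_space, rule that; assumption)
  \<comment> \<open>The 4 comes from the lower bound \<open>1 / 4\<close> for \<open>\<psi>\<close>
    below; the 1 is for the case of different means.\<close>
  define c0 where "c0 = Min (insert 1 ((\<lambda>v. \<bar>c (e1 v)\<bar> / 4) ` l2))"
  have finS: "finite (insert 1 ((\<lambda>v. \<bar>c (e1 v)\<bar> / 4) ` l2))" using l2_sub(3) by simp
  have c0: "0 < c0" "c0 \<le> 1" "\<And>v. v \<in> l2 \<Longrightarrow> c0 \<le> \<bar>c (e1 v)\<bar> / 4"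
  proof -
    have "c (e1 v) \<noteq> 0" if "v \<in> l2" for v using e[OF that] unfolding c_def by blast
    then show "0 < c0" unfolding c0_def using finS by (subst Min_gr_iff) auto
    show "c0 \<le> 1" unfolding c0_def using finS by (intro Min_le) auto
    show "c0 \<le> \<bar>c (e1 v)\<bar> / 4" if "v \<in> l2" for v unfolding c0_def using finS that by (intro Min_le) auto
  qed
  \<comment> \<open>One of the \<open>CARD('k)\<close> coordinate differences is at least the
    average share of their sum.\<close>
  define \<kappa> where "\<kappa> = c0 / (C * CARD('k))"
  have \<kappa>: "0 < \<kappa>" using c0(1) C(1) by (simp add: \<kappa>_def)
  show ?thesis
  proof (rule that[OF \<delta>(1) \<kappa>])
    show "fam s \<in> param_space \<and> p (fam s) = phat" if "\<And>x. \<bar>s x\<bar> \<le> \<delta>" for s using \<delta>(2)[of s, OF that] by blast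
    fix s s' :: "'v \<times> bool \<Rightarrow> real" and \<epsilon> :: real
    assume s: "\<And>x. \<bar>s x\<bar> \<le> \<delta>" and s': "\<And>x. \<bar>s' x\<bar> \<le> \<delta>" and \<epsilon>: "0 < \<epsilon>"
      and ex: "\<exists>x\<in>l2 \<times> UNIV. s x \<noteq> s' x" and far: "\<And>x. x \<in> l2 \<times> UNIV \<Longrightarrow> s x \<noteq> s' x \<Longrightarrow> \<epsilon> \<le> \<bar>s x - s' x\<bar>"
    let ?D = "\<Sum>k\<in>UNIV. \<bar>fam s $ k - fam s' $ k\<bar>"
    have ps: "fam s \<in> param_space" "fam s' \<in> param_space" using \<delta>(2)[of s, OF s] \<delta>(2)[of s', OF s'] by auto
    have sc: "0 < scale s v" "scale s v \<le> 2" "var \<theta>s v / 2 \<le> new_var s v" if "v \<in> l2" for v using \<delta>(2)[of s, OF s] that by auto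
    have sc': "0 < scale s' v" "scale s' v \<le> 2" "var \<theta>s v / 2 \<le> new_var s' v" if "v \<in> l2" for v using \<delta>(2)[of s', OF s'] that by auto
    have vp: "0 < var \<theta>s v" if "v \<in> l2" for v using var_nz that l2_sub by blast
    have nz: "new_var s v \<noteq> 0" "new_var s' v \<noteq> 0" if "v \<in> l2" for v using sc(3)[OF that] sc'(3)[OF that] vp[OF that] by auto
    have key: "c0 * \<epsilon> \<le> C * ?D"
    proof (cases "\<exists>v\<in>l2. s (v, False) \<noteq> s' (v, False)")
      case True
      then obtain v where v: "v \<in> l2" "s (v, False) \<noteq> s' (v, False)" by blast
      have vV: "v \<in> V" using v l2_sub by blast
      have "\<epsilon> \<le> \<bar>s (v, False) - s' (v, False)\<bar>" using far[of "(v, False)"] v by simp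
      also have "\<dots> = \<bar>mean (fam s) v - mean (fam s') v\<bar>" using v by (simp add: mean_fam[OF vV] mm_def new_mean_def)
      also have "\<dots> \<le> C * ?D" by (rule C(2)[OF ps vV])
      finally have "\<epsilon> \<le> C * ?D" .
      moreover have "c0 * \<epsilon> \<le> 1 * \<epsilon>" using c0(2) \<epsilon> by (intro mult_right_mono) auto
      ultimately show ?thesis by linarith
    next
      case False
      then have eqF: "s (v, False) = s' (v, False)" if "v \<in> l2" for v using that by blast
      define B where "B = {v \<in> l2. s (v, True) \<noteq> s' (v, True)}"
      obtain v0 b where "v0 \<in> l2" "s (v0, b) \<noteq> s' (v0, b)" using ex by auto
      then have "v0 \<in> B" using eqF by (cases b) (auto simp: B_def)
      \<comment> \<open>A lowest node of \<open>B\<close>, so that the child \<open>e1 v\<close> is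
        not in \<open>B\<close>.\<close>
      then obtain v where v: "v \<in> B" "\<And>y. (v, y) \<in> E \<Longrightarrow> y \<notin> B" using wf_E_converse by (metis converse_iff wfE_min)
      have vl: "v \<in> l2" "s (v, True) \<noteq> s' (v, True)" using v by (auto simp: B_def)
      let ?w = "e1 v"
      have w: "?w \<in> V - {r}" "parent E ?w = v" using e[OF vl(1)] by (auto simp: inc_def)
      have wB: "?w \<notin> B" using v(2) parent_edge[OF w(1)] w(2) by simp
      define \<psi> where "\<psi> s = (if ?w \<in> l2 \<and> e2 ?w = ?w then new_var s ?w / (var \<theta>s ?w * scale s ?w) else 1)" for s
      have \<psi>eq: "\<psi> s' = \<psi> s"
        unfolding \<psi>_def using wB eqF by (auto simp: B_def new_var_def new_mean_def scale_def)
      \<comment> \<open>The new variance is at least half the old one, and the scale is at most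
        2.\<close>
      have \<psi>: "1 / 4 \<le> \<psi> s"
      proof (cases "?w \<in> l2 \<and> e2 ?w = ?w")
        case True
        then have h: "0 < scale s ?w" "scale s ?w \<le> 2" "var \<theta>s ?w / 2 \<le> new_var s ?w" "0 < var \<theta>s ?w" using sc vp by auto
        have "1 / 4 * (var \<theta>s ?w * scale s ?w) \<le> var \<theta>s ?w / 2"
          using mult_left_mono[OF h(2), of "var \<theta>s ?w"] h(4) by simp
        then have "1 / 4 * (var \<theta>s ?w * scale s ?w) \<le> new_var s ?w" using h(3) by linarith
        then have "1 / 4 \<le> new_var s ?w / (var \<theta>s ?w * scale s ?w)"
          using h(1,4) by (subst pos_le_divide_eq) auto
        then show ?thesis using True by (simp add: \<psi>_def)
      qed (auto simp: \<psi>_def)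
      have cs: "cov (fam s) ?w (parent E ?w) = c ?w * scale s v * \<psi> s" "cov (fam s') ?w (parent E ?w) = c ?w * scale s' v * \<psi> s'"
        unfolding \<psi>_def by (rule cov_fam_e1[OF vl(1)]; use nz in blast)+
      have "\<epsilon> \<le> \<bar>s (v, True) - s' (v, True)\<bar>" using far[of "(v, True)"] vl by simp
      then have "c0 * \<epsilon> \<le> \<bar>c ?w\<bar> / 4 * \<bar>s (v, True) - s' (v, True)\<bar>"
        using c0(1) c0(3)[OF vl(1)] \<epsilon> by (intro mult_mono) auto
      also have "\<dots> = \<bar>c ?w\<bar> * \<bar>s (v, True) - s' (v, True)\<bar> * (1 / 4)" by simp
      also have "\<dots> \<le> \<bar>c ?w\<bar> * \<bar>s (v, True) - s' (v, True)\<bar> * \<psi> s" using \<psi> by (intro mult_left_mono) auto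
      also have "\<dots> = \<bar>cov (fam s) ?w (parent E ?w) - cov (fam s') ?w (parent E ?w)\<bar>"
      proof -
        have "cov (fam s) ?w (parent E ?w) - cov (fam s') ?w (parent E ?w) = c ?w * (s (v, True) - s' (v, True)) * \<psi> s"
          unfolding cs \<psi>eq by (simp add: scale_def algebra_simps)
        then show ?thesis using \<psi> by (simp add: abs_mult)
      qed
      also have "\<dots> \<le> C * ?D" by (rule C(3)[OF ps]) (use w in blast)
      finally show ?thesis .
    qed
    show "\<exists>k. \<kappa> * \<epsilon> \<le> \<bar>fam s $ k - fam s' $ k\<bar>"
    proof (rule ccontr)
      assume "\<not> ?thesis"
      then have "?D < (\<Sum>k\<in>(UNIV :: 'k set). \<kappa> * \<epsilon>)" by (intro sum_strict_mono) (auto simp: not_le)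
      then have "C * ?D < C * (CARD('k) * (\<kappa> * \<epsilon>))" using C(1) by simp
      also have "\<dots> = c0 * \<epsilon>" using C(1) by (simp add: \<kappa>_def)
      finally show False using key by simp
    qed
  qed
qed

lemma volume_lower:
  obtains C \<epsilon>0 where "0 < C" "0 < \<epsilon>0" "\<And>\<epsilon>. 0 < \<epsilon> \<Longrightarrow> \<epsilon> \<le> \<epsilon>0 \<Longrightarrow>
    ennreal (C * \<epsilon> ^ CARD('k) * (1 / \<epsilon>) ^ (2 * card l2)) \<le> emeasure lborel (fibre_nbhd \<epsilon>)"
proof -
  obtain \<delta> \<kappa> where \<delta>: "0 < \<delta>" "0 < \<kappa>"
    "\<And>s. (\<And>x. \<bar>s x\<bar> \<le> \<delta>) \<Longrightarrow> fam s \<in> param_space \<and> p (fam s) = phat"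
    "\<And>s s' \<epsilon>. (\<And>x. \<bar>s x\<bar> \<le> \<delta>) \<Longrightarrow> (\<And>x. \<bar>s' x\<bar> \<le> \<delta>) \<Longrightarrow> 0 < \<epsilon> \<Longrightarrow>
      (\<exists>x\<in>l2 \<times> UNIV. s x \<noteq> s' x) \<Longrightarrow> (\<And>x. x \<in> l2 \<times> UNIV \<Longrightarrow> s x \<noteq> s' x \<Longrightarrow> \<epsilon> \<le> \<bar>s x - s' x\<bar>) \<Longrightarrow>
      \<exists>k. \<kappa> * \<epsilon> \<le> \<bar>fam s $ k - fam s' $ k\<bar>"
    using fam_separated by blast
  obtain C where C: "0 < C"
    "\<And>\<theta> \<theta>' \<alpha>. \<theta> \<in> param_space \<Longrightarrow> \<theta>' \<in> param_space \<Longrightarrow> \<alpha> \<in> leaf_states V E \<Longrightarrow>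
      \<bar>p \<theta> \<alpha> - p \<theta>' \<alpha>\<bar> \<le> C * (\<Sum>k\<in>UNIV. \<bar>\<theta> $ k - \<theta>' $ k\<bar>)"
    by (rule lipschitz_on_param_space, rule that; assumption)
  \<comment> \<open>\<open>\<kappa> / 3\<close> keeps the cubes disjoint, \<open>1 / 2\<close> keeps
    them in the unit cube, and \<open>1 / (C * CARD('k))\<close> keeps the leaf probabilities within
    \<open>\<epsilon>\<close> of \<open>phat\<close>.\<close>
  define \<rho> where "\<rho> = min (\<kappa> / 3) (min (1 / 2) (1 / (C * CARD('k))))"
  have \<rho>: "0 < \<rho>" "3 * \<rho> \<le> \<kappa>" "\<rho> \<le> 1 / 2" "C * (CARD('k) * \<rho>) \<le> 1"
  proof -
    show "0 < \<rho>" using \<delta>(2) C(1) by (simp add: \<rho>_def)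
    have "\<rho> \<le> \<kappa> / 3" unfolding \<rho>_def by (rule min.cobounded1)
    then show "3 * \<rho> \<le> \<kappa>" by simp
    show "\<rho> \<le> 1 / 2" unfolding \<rho>_def by (rule min.coboundedI2, rule min.cobounded1)
    have "C * (CARD('k) * \<rho>) \<le> C * (CARD('k) * (1 / (C * CARD('k))))"
      using C(1) by (intro mult_left_mono) (auto simp: \<rho>_def)
    then show "C * (CARD('k) * \<rho>) \<le> 1" using C(1) by simp
  qed
  show ?thesis
  proof (rule that[of "\<delta> ^ (2 * card l2) * \<rho> ^ CARD('k)" 1])
    show "0 < \<delta> ^ (2 * card l2) * \<rho> ^ CARD('k)" using \<delta>(1) \<rho>(1) by simp
    fix \<epsilon> :: real assume \<epsilon>: "0 < \<epsilon>" "\<epsilon> \<le> 1"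
    \<comment> \<open>Each of the \<open>2 * card l2\<close> coordinates takes \<open>K + 1\<close>
      grid values, and \<open>K + 1\<close> is at least
      \<open>\<delta> / \<epsilon>\<close>.\<close>
    define K where "K = nat \<lfloor>\<delta> / \<epsilon>\<rfloor>"
    define h where "h = \<rho> * \<epsilon> / 2"
    have h: "0 < h" "h \<le> 1 / 4"
      using \<rho> \<epsilon> mult_mono[OF \<rho>(3) \<epsilon>(2)] by (simp_all add: h_def mult.commute)
    define I where "I = (l2 \<times> (UNIV :: bool set)) \<rightarrow>\<^sub>E {0..K}"
    define s where "s k x = (if x \<in> l2 \<times> UNIV then \<epsilon> * real (k x) else 0)" for k :: "'v \<times> bool \<Rightarrow> nat" and x
    \<comment> \<open>In every coordinate the cube extends from \<open>x\<close> towards the farther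
      end of the unit interval, so it stays in the parameter space even if \<open>x\<close> is on
      the boundary.\<close>
    define Q where "Q x = cbox (\<chi> k. (\<chi> k. if x $ k \<le> 1 / 2 then x $ k + h else x $ k - h) $ k - h)
      (\<chi> k. (\<chi> k. if x $ k \<le> 1 / 2 then x $ k + h else x $ k - h) $ k + h)" for x :: "real ^ 'k"
    have Qm: "emeasure lborel (Q x) = ennreal ((\<rho> * \<epsilon>) ^ CARD('k))" for x
      unfolding Q_def using h(1) by (subst emeasure_cube) (auto simp: h_def)
    have Qd: "\<bar>y $ k - x $ k\<bar> \<le> \<rho> * \<epsilon> \<and> 0 \<le> y $ k \<and> y $ k \<le> 1" if y: "y \<in> Q x" and x: "x \<in> param_space" for x y k
    proof -
      have "0 \<le> x $ k \<and> x $ k \<le> 1" using x by (simp add: param_space_def)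
      moreover have "if x $ k \<le> 1 / 2 then x $ k \<le> y $ k \<and> y $ k \<le> x $ k + 2 * h else x $ k - 2 * h \<le> y $ k \<and> y $ k \<le> x $ k"
        using y unfolding Q_def mem_box_cart by (auto dest: spec[of _ k] split: if_splits)
      moreover have "\<rho> * \<epsilon> = 2 * h" by (simp add: h_def)
      ultimately show ?thesis using h by (auto split: if_splits)
    qed
    have K: "\<epsilon> * real K \<le> \<delta>" "\<delta> / \<epsilon> \<le> real (K + 1)"
    proof -
      have "0 \<le> \<delta> / \<epsilon>" using \<delta>(1) \<epsilon> by simp
      then have "real K \<le> \<delta> / \<epsilon>" unfolding K_def by (simp add: of_nat_floor)
      then show "\<epsilon> * real K \<le> \<delta>" using \<epsilon> by (simp add: field_simps)
      show "\<delta> / \<epsilon> \<le> real (K + 1)" unfolding K_def by linarith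
    qed
    have sb: "\<bar>s k x\<bar> \<le> \<delta>" if k: "k \<in> I" for k x
    proof (cases "x \<in> l2 \<times> UNIV")
      case True
      then have "k x \<le> K" using k by (auto simp: I_def PiE_iff)
      then have "\<epsilon> * real (k x) \<le> \<epsilon> * real K" using \<epsilon> by (intro mult_left_mono) auto
      then have "\<epsilon> * real (k x) \<le> \<delta>" using K(1) by linarith
      then show ?thesis using True \<epsilon> by (simp add: s_def)
    qed (use \<delta>(1) in \<open>simp add: s_def\<close>)
    have fp: "fam (s k) \<in> param_space" "p (fam (s k)) = phat" if "k \<in> I" for k using \<delta>(3)[of "s k"] sb[OF that] by auto
    have finI: "finite I" unfolding I_def using l2_sub(3) by (intro finite_PiE) auto
    have cardI: "card I = (K + 1) ^ (2 * card l2)"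
      unfolding I_def using l2_sub(3) by (subst card_PiE) (auto simp: card_cartesian_product mult.commute)
    have disj: "disjoint_family_on (\<lambda>k. Q (fam (s k))) I"
    unfolding disjoint_family_on_def
    proof (intro ballI impI)
      fix k k' assume k: "k \<in> I" "k' \<in> I" "k \<noteq> k'"
      obtain x where x: "x \<in> l2 \<times> UNIV" "k x \<noteq> k' x" using k unfolding I_def by (meson PiE_ext)
      have "\<exists>i. \<kappa> * \<epsilon> \<le> \<bar>fam (s k) $ i - fam (s k') $ i\<bar>"
      proof (rule \<delta>(4))
        show "\<exists>x\<in>l2 \<times> UNIV. s k x \<noteq> s k' x" using x \<epsilon> by (intro bexI[of _ x]) (auto simp: s_def)
        show "\<epsilon> \<le> \<bar>s k y - s k' y\<bar>" if y: "y \<in> l2 \<times> UNIV" "s k y \<noteq> s k' y" for y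
        proof -
          have "k y \<noteq> k' y" using y by (auto simp: s_def)
          then have "1 \<le> \<bar>real (k y) - real (k' y)\<bar>" by linarith
          then have "\<epsilon> * 1 \<le> \<epsilon> * \<bar>real (k y) - real (k' y)\<bar>" using \<epsilon> by (intro mult_left_mono) auto
          also have "\<dots> = \<bar>\<epsilon> * (real (k y) - real (k' y))\<bar>" using \<epsilon> by (simp add: abs_mult)
          finally show ?thesis using y by (simp add: s_def right_diff_distrib)
        qed
      qed (use sb k \<epsilon> in auto)
      then obtain i where i: "\<kappa> * \<epsilon> \<le> \<bar>fam (s k) $ i - fam (s k') $ i\<bar>" by blast
      have \<kappa>: "3 * (\<rho> * \<epsilon>) \<le> \<kappa> * \<epsilon>" using mult_right_mono[OF \<rho>(2), of \<epsilon>] \<epsilon> by simp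
      have pos: "0 < \<rho> * \<epsilon>" using \<rho> \<epsilon> by simp
      show "Q (fam (s k)) \<inter> Q (fam (s k')) = {}"
      proof (rule ccontr)
        assume "\<not> ?thesis"
        then obtain y where y: "y \<in> Q (fam (s k))" "y \<in> Q (fam (s k'))" by blast
        have "\<bar>y $ i - fam (s k) $ i\<bar> \<le> \<rho> * \<epsilon>" "\<bar>y $ i - fam (s k') $ i\<bar> \<le> \<rho> * \<epsilon>"
          using Qd[OF y(1) fp(1)[OF k(1)]] Qd[OF y(2) fp(1)[OF k(2)]] by auto
        then show False using i \<kappa> pos by linarith
      qed
    qed
    have sub: "(\<Union>k\<in>I. Q (fam (s k))) \<subseteq> fibre_nbhd \<epsilon>"
    proof
      fix y assume "y \<in> (\<Union>k\<in>I. Q (fam (s k)))"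
      then obtain k where k: "k \<in> I" "y \<in> Q (fam (s k))" by blast
      note yd = Qd[OF k(2) fp(1)[OF k(1)]]
      have y: "y \<in> param_space" using yd by (auto simp: param_space_def)
      have "\<bar>p y \<alpha> - phat \<alpha>\<bar> \<le> \<epsilon>" if \<alpha>: "\<alpha> \<in> leaf_states V E" for \<alpha>
      proof -
        have "\<bar>p y \<alpha> - phat \<alpha>\<bar> = \<bar>p y \<alpha> - p (fam (s k)) \<alpha>\<bar>" using fp(2)[OF k(1)] by simp
        also have "\<dots> \<le> C * (\<Sum>i\<in>UNIV. \<bar>y $ i - fam (s k) $ i\<bar>)" by (rule C(2)[OF y fp(1)[OF k(1)] \<alpha>])
        also have "\<dots> \<le> C * (CARD('k) * (\<rho> * \<epsilon>))"
          using C(1) yd by (intro mult_left_mono sum_bounded_above) auto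
        also have "\<dots> = (C * (CARD('k) * \<rho>)) * \<epsilon>" by simp
        also have "\<dots> \<le> 1 * \<epsilon>" using \<rho>(4) \<epsilon> by (intro mult_right_mono) auto
        finally show ?thesis by simp
      qed
      then show "y \<in> fibre_nbhd \<epsilon>" using y by (simp add: fibre_nbhd_def)
    qed
    have "\<delta> ^ (2 * card l2) * \<rho> ^ CARD('k) * \<epsilon> ^ CARD('k) * (1 / \<epsilon>) ^ (2 * card l2) =
        (\<delta> / \<epsilon>) ^ (2 * card l2) * (\<rho> * \<epsilon>) ^ CARD('k)"
      by (simp add: power_divide power_mult_distrib)
    also have "\<dots> \<le> real (K + 1) ^ (2 * card l2) * (\<rho> * \<epsilon>) ^ CARD('k)"
      using K(2) \<delta>(1) \<epsilon> \<rho>(1) by (intro mult_right_mono power_mono) auto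
    also have "\<dots> = real (card I) * (\<rho> * \<epsilon>) ^ CARD('k)" by (simp only: cardI of_nat_power)
    finally have "ennreal (\<delta> ^ (2 * card l2) * \<rho> ^ CARD('k) * \<epsilon> ^ CARD('k) * (1 / \<epsilon>) ^ (2 * card l2)) \<le>
      ennreal (real (card I) * (\<rho> * \<epsilon>) ^ CARD('k))" by (rule ennreal_leI)
    also have "\<dots> = (\<Sum>k\<in>I. emeasure lborel (Q (fam (s k))))"
      using \<rho>(1) \<epsilon>(1) by (simp add: Qm ennreal_mult ennreal_of_nat_eq_real_of_nat)
    also have "\<dots> = emeasure lborel (\<Union>k\<in>I. Q (fam (s k)))"
      by (rule sum_emeasure[OF _ disj finI]) (rule image_subsetI, simp add: Q_def)
    also have "\<dots> \<le> emeasure lborel (fibre_nbhd \<epsilon>)"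
      by (rule emeasure_mono[OF sub]) (use closed_fibre_nbhd in simp)
    finally show "ennreal (\<delta> ^ (2 * card l2) * \<rho> ^ CARD('k) * \<epsilon> ^ CARD('k) * (1 / \<epsilon>) ^ (2 * card l2)) \<le> emeasure lborel (fibre_nbhd \<epsilon>)" .
  qed simp
qed

end


section \<open>The likelihood ratio\<close>

text \<open>From \<open>ln x = 2 * ln (sqrt x)\<close> and \<open>ln t \<le> t - 1\<close>. The term
  \<open>(sqrt x - 1)^2\<close> is the one in the Hellinger bound for relative entropy, and
  \<open>(x - 1)^2\<close> is at most \<open>(sqrt M + 1)^2\<close> times it.\<close>

lemma ln_le_quadratic:
  fixes x M :: real
  assumes "0 < x" "x \<le> M"
  shows "ln x \<le> (x - 1) - (x - 1) ^ 2 / (sqrt M + 1) ^ 2"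
proof -
  have s: "0 < sqrt x" "sqrt x ^ 2 = x" using assms by auto
  have "ln x = 2 * ln (sqrt x)" using assms by (simp add: ln_sqrt)
  also have "\<dots> \<le> 2 * (sqrt x - 1)" using ln_le_minus_one[OF s(1)] by simp
  also have "\<dots> = (x - 1) - (sqrt x - 1) ^ 2"
    using s(2) by (simp add: power2_diff)
  finally have 1: "ln x \<le> (x - 1) - (sqrt x - 1) ^ 2" .
  have "(x - 1) ^ 2 = (sqrt x - 1) ^ 2 * (sqrt x + 1) ^ 2"
    using s(2) by (simp flip: power_mult_distrib) (simp add: algebra_simps power2_eq_square)
  also have "\<dots> \<le> (sqrt x - 1) ^ 2 * (sqrt M + 1) ^ 2"
    using assms s by (intro mult_left_mono power_mono) auto
  finally have "(x - 1) ^ 2 \<le> (sqrt x - 1) ^ 2 * (sqrt M + 1) ^ 2" .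
  moreover have "0 < (sqrt M + 1) ^ 2" using assms by (intro zero_less_power add_nonneg_pos) auto
  ultimately have "(x - 1) ^ 2 / (sqrt M + 1) ^ 2 \<le> (sqrt x - 1) ^ 2"
    by (simp add: pos_divide_le_eq)
  then show ?thesis using 1 by linarith
qed

lemma summable_gaussian_power:
  fixes \<kappa> :: real
  assumes "0 < \<kappa>"
  shows "summable (\<lambda>k. exp (- \<kappa> * real k ^ 2) * real (k + 1) ^ d)"
proof (rule summable_comparison_test_bigo)
  show "summable (\<lambda>k. norm (1 / real k ^ 2))"
    using inverse_power_summable[of 2, where 'a = real] by (simp add: inverse_eq_divide)
  show "(\<lambda>k. exp (- \<kappa> * real k ^ 2) * real (k + 1) ^ d) \<in> O(\<lambda>k. 1 / real k ^ 2)"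
    using assms by real_asymp
qed

context fitted_model
begin

abbreviation A :: "('v \<Rightarrow> nat) set" where "A \<equiv> leaf_states V E"

lemma sum_phat: "(\<Sum>\<alpha>\<in>A. phat \<alpha>) = 1"
  using phat_model sum_p by (auto simp: markov_model_def)

lemma phat_le_1: "\<alpha> \<in> A \<Longrightarrow> phat \<alpha> \<le> 1"
  using phat_model p_le_1 by (auto simp: markov_model_def)

lemma p_phat_dist_le_1: "\<theta> \<in> param_space \<Longrightarrow> \<alpha> \<in> A \<Longrightarrow> \<bar>p \<theta> \<alpha> - phat \<alpha>\<bar> \<le> 1"
  using p_nonneg[of \<theta> \<alpha>] p_le_1[of \<theta> \<alpha>] phat_pos[of \<alpha>] phat_le_1[of \<alpha>] by (auto simp: abs_le_iff)

definition lik_ratio :: "nat \<Rightarrow> real ^ 'k \<Rightarrow> real" where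
  "lik_ratio N \<theta> = (\<Prod>\<alpha>\<in>A. (p \<theta> \<alpha> / phat \<alpha>) powr (real N * phat \<alpha>))"

lemma lik_ratio_nonneg: "0 \<le> lik_ratio N \<theta>"
  by (simp add: lik_ratio_def prod_nonneg)

lemma A_nonempty: "A \<noteq> {}"
  using sum_phat by auto

lemma phat_min:
  obtains q where "0 < q" "\<And>\<alpha>. \<alpha> \<in> A \<Longrightarrow> q \<le> phat \<alpha>"
proof -
  have "0 < Min (phat ` A)" using finite_leaf_states A_nonempty phat_pos by (subst Min_gr_iff) auto
  moreover have "Min (phat ` A) \<le> phat \<alpha>" if "\<alpha> \<in> A" for \<alpha> using finite_leaf_states that by simp
  ultimately show ?thesis using that by blast
qed

lemma lik_ratio_eq_exp:
  assumes "\<And>\<alpha>. \<alpha> \<in> A \<Longrightarrow> 0 < p \<theta> \<alpha>"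
  shows "lik_ratio N \<theta> = exp (real N * (\<Sum>\<alpha>\<in>A. phat \<alpha> * ln (p \<theta> \<alpha> / phat \<alpha>)))"
proof -
  have "lik_ratio N \<theta> = (\<Prod>\<alpha>\<in>A. exp (real N * (phat \<alpha> * ln (p \<theta> \<alpha> / phat \<alpha>))))"
    unfolding lik_ratio_def
  proof (rule prod.cong[OF refl])
    fix \<alpha> assume "\<alpha> \<in> A"
    then have "p \<theta> \<alpha> / phat \<alpha> \<noteq> 0" using assms[of \<alpha>] phat_pos[of \<alpha>] by simp
    then show "(p \<theta> \<alpha> / phat \<alpha>) powr (real N * phat \<alpha>) = exp (real N * (phat \<alpha> * ln (p \<theta> \<alpha> / phat \<alpha>)))"
      by (simp add: powr_def mult.assoc)
  qed
  then show ?thesis using finite_leaf_states by (simp add: exp_sum sum_distrib_left)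
qed

text \<open>\<open>ln_le_quadratic\<close> is applied to the ratios
  \<open>p \<theta> \<alpha> / phat \<alpha>\<close>, which are at most \<open>1 / q\<close> for a
  lower bound \<open>q\<close> of the entries of \<open>phat\<close>. The linear terms cancel in the
  sum, as both distributions have total 1.\<close>

lemma lik_ratio_upper:
  obtains \<kappa> where "0 < \<kappa>"
    "\<And>N \<theta>. 0 < N \<Longrightarrow> \<theta> \<in> param_space \<Longrightarrow> lik_ratio N \<theta> \<le> exp (- \<kappa> * (real N * (\<Sum>\<alpha>\<in>A. (p \<theta> \<alpha> - phat \<alpha>) ^ 2)))"
proof -
  obtain q where q: "0 < q" "\<And>\<alpha>. \<alpha> \<in> A \<Longrightarrow> q \<le> phat \<alpha>" by (rule phat_min, rule that; assumption)
  define \<kappa> where "\<kappa> = 1 / (sqrt (1 / q) + 1) ^ 2"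
  have \<kappa>: "0 < \<kappa>" unfolding \<kappa>_def using q(1) by (intro divide_pos_pos zero_less_power add_nonneg_pos) auto
  show ?thesis
  proof (rule that[OF \<kappa>])
    fix N :: nat and \<theta> :: "real ^ 'k" assume N: "0 < N" and \<theta>: "\<theta> \<in> param_space"
    show "lik_ratio N \<theta> \<le> exp (- \<kappa> * (real N * (\<Sum>\<alpha>\<in>A. (p \<theta> \<alpha> - phat \<alpha>) ^ 2)))"
    proof (cases "\<forall>\<alpha>\<in>A. 0 < p \<theta> \<alpha>")
      case True
      have t: "phat \<alpha> * ln (p \<theta> \<alpha> / phat \<alpha>) \<le> (p \<theta> \<alpha> - phat \<alpha>) - \<kappa> * (p \<theta> \<alpha> - phat \<alpha>) ^ 2" if \<alpha>: "\<alpha> \<in> A" for \<alpha>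
      proof -
        define x where "x = p \<theta> \<alpha> / phat \<alpha>"
        have ph: "0 < phat \<alpha>" "phat \<alpha> \<le> 1" using phat_pos[OF \<alpha>] phat_le_1[OF \<alpha>] by auto
        have px: "p \<theta> \<alpha> = phat \<alpha> * x" using ph by (simp add: x_def)
        have x: "0 < x" "x \<le> 1 / q"
          unfolding x_def using True \<alpha> ph q(1) q(2)[OF \<alpha>] p_le_1[OF \<theta> \<alpha>] by (auto intro!: frac_le)
        have "ln x \<le> (x - 1) - \<kappa> * (x - 1) ^ 2" using ln_le_quadratic[OF x] by (simp add: \<kappa>_def)
        then have "phat \<alpha> * ln x \<le> phat \<alpha> * ((x - 1) - \<kappa> * (x - 1) ^ 2)" using ph by (intro mult_left_mono) auto
        also have "\<dots> = phat \<alpha> * (x - 1) - \<kappa> * (phat \<alpha> * (x - 1) ^ 2)" by (simp add: algebra_simps)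
        also have "\<dots> \<le> phat \<alpha> * (x - 1) - \<kappa> * (phat \<alpha> ^ 2 * (x - 1) ^ 2)"
        proof -
          have "phat \<alpha> ^ 2 \<le> phat \<alpha>" using ph by (simp add: power2_eq_square mult_left_le)
          then have "phat \<alpha> ^ 2 * (x - 1) ^ 2 \<le> phat \<alpha> * (x - 1) ^ 2" by (intro mult_right_mono) auto
          then show ?thesis using \<kappa> by simp
        qed
        also have "\<dots> = (p \<theta> \<alpha> - phat \<alpha>) - \<kappa> * (p \<theta> \<alpha> - phat \<alpha>) ^ 2"
          unfolding px by (simp add: algebra_simps flip: power_mult_distrib)
        finally show ?thesis unfolding x_def .
      qed
      have "(\<Sum>\<alpha>\<in>A. phat \<alpha> * ln (p \<theta> \<alpha> / phat \<alpha>)) \<le> (\<Sum>\<alpha>\<in>A. (p \<theta> \<alpha> - phat \<alpha>) - \<kappa> * (p \<theta> \<alpha> - phat \<alpha>) ^ 2)"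
        by (rule sum_mono) (rule t)
      also have "\<dots> = - \<kappa> * (\<Sum>\<alpha>\<in>A. (p \<theta> \<alpha> - phat \<alpha>) ^ 2)"
        by (simp add: sum_subtractf sum_p sum_phat flip: sum_distrib_left)
      finally have "real N * (\<Sum>\<alpha>\<in>A. phat \<alpha> * ln (p \<theta> \<alpha> / phat \<alpha>)) \<le> real N * (- \<kappa> * (\<Sum>\<alpha>\<in>A. (p \<theta> \<alpha> - phat \<alpha>) ^ 2))"
        by (rule mult_left_mono) simp
      then show ?thesis using lik_ratio_eq_exp[of \<theta> N] True by (simp add: algebra_simps)
    next
      case False
      then obtain \<alpha> where \<alpha>: "\<alpha> \<in> A" "p \<theta> \<alpha> = 0" using p_nonneg[OF \<theta>] by (metis less_eq_real_def)
      then have "lik_ratio N \<theta> = 0" unfolding lik_ratio_def using finite_leaf_states by (intro prod_zero) (auto intro!: bexI[of _ \<alpha>])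
      then show ?thesis by simp
    qed
  qed
qed

text \<open>From \<open>ln t \<le> t - 1\<close> at
  \<open>t = phat \<alpha> / p \<theta> \<alpha>\<close>; again the linear terms cancel. A radius of
  at most \<open>q / 2\<close> keeps the denominators above \<open>q / 2\<close>, and
  \<open>N * \<epsilon>^2 \<le> 1\<close> bounds the exponent.\<close>

lemma lik_ratio_lower:
  obtains B \<epsilon>1 where "0 < \<epsilon>1" "\<And>N \<epsilon> \<theta>. 0 < \<epsilon> \<Longrightarrow> \<epsilon> \<le> \<epsilon>1 \<Longrightarrow> real N * \<epsilon> ^ 2 \<le> 1 \<Longrightarrow> \<theta> \<in> fibre_nbhd \<epsilon> \<Longrightarrow> exp (- B) \<le> lik_ratio N \<theta>"
proof -
  obtain q where q: "0 < q" "\<And>\<alpha>. \<alpha> \<in> A \<Longrightarrow> q \<le> phat \<alpha>" by (rule phat_min, rule that; assumption)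
  show ?thesis
  proof (rule that[of "q / 2" "real (card A) * (2 / q)"])
    show "0 < q / 2" using q by simp
    fix N :: nat and \<epsilon> \<theta> assume \<epsilon>: "0 < \<epsilon>" "\<epsilon> \<le> q / 2" "real N * \<epsilon> ^ 2 \<le> 1" and \<theta>: "\<theta> \<in> fibre_nbhd \<epsilon>"
    have d: "\<bar>p \<theta> \<alpha> - phat \<alpha>\<bar> \<le> \<epsilon>" if "\<alpha> \<in> A" for \<alpha> using \<theta> that by (simp add: fibre_nbhd_def)
    have pq: "q / 2 \<le> p \<theta> \<alpha>" if "\<alpha> \<in> A" for \<alpha> using d[OF that] q(2)[OF that] \<epsilon>(2) by linarith
    then have pp: "0 < p \<theta> \<alpha>" if "\<alpha> \<in> A" for \<alpha> using that q(1) by fastforce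
    have t: "(p \<theta> \<alpha> - phat \<alpha>) - \<epsilon> ^ 2 * (2 / q) \<le> phat \<alpha> * ln (p \<theta> \<alpha> / phat \<alpha>)" if \<alpha>: "\<alpha> \<in> A" for \<alpha>
    proof -
      have ph: "0 < phat \<alpha>" "0 < p \<theta> \<alpha>" using phat_pos[OF \<alpha>] pp[OF \<alpha>] by auto
      have "ln (phat \<alpha> / p \<theta> \<alpha>) \<le> phat \<alpha> / p \<theta> \<alpha> - 1" using ph by (intro ln_le_minus_one) simp
      then have "1 - phat \<alpha> / p \<theta> \<alpha> \<le> ln (p \<theta> \<alpha> / phat \<alpha>)" using ph by (simp add: ln_div)
      then have "phat \<alpha> * (1 - phat \<alpha> / p \<theta> \<alpha>) \<le> phat \<alpha> * ln (p \<theta> \<alpha> / phat \<alpha>)"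
        using ph by (intro mult_left_mono) auto
      moreover have "phat \<alpha> * (1 - phat \<alpha> / p \<theta> \<alpha>) = (p \<theta> \<alpha> - phat \<alpha>) - (p \<theta> \<alpha> - phat \<alpha>) ^ 2 * (1 / p \<theta> \<alpha>)"
        using ph by (simp add: field_simps power2_eq_square)
      moreover have "(p \<theta> \<alpha> - phat \<alpha>) ^ 2 * (1 / p \<theta> \<alpha>) \<le> \<epsilon> ^ 2 * (2 / q)"
      proof (rule mult_mono)
        show "(p \<theta> \<alpha> - phat \<alpha>) ^ 2 \<le> \<epsilon> ^ 2" using d[OF \<alpha>] \<epsilon>(1) by (simp add: abs_le_square_iff[symmetric])
        show "1 / p \<theta> \<alpha> \<le> 2 / q" using pq[OF \<alpha>] q(1) ph by (simp add: field_simps)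
      qed (use ph in auto)
      ultimately show ?thesis by linarith
    qed
    have "- (real (card A) * (2 / q)) \<le> real N * (- (real (card A) * (\<epsilon> ^ 2 * (2 / q))))"
    proof -
      have "(real (card A) * (2 / q)) * (real N * \<epsilon> ^ 2) \<le> (real (card A) * (2 / q)) * 1"
        using \<epsilon>(3) q(1) by (intro mult_left_mono) auto
      then show ?thesis by (simp add: algebra_simps)
    qed
    also have "- (real (card A) * (\<epsilon> ^ 2 * (2 / q))) = (\<Sum>\<alpha>\<in>A. (p \<theta> \<alpha> - phat \<alpha>) - \<epsilon> ^ 2 * (2 / q))"
      by (simp add: sum_subtractf sum_p sum_phat)
    also have "real N * (\<Sum>\<alpha>\<in>A. (p \<theta> \<alpha> - phat \<alpha>) - \<epsilon> ^ 2 * (2 / q)) \<le> real N * (\<Sum>\<alpha>\<in>A. phat \<alpha> * ln (p \<theta> \<alpha> / phat \<alpha>))"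
      by (intro mult_left_mono sum_mono t) auto
    finally show "exp (- (real (card A) * (2 / q))) \<le> lik_ratio N \<theta>"
      using lik_ratio_eq_exp[of \<theta> N] pp by simp
  qed
qed

lemma lik_ratio_le_1: "0 < N \<Longrightarrow> \<theta> \<in> param_space \<Longrightarrow> lik_ratio N \<theta> \<le> 1"
proof -
  assume N: "0 < N" and \<theta>: "\<theta> \<in> param_space"
  obtain \<kappa> where \<kappa>: "0 < \<kappa>" "lik_ratio N \<theta> \<le> exp (- \<kappa> * (real N * (\<Sum>\<alpha>\<in>A. (p \<theta> \<alpha> - phat \<alpha>) ^ 2)))"
    using lik_ratio_upper N \<theta> by metis
  have "0 \<le> \<kappa> * (real N * (\<Sum>\<alpha>\<in>A. (p \<theta> \<alpha> - phat \<alpha>) ^ 2))" using \<kappa>(1) by (simp add: sum_nonneg)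
  then show ?thesis using \<kappa>(2) by (smt (verit) exp_le_one_iff mult_minus_left)
qed

lemma continuous_on_lik_ratio:
  assumes "0 < N"
  shows "continuous_on param_space (lik_ratio N)"
  unfolding lik_ratio_def
proof (intro continuous_on_prod continuous_on_powr' continuous_on_const continuous_on_divide continuous_on_p)
  fix \<alpha> assume \<alpha>: "\<alpha> \<in> A"
  show "\<forall>\<theta>\<in>param_space. 0 \<le> p \<theta> \<alpha> / phat \<alpha> \<and> (p \<theta> \<alpha> / phat \<alpha> = 0 \<longrightarrow> 0 < real N * phat \<alpha>)"
    using assms phat_pos[OF \<alpha>] p_nonneg[OF _ \<alpha>] by simp
  show "\<forall>\<theta>\<in>param_space. phat \<alpha> \<noteq> 0" using phat_pos[OF \<alpha>] by simp
qed

text \<open>The log-likelihood at any point of the fibre of \<open>phat\<close>, equal to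
  \<open>- N\<close> times the entropy of \<open>phat\<close>. It is the maximum because
  \<open>lik_ratio\<close> is at most 1.\<close>

definition max_ll :: "nat \<Rightarrow> real" where
  "max_ll N = real N * (\<Sum>\<alpha>\<in>A. phat \<alpha> * ln (phat \<alpha>))"

lemma likelihood_eq:
  assumes N: "0 < N" and c: "\<And>\<alpha>. \<alpha> \<in> A \<Longrightarrow> c \<alpha> = real N * phat \<alpha>" and \<theta>: "\<theta> \<in> param_space"
  shows "likelihood A p c \<theta> = exp (max_ll N) * lik_ratio N \<theta>"
proof -
  have "likelihood A p c \<theta> = (\<Prod>\<alpha>\<in>A. exp (real N * (phat \<alpha> * ln (phat \<alpha>))) * (p \<theta> \<alpha> / phat \<alpha>) powr (real N * phat \<alpha>))"
    unfolding likelihood_def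
  proof (rule prod.cong[OF refl])
    fix \<alpha> assume \<alpha>: "\<alpha> \<in> A"
    have ph: "0 < phat \<alpha>" by (rule phat_pos[OF \<alpha>])
    have "p \<theta> \<alpha> powr (real N * phat \<alpha>) = (phat \<alpha> * (p \<theta> \<alpha> / phat \<alpha>)) powr (real N * phat \<alpha>)" using ph by simp
    also have "\<dots> = phat \<alpha> powr (real N * phat \<alpha>) * (p \<theta> \<alpha> / phat \<alpha>) powr (real N * phat \<alpha>)"
      by (rule powr_mult)
    also have "phat \<alpha> powr (real N * phat \<alpha>) = exp (real N * (phat \<alpha> * ln (phat \<alpha>)))"
      using ph by (simp add: powr_def mult.assoc)
    finally show "(if c \<alpha> = 0 then 1 else p \<theta> \<alpha> powr c \<alpha>) =
      exp (real N * (phat \<alpha> * ln (phat \<alpha>))) * (p \<theta> \<alpha> / phat \<alpha>) powr (real N * phat \<alpha>)"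
      using c[OF \<alpha>] ph N by simp
  qed
  then show ?thesis
    using finite_leaf_states by (simp add: prod.distrib lik_ratio_def max_ll_def exp_sum sum_distrib_left)
qed

lemma max_log_likelihood_eq:
  assumes N: "0 < N" and c: "\<And>\<alpha>. \<alpha> \<in> A \<Longrightarrow> c \<alpha> = real N * phat \<alpha>"
  shows "max_log_likelihood A p c = max_ll N"
proof -
  obtain \<theta>s :: "real ^ 'k" where \<theta>s: "\<theta>s \<in> param_space" "p \<theta>s = phat" using phat_model by (auto simp: markov_model_def)
  have "lik_ratio N \<theta>s = 1" unfolding lik_ratio_def \<theta>s(2) using phat_pos by (intro prod.neutral) force
  then have Ls: "likelihood A p c \<theta>s = exp (max_ll N)" using likelihood_eq[OF N c \<theta>s(1)] by simp
  have le: "ln (likelihood A p c \<theta>) \<le> max_ll N" if "\<theta> \<in> param_space" "0 < likelihood A p c \<theta>" for \<theta>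
  proof -
    have eq: "likelihood A p c \<theta> = exp (max_ll N) * lik_ratio N \<theta>" by (rule likelihood_eq[OF N c that(1)])
    have "likelihood A p c \<theta> \<le> exp (max_ll N) * 1"
      unfolding eq using lik_ratio_le_1[OF N that(1)] by (intro mult_left_mono) auto
    then show ?thesis using that(2) by (metis exp_gt_zero ln_exp ln_le_cancel_iff mult.right_neutral)
  qed
  show ?thesis
    unfolding max_log_likelihood_def
  proof (rule cSup_eq_maximum)
    show "max_ll N \<in> (\<lambda>\<theta>. ln (likelihood A p c \<theta>)) ` {\<theta> \<in> param_space. 0 < likelihood A p c \<theta>}"
      using \<theta>s(1) Ls by (intro image_eqI[of _ _ \<theta>s]) auto
  qed (use le in auto)
qed

end


section \<open>The marginal likelihood\<close>

context fitted_model
begin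

lemma param_space_eq_cbox: "(param_space :: (real ^ 'k) set) = cbox 0 1"
  by (auto simp: param_space_def mem_box_cart)

lemma compact_param_space: "compact (param_space :: (real ^ 'k) set)"
  unfolding param_space_eq_cbox by (rule compact_cbox)

definition vol :: "real \<Rightarrow> real" where "vol \<epsilon> = measure lborel (fibre_nbhd \<epsilon>)"

lemma fibre_nbhd_sets: "fibre_nbhd \<epsilon> \<in> sets lborel"
  using closed_fibre_nbhd by simp

lemma fibre_nbhd_finite: "emeasure lborel (fibre_nbhd \<epsilon>) < \<infinity>"
proof -
  have "emeasure lborel (fibre_nbhd \<epsilon>) \<le> emeasure lborel (param_space :: (real ^ 'k) set)"
    by (rule emeasure_mono) (auto simp: fibre_nbhd_def param_space_eq_cbox)
  also have "\<dots> < \<infinity>" unfolding param_space_eq_cbox by (rule emeasure_lborel_cbox_finite)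
  finally show ?thesis .
qed

lemma emeasure_fibre_nbhd: "emeasure lborel (fibre_nbhd \<epsilon>) = ennreal (vol \<epsilon>)"
  unfolding vol_def using fibre_nbhd_finite[of \<epsilon>] by (intro emeasure_eq_ennreal_measure) (simp add: less_top[symmetric])

lemma vol_ge_1: "1 \<le> \<epsilon> \<Longrightarrow> vol \<epsilon> = vol 1"
proof -
  assume "1 \<le> \<epsilon>"
  then have "fibre_nbhd \<epsilon> = fibre_nbhd 1"
    using p_phat_dist_le_1 by (fastforce simp: fibre_nbhd_def)
  then show ?thesis by (simp add: vol_def)
qed

lemma integrable_on_param_space:
  fixes f :: "real ^ 'k \<Rightarrow> real"
  assumes "continuous_on param_space f"
  shows "integrable lborel (\<lambda>\<theta>. indicator param_space \<theta> * f \<theta>)"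
  using borel_integrable_compact[OF compact_param_space assms] by simp

text \<open>The radius may exceed 1, but from there on the volume is constant. Using
  \<open>1 / \<delta>\<close> in place of the reciprocal of the radius leaves a polynomial in
  \<open>j\<close>, to be summed against Gaussian weights.\<close>

lemma vol_upper:
  obtains C where "0 < C" "\<And>j \<delta>. 0 < \<delta> \<Longrightarrow> \<delta> \<le> 1 \<Longrightarrow>
    vol (real (j + 1) * \<delta>) \<le> C * real (j + 1) ^ CARD('k) * (\<delta> ^ CARD('k) * (1 / \<delta>) ^ (2 * card l2))"
proof -
  obtain C where C: "0 < C" "\<And>\<epsilon>. 0 < \<epsilon> \<Longrightarrow> \<epsilon> \<le> 1 \<Longrightarrow>
    emeasure lborel (fibre_nbhd \<epsilon>) \<le> ennreal (C * \<epsilon> ^ CARD('k) * (1 / \<epsilon>) ^ (2 * card l2))"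
    by (rule volume_upper, rule that; assumption)
  have v: "vol \<epsilon> \<le> C * \<epsilon> ^ CARD('k) * (1 / \<epsilon>) ^ (2 * card l2)" if "0 < \<epsilon>" "\<epsilon> \<le> 1" for \<epsilon>
    using C(2)[OF that] C(1) that unfolding emeasure_fibre_nbhd by (subst (asm) ennreal_le_iff) auto
  show ?thesis
  proof (rule that[OF C(1)])
    fix j :: nat and \<delta> :: real assume \<delta>: "0 < \<delta>" "\<delta> \<le> 1"
    let ?\<epsilon> = "real (j + 1) * \<delta>"
    have inv: "1 \<le> 1 / \<delta>" using \<delta> by simp
    have e0: "0 < ?\<epsilon>" using \<delta> by simp
    have "vol ?\<epsilon> \<le> C * ?\<epsilon> ^ CARD('k) * (1 / \<delta>) ^ (2 * card l2)"
    proof (cases "?\<epsilon> \<le> 1")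
      case True
      have "\<delta> \<le> ?\<epsilon>" using \<delta> by (simp add: algebra_simps)
      then have "1 / ?\<epsilon> \<le> 1 / \<delta>" using \<delta> by (intro divide_left_mono) auto
      then have "C * ?\<epsilon> ^ CARD('k) * (1 / ?\<epsilon>) ^ (2 * card l2) \<le> C * ?\<epsilon> ^ CARD('k) * (1 / \<delta>) ^ (2 * card l2)"
        using C(1) e0 by (intro mult_left_mono power_mono) auto
      then show ?thesis using v[OF e0 True] by linarith
    next
      case False
      then have "vol ?\<epsilon> = vol 1" by (intro vol_ge_1) simp
      also have "\<dots> \<le> C" using v[of 1] by simp
      also have "\<dots> = C * 1 * 1" by simp
      also have "\<dots> \<le> C * ?\<epsilon> ^ CARD('k) * (1 / \<delta>) ^ (2 * card l2)"
        using C(1) False inv by (intro mult_mono one_le_power) auto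
      finally show ?thesis .
    qed
    then show "vol ?\<epsilon> \<le> C * real (j + 1) ^ CARD('k) * (\<delta> ^ CARD('k) * (1 / \<delta>) ^ (2 * card l2))"
      by (simp only: power_mult_distrib mult.assoc)
  qed
qed

text \<open>In the \<open>j\<close>-th shell the sum of squared deviations is at least
  \<open>j^2 / N\<close>, so the ratio is at most \<open>exp (- \<kappa> * j^2)\<close>; the shell
  lies in the neighbourhood of radius \<open>(j + 1) * \<delta>\<close>.\<close>

lemma integral_lik_ratio_upper:
  obtains C where "0 < C" "\<And>N. 0 < N \<Longrightarrow>
    (LINT \<theta>|lborel. indicator param_space \<theta> * lik_ratio N \<theta>) \<le>
      C * ((1 / sqrt (real N)) ^ CARD('k) * sqrt (real N) ^ (2 * card l2))"
proof -
  obtain C where C: "0 < C" "\<And>j \<delta>. 0 < \<delta> \<Longrightarrow> \<delta> \<le> 1 \<Longrightarrow>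
    vol (real (j + 1) * \<delta>) \<le> C * real (j + 1) ^ CARD('k) * (\<delta> ^ CARD('k) * (1 / \<delta>) ^ (2 * card l2))"
    by (rule vol_upper, rule that; assumption)
  obtain \<kappa> where \<kappa>: "0 < \<kappa>"
    "\<And>N \<theta>. 0 < N \<Longrightarrow> \<theta> \<in> param_space \<Longrightarrow> lik_ratio N \<theta> \<le> exp (- \<kappa> * (real N * (\<Sum>\<alpha>\<in>A. (p \<theta> \<alpha> - phat \<alpha>) ^ 2)))"
    by (rule lik_ratio_upper, rule that; assumption)
  let ?w = "\<lambda>j. exp (- \<kappa> * real j ^ 2) * real (j + 1) ^ CARD('k)"
  have summ: "summable ?w" by (rule summable_gaussian_power[OF \<kappa>(1)])
  show ?thesis
  proof (rule that[of "C * (1 + suminf ?w)"])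
    have "0 \<le> suminf ?w" by (rule suminf_nonneg[OF summ]) simp
    then show "0 < C * (1 + suminf ?w)" using C(1) by (intro mult_pos_pos) auto
    fix N :: nat assume N: "0 < N"
    define \<delta> where "\<delta> = 1 / sqrt (real N)"
    have sN: "0 < sqrt (real N)" "1 \<le> sqrt (real N)" using N by auto
    have \<delta>: "0 < \<delta>" "\<delta> \<le> 1" using sN by (auto simp: \<delta>_def)
    \<comment> \<open>No leaf probability deviates by more than 1, so the shells with numbers up to
      \<open>sqrt N\<close> cover the cube.\<close>
    define K where "K = nat \<lfloor>sqrt (real N)\<rfloor> + 1"
    define g where "g = \<delta> ^ CARD('k) * (1 / \<delta>) ^ (2 * card l2)"
    have pw: "indicator param_space \<theta> * lik_ratio N \<theta> \<le>
        (\<Sum>j<K. exp (- \<kappa> * real j ^ 2) * indicator (fibre_nbhd (real (j + 1) * \<delta>)) \<theta>)" for \<theta>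
    proof (cases "\<theta> \<in> param_space")
      case True
      let ?M = "Max ((\<lambda>\<alpha>. \<bar>p \<theta> \<alpha> - phat \<alpha>\<bar>) ` A)"
      have fin: "finite ((\<lambda>\<alpha>. \<bar>p \<theta> \<alpha> - phat \<alpha>\<bar>) ` A)" "(\<lambda>\<alpha>. \<bar>p \<theta> \<alpha> - phat \<alpha>\<bar>) ` A \<noteq> {}"
        using finite_leaf_states A_nonempty by auto
      obtain \<alpha> where \<alpha>: "\<alpha> \<in> A" "?M = \<bar>p \<theta> \<alpha> - phat \<alpha>\<bar>" using Max_in[OF fin] by auto
      have M: "\<bar>p \<theta> \<alpha>' - phat \<alpha>'\<bar> \<le> ?M" if "\<alpha>' \<in> A" for \<alpha>' using fin(1) that by (intro Max_ge) auto
      have M01: "0 \<le> ?M" "?M \<le> 1" using \<alpha> p_phat_dist_le_1[OF True \<alpha>(1)] by auto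
      define j where "j = nat \<lfloor>sqrt (real N) * ?M\<rfloor>"
      have j: "real j \<le> sqrt (real N) * ?M" "sqrt (real N) * ?M \<le> real (j + 1)"
        unfolding j_def using M01 sN by (auto simp: of_nat_floor) linarith
      have "sqrt (real N) * ?M \<le> sqrt (real N)" using M01 sN by (simp add: mult_left_le)
      then have jK: "j < K" unfolding j_def K_def by (simp add: floor_mono nat_mono less_Suc_eq_le)
      have "?M \<le> real (j + 1) * \<delta>" using j(2) sN by (simp add: \<delta>_def field_simps)
      then have nb: "\<theta> \<in> fibre_nbhd (real (j + 1) * \<delta>)" using M True by (auto simp: fibre_nbhd_def intro: order_trans)
      have "real j ^ 2 \<le> (sqrt (real N) * ?M) ^ 2" using j(1) by (intro power_mono) auto
      also have "\<dots> = real N * (p \<theta> \<alpha> - phat \<alpha>) ^ 2" by (simp add: power_mult_distrib \<alpha>(2))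
      also have "\<dots> \<le> real N * (\<Sum>\<alpha>\<in>A. (p \<theta> \<alpha> - phat \<alpha>) ^ 2)"
        using member_le_sum[OF \<alpha>(1), of "\<lambda>\<alpha>. (p \<theta> \<alpha> - phat \<alpha>) ^ 2"] finite_leaf_states by (intro mult_left_mono) auto
      finally have "\<kappa> * real j ^ 2 \<le> \<kappa> * (real N * (\<Sum>\<alpha>\<in>A. (p \<theta> \<alpha> - phat \<alpha>) ^ 2))"
        using \<kappa>(1) by (intro mult_left_mono) auto
      then have "lik_ratio N \<theta> \<le> exp (- \<kappa> * real j ^ 2)"
        using \<kappa>(2)[OF N True] by (elim order_trans) simp
      also have "\<dots> = exp (- \<kappa> * real j ^ 2) * indicator (fibre_nbhd (real (j + 1) * \<delta>)) \<theta>" using nb by simp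
      also have "\<dots> \<le> (\<Sum>j<K. exp (- \<kappa> * real j ^ 2) * indicator (fibre_nbhd (real (j + 1) * \<delta>)) \<theta>)"
        by (rule member_le_sum[of j "{..<K}" "\<lambda>j. exp (- \<kappa> * real j ^ 2) * indicator (fibre_nbhd (real (j + 1) * \<delta>)) \<theta>"])
          (use jK in auto)
      finally show ?thesis using True by simp
    qed (auto intro!: sum_nonneg)
    have int: "integrable lborel (\<lambda>\<theta>. exp (- \<kappa> * real j ^ 2) * indicator (fibre_nbhd (real (j + 1) * \<delta>)) \<theta> :: real)" for j
      using fibre_nbhd_finite fibre_nbhd_sets by (intro integrable_mult_right integrable_real_indicator) auto
    have "(LINT \<theta>|lborel. indicator param_space \<theta> * lik_ratio N \<theta>) \<le>
        (LINT \<theta>|lborel. (\<Sum>j<K. exp (- \<kappa> * real j ^ 2) * indicator (fibre_nbhd (real (j + 1) * \<delta>)) \<theta>))"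
      by (intro integral_mono integrable_on_param_space continuous_on_lik_ratio N Bochner_Integration.integrable_sum int pw)
    also have "\<dots> = (\<Sum>j<K. exp (- \<kappa> * real j ^ 2) * vol (real (j + 1) * \<delta>))"
      using int by (subst Bochner_Integration.integral_sum) (auto simp: vol_def)
    also have "\<dots> \<le> (\<Sum>j<K. exp (- \<kappa> * real j ^ 2) * (C * real (j + 1) ^ CARD('k) * g))"
      unfolding g_def by (intro sum_mono mult_left_mono C(2) \<delta>) auto
    also have "\<dots> = C * (\<Sum>j<K. ?w j) * g"
      by (simp add: sum_distrib_left sum_distrib_right mult_ac)
    also have "\<dots> \<le> C * (1 + suminf ?w) * g"
    proof -
      have "(\<Sum>j<K. ?w j) \<le> suminf ?w" by (rule sum_le_suminf[OF summ]) auto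
      then show ?thesis using C(1) \<delta> by (intro mult_right_mono mult_left_mono) (auto simp: g_def)
    qed
    finally show "(LINT \<theta>|lborel. indicator param_space \<theta> * lik_ratio N \<theta>) \<le>
      C * (1 + suminf ?w) * ((1 / sqrt (real N)) ^ CARD('k) * sqrt (real N) ^ (2 * card l2))"
      by (simp add: g_def \<delta>_def)
  qed
qed

end

lemma smooth_near_continuous_on: "smooth_near S f \<Longrightarrow> continuous_on S f"
proof -
  assume "smooth_near S f"
  then obtain U g where g: "S \<subseteq> U" "Ck_on 0 U g" "\<And>x. x \<in> S \<Longrightarrow> g x = f x" unfolding smooth_near_def by blast
  then have "continuous_on S g" using continuous_on_subset[of U g S] by simp
  then show ?thesis using g(3) by (simp cong: continuous_on_cong)
qed

context fibre_point
begin

text \<open>On the neighbourhood of radius \<open>1 / sqrt N\<close> the ratio is bounded below by a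
  constant, and \<open>volume_lower\<close> gives its volume.\<close>

lemma integral_lik_ratio_lower:
  obtains C N1 where "0 < C" "0 < N1" "\<And>N. N1 \<le> N \<Longrightarrow>
    C * ((1 / sqrt (real N)) ^ CARD('k) * sqrt (real N) ^ (2 * card l2)) \<le>
    (LINT \<theta>|lborel. indicator param_space \<theta> * lik_ratio N \<theta>)"
proof -
  obtain C \<epsilon>0 where C: "0 < C" "0 < \<epsilon>0" "\<And>\<epsilon>. 0 < \<epsilon> \<Longrightarrow> \<epsilon> \<le> \<epsilon>0 \<Longrightarrow>
    ennreal (C * \<epsilon> ^ CARD('k) * (1 / \<epsilon>) ^ (2 * card l2)) \<le> emeasure lborel (fibre_nbhd \<epsilon>)"
    by (rule volume_lower, rule that; assumption)
  obtain B \<epsilon>1 where B: "0 < \<epsilon>1" "\<And>N \<epsilon> \<theta>. 0 < \<epsilon> \<Longrightarrow> \<epsilon> \<le> \<epsilon>1 \<Longrightarrow> real N * \<epsilon> ^ 2 \<le> 1 \<Longrightarrow> \<theta> \<in> fibre_nbhd \<epsilon> \<Longrightarrow> exp (- B) \<le> lik_ratio N \<theta>"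
    by (rule lik_ratio_lower, rule that; assumption)
  define e where "e = min \<epsilon>0 \<epsilon>1"
  have e: "0 < e" "e \<le> \<epsilon>0" "e \<le> \<epsilon>1" using C B by (auto simp: e_def)
  \<comment> \<open>From here on \<open>1 / sqrt N\<close> is at most \<open>e\<close>.\<close>
  obtain N1 :: nat where N1: "1 / e ^ 2 \<le> real N1" using real_arch_simple by blast
  show ?thesis
  proof (rule that[of "exp (- B) * C" "Suc N1"])
    show "0 < exp (- B) * C" using C by simp
    fix N assume N: "Suc N1 \<le> N"
    then have N0: "0 < N" by simp
    define \<delta> where "\<delta> = 1 / sqrt (real N)"
    have d0: "0 < \<delta>" using N0 by (simp add: \<delta>_def)
    have "1 / e ^ 2 \<le> real N" using N1 N by linarith
    then have "sqrt (1 / e ^ 2) \<le> sqrt (real N)" by simp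
    then have "1 / e \<le> sqrt (real N)" using e(1) by (simp add: real_sqrt_divide)
    then have de: "\<delta> \<le> e" using e(1) N0 by (simp add: \<delta>_def field_simps)
    have dN: "real N * \<delta> ^ 2 \<le> 1" using N0 by (simp add: \<delta>_def power_divide)
    have "C * \<delta> ^ CARD('k) * (1 / \<delta>) ^ (2 * card l2) \<le> vol \<delta>"
      using C(3)[OF d0 order_trans[OF de e(2)]] unfolding emeasure_fibre_nbhd by (simp add: vol_def)
    then have "exp (- B) * (C * \<delta> ^ CARD('k) * (1 / \<delta>) ^ (2 * card l2)) \<le> exp (- B) * vol \<delta>"
      by (intro mult_left_mono) auto
    also have "\<dots> = (LINT \<theta>|lborel. exp (- B) * indicator (fibre_nbhd \<delta>) \<theta>)"
      by (simp add: vol_def)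
    also have "\<dots> \<le> (LINT \<theta>|lborel. indicator param_space \<theta> * lik_ratio N \<theta>)"
    proof (rule integral_mono)
      show "integrable lborel (\<lambda>\<theta>. exp (- B) * indicator (fibre_nbhd \<delta>) \<theta> :: real)"
        using fibre_nbhd_finite fibre_nbhd_sets by (intro integrable_mult_right integrable_real_indicator) auto
      show "integrable lborel (\<lambda>\<theta>. indicator param_space \<theta> * lik_ratio N \<theta>)"
        by (intro integrable_on_param_space continuous_on_lik_ratio N0)
      fix \<theta> :: "real ^ 'k"
      show "exp (- B) * indicator (fibre_nbhd \<delta>) \<theta> \<le> indicator param_space \<theta> * lik_ratio N \<theta>"
      proof (cases "\<theta> \<in> fibre_nbhd \<delta>")
        case True
        moreover have "\<theta> \<in> param_space" using True by (simp add: fibre_nbhd_def)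
        moreover have "exp (- B) \<le> lik_ratio N \<theta>" using B(2)[OF d0 _ dN True] de e(3) by simp
        ultimately show ?thesis by simp
      qed (simp add: lik_ratio_nonneg)
    qed
    finally show "exp (- B) * C * ((1 / sqrt (real N)) ^ CARD('k) * sqrt (real N) ^ (2 * card l2)) \<le>
      (LINT \<theta>|lborel. indicator param_space \<theta> * lik_ratio N \<theta>)"
      by (simp add: \<delta>_def mult.assoc)
  qed simp
qed

text \<open>The prior lies between its positive minimum and its maximum on the compact cube, so it
  changes the logarithm of the integral by a bounded amount.\<close>

lemma marginal_likelihood_asymptotics:
  fixes \<phi> :: "real ^ 'k \<Rightarrow> real"
  assumes counts: "\<And>N \<alpha>. N0 < N \<Longrightarrow> \<alpha> \<in> A \<Longrightarrow> counts N \<alpha> = real N * phat \<alpha>"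
    and pos: "\<And>\<theta>. \<theta> \<in> param_space \<Longrightarrow> \<phi> \<theta> > 0" and cont: "continuous_on param_space \<phi>"
  shows "(\<lambda>N. ln (marginal_likelihood A p \<phi> (counts N)) - (max_log_likelihood A p (counts N)
     - (real (card V) + real (card E) - 2 * real (card l2)) / 2 * ln (real N))) \<in> O(\<lambda>_. 1)"
proof -
  obtain C1 where C1: "0 < C1" "\<And>N. 0 < N \<Longrightarrow> (LINT \<theta>|lborel. indicator param_space \<theta> * lik_ratio N \<theta>) \<le>
      C1 * ((1 / sqrt (real N)) ^ CARD('k) * sqrt (real N) ^ (2 * card l2))"
    by (rule integral_lik_ratio_upper, rule that; assumption)
  obtain C2 N1 where C2: "0 < C2" "0 < N1" "\<And>N. N1 \<le> N \<Longrightarrow>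
    C2 * ((1 / sqrt (real N)) ^ CARD('k) * sqrt (real N) ^ (2 * card l2)) \<le>
    (LINT \<theta>|lborel. indicator param_space \<theta> * lik_ratio N \<theta>)"
    by (rule integral_lik_ratio_lower, rule that; assumption)
  have ne: "(param_space :: (real ^ 'k) set) \<noteq> {}" using \<theta>s(1) by blast
  obtain x where x: "x \<in> param_space" "\<And>\<theta>. \<theta> \<in> param_space \<Longrightarrow> \<phi> x \<le> \<phi> \<theta>"
    using continuous_attains_inf[OF compact_param_space ne cont] by blast
  obtain y where y: "y \<in> param_space" "\<And>\<theta>. \<theta> \<in> param_space \<Longrightarrow> \<phi> \<theta> \<le> \<phi> y"
    using continuous_attains_sup[OF compact_param_space ne cont] by blast
  have ab: "0 < \<phi> x" "0 < \<phi> y" using pos x y by auto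
  define Z where "Z N = (LINT \<theta>|lborel. indicator param_space \<theta> * (lik_ratio N \<theta> * \<phi> \<theta>))" for N
  \<comment> \<open>The volume of the neighbourhood of radius \<open>1 / sqrt N\<close> up to
    constants; \<open>ln (G N)\<close> is exactly the \<open>ln N\<close> term of the
    theorem.\<close>
  define G where "G N = (1 / sqrt (real N)) ^ CARD('k) * sqrt (real N) ^ (2 * card l2)" for N
  have Zb: "\<phi> x * C2 * G N \<le> Z N" "Z N \<le> \<phi> y * C1 * G N" if N: "N1 \<le> N" for N
  proof -
    have N0: "0 < N" using N C2(2) by simp
    let ?I = "LINT \<theta>|lborel. indicator param_space \<theta> * lik_ratio N \<theta>"
    have int: "integrable lborel (\<lambda>\<theta>. indicator param_space \<theta> * lik_ratio N \<theta>)"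
      by (intro integrable_on_param_space continuous_on_lik_ratio N0)
    have int': "integrable lborel (\<lambda>\<theta>. indicator param_space \<theta> * (lik_ratio N \<theta> * \<phi> \<theta>))"
      by (intro integrable_on_param_space continuous_on_mult continuous_on_lik_ratio N0 cont)
    have pw: "\<phi> x * (indicator param_space \<theta> * lik_ratio N \<theta>) \<le> indicator param_space \<theta> * (lik_ratio N \<theta> * \<phi> \<theta>)"
      "indicator param_space \<theta> * (lik_ratio N \<theta> * \<phi> \<theta>) \<le> \<phi> y * (indicator param_space \<theta> * lik_ratio N \<theta>)" for \<theta>
      using mult_left_mono[OF x(2) lik_ratio_nonneg, of \<theta> N \<theta>] mult_left_mono[OF y(2) lik_ratio_nonneg, of \<theta> N \<theta>]
      by (cases "\<theta> \<in> param_space"; simp add: mult.commute)+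
    have "\<phi> x * C2 * G N = \<phi> x * (C2 * G N)" by simp
    also have "\<dots> \<le> \<phi> x * ?I" using C2(3)[OF N] ab(1) unfolding G_def by (intro mult_left_mono) auto
    also have "\<dots> = (LINT \<theta>|lborel. \<phi> x * (indicator param_space \<theta> * lik_ratio N \<theta>))" by simp
    also have "\<dots> \<le> Z N" unfolding Z_def by (intro integral_mono integrable_mult_right int int' pw)
    finally show "\<phi> x * C2 * G N \<le> Z N" .
    have "Z N \<le> (LINT \<theta>|lborel. \<phi> y * (indicator param_space \<theta> * lik_ratio N \<theta>))"
      unfolding Z_def by (intro integral_mono integrable_mult_right int int' pw)
    also have "\<dots> = \<phi> y * ?I" by simp
    also have "\<dots> \<le> \<phi> y * (C1 * G N)" using C1(2)[OF N0] ab(2) unfolding G_def by (intro mult_left_mono) auto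
    finally show "Z N \<le> \<phi> y * C1 * G N" by simp
  qed
  have ml: "marginal_likelihood A p \<phi> (counts N) = exp (max_ll N) * Z N" if N: "N0 < N" for N
  proof -
    have c: "counts N \<alpha> = real N * phat \<alpha>" if "\<alpha> \<in> A" for \<alpha> by (rule counts[OF N that])
    have "marginal_likelihood A p \<phi> (counts N) =
        (LINT \<theta>|lborel. exp (max_ll N) * (indicator param_space \<theta> * (lik_ratio N \<theta> * \<phi> \<theta>)))"
      unfolding marginal_likelihood_def set_lebesgue_integral_def
    proof (rule Bochner_Integration.integral_cong[OF refl])
      fix \<theta> :: "real ^ 'k"
      show "indicator param_space \<theta> *\<^sub>R (likelihood A p (counts N) \<theta> * \<phi> \<theta>) =
        exp (max_ll N) * (indicator param_space \<theta> * (lik_ratio N \<theta> * \<phi> \<theta>))"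
      proof (cases "\<theta> \<in> param_space")
        case True
        have "likelihood A p (counts N) \<theta> = exp (max_ll N) * lik_ratio N \<theta>"
          by (rule likelihood_eq[OF _ c True]) (use N in auto)
        then show ?thesis using True by simp
      qed simp
    qed
    then show ?thesis by (simp add: Z_def)
  qed
  define X where "X N = ln (marginal_likelihood A p \<phi> (counts N)) - (max_log_likelihood A p (counts N)
     - (real (card V) + real (card E) - 2 * real (card l2)) / 2 * ln (real N))" for N
  have bound: "ln (\<phi> x * C2) \<le> X N \<and> X N \<le> ln (\<phi> y * C1)" if N: "Suc N0 + N1 \<le> N" for N
  proof -
    have N': "0 < N" "N0 < N" "N1 \<le> N" using N by auto
    have G: "0 < G N" using N' by (simp add: G_def)
    have lo: "0 < \<phi> x * C2" and hi: "0 < \<phi> y * C1" using ab C1 C2 by auto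
    have "0 < \<phi> x * C2 * G N" using lo G by simp
    then have Zp: "0 < Z N" using Zb(1)[OF N'(3)] by linarith
    have "max_log_likelihood A p (counts N) = max_ll N"
      by (rule max_log_likelihood_eq) (use N' counts in auto)
    moreover have "ln (marginal_likelihood A p \<phi> (counts N)) = max_ll N + ln (Z N)"
      unfolding ml[OF N'(2)] using Zp by (simp add: ln_mult)
    moreover have "ln (G N) = - ((real (card V) + real (card E) - 2 * real (card l2)) / 2 * ln (real N))"
    proof -
      have "ln (G N) = real CARD('k) * ln (1 / sqrt (real N)) + real (2 * card l2) * ln (sqrt (real N))"
        unfolding G_def using N'(1) by (simp add: ln_mult ln_realpow)
      also have "ln (1 / sqrt (real N)) = - (ln (real N) / 2)" using N'(1) by (simp add: ln_div ln_sqrt)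
      also have "ln (sqrt (real N)) = ln (real N) / 2" using N'(1) by (simp add: ln_sqrt)
      finally show ?thesis by (simp add: card_param algebra_simps add_divide_distrib diff_divide_distrib)
    qed
    ultimately have X: "X N = ln (Z N) - ln (G N)" by (simp add: X_def)
    have "ln (\<phi> x * C2) + ln (G N) \<le> ln (Z N)"
      using Zb(1)[OF N'(3)] lo G Zp ln_mult_pos[OF lo G] by (metis ln_le_cancel_iff mult_pos_pos)
    moreover have "ln (Z N) \<le> ln (\<phi> y * C1) + ln (G N)"
      using Zb(2)[OF N'(3)] hi G Zp ln_mult_pos[OF hi G] by (metis ln_le_cancel_iff mult_pos_pos)
    ultimately show ?thesis unfolding X by linarith
  qed
  have "X \<in> O(\<lambda>_. 1)"
  proof (rule bigoI)
    show "\<forall>\<^sub>F N in sequentially. norm (X N) \<le> (\<bar>ln (\<phi> x * C2)\<bar> + \<bar>ln (\<phi> y * C1)\<bar>) * norm (1 :: real)"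
      using eventually_ge_at_top[of "Suc N0 + N1"]
    proof eventually_elim
      case (elim N)
      then show ?case using bound[OF elim] by auto
    qed
  qed
  then show ?thesis unfolding X_def .
qed

end

theorem theorem1p1:
  fixes V :: "'v set" and E :: "('v \<times> 'v) set" and r :: 'v
    and coord :: "'v param \<Rightarrow> 'k::finite"
    and \<phi> :: "real ^ 'k \<Rightarrow> real"
    and counts :: "nat \<Rightarrow> ('v \<Rightarrow> nat) \<Rightarrow> real"
    and phat :: "('v \<Rightarrow> nat) \<Rightarrow> real"
  assumes tree: "rooted_tree V E r"
    and coord: "bij_betw coord (param_index V r) UNIV"
    and counts: "\<And>N. is_counts (leaf_states V E) N (counts N)"
    and prior_density: "set_lebesgue_integral lborel param_space \<phi> = 1"
    and A1_pos: "\<And>\<theta>. \<theta> \<in> param_space \<Longrightarrow> \<phi> \<theta> > 0"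
    and A1_bounded: "bounded (\<phi> ` param_space)"
    and A1_smooth: "smooth_near param_space \<phi>"
    and A2_stable: "\<exists>N0. \<forall>N > N0. sample_proportions (leaf_states V E) N (counts N) = phat"
    and A2_model: "phat \<in> markov_model V E r coord"
    and A2_pos: "\<And>\<alpha>. \<alpha> \<in> leaf_states V E \<Longrightarrow> phat \<alpha> > 0"
    and boundary: "nondeterministic_at_l2_nodes V E r coord phat"
    and no_degenerate: "\<nexists>v. degenerate_node V E phat v"
  shows "(\<lambda>N. ln (marginal_likelihood (leaf_states V E) (tree_map V E r coord) \<phi> (counts N))
            - (max_log_likelihood (leaf_states V E) (tree_map V E r coord) (counts N)
               - (real (card V) + real (card E) - 2 * real (card (l2_nodes V E phat))) / 2
                 * ln (real N)))
         \<in> O(\<lambda>_. 1)"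
proof -
  interpret fitted_model V E r coord phat
    by unfold_locales (fact tree coord A2_model A2_pos no_degenerate)+
  \<comment> \<open>The family is built around the representation given by \<open>boundary\<close>,
    whose transitions at \<open>l2\<close> nodes can be moved in both directions.\<close>
  obtain \<theta>s where \<theta>s: "\<theta>s \<in> param_space" "p \<theta>s = phat"
    and int: "\<forall>(u, w) \<in> E. u \<in> l2 \<or> w \<in> l2 \<longrightarrow> (\<forall>i \<in> {0, 1}. 0 < tp \<theta>s w i \<and> tp \<theta>s w i < 1)"
    using boundary unfolding nondeterministic_at_l2_nodes_def by blast
  define good where "good v e1 e2 \<longleftrightarrow> e1 \<in> inc v \<and> e2 \<in> inc v \<and> e1 \<noteq> e2 \<and> parent E e1 = v \<and>
      cov \<theta>s e1 (parent E e1) \<noteq> 0 \<and> cov \<theta>s e2 (parent E e2) \<noteq> 0 \<and>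
      (\<forall>w\<in>inc v. w \<noteq> e1 \<longrightarrow> w \<noteq> e2 \<longrightarrow> cov \<theta>s w (parent E w) = 0)" for v e1 e2
  \<comment> \<open>The two live edges are put into a pair so that one choice function yields
    both.\<close>
  have "\<forall>v\<in>l2. \<exists>ee. good v (fst ee) (snd ee)"
  proof
    fix v assume "v \<in> l2"
    then obtain a b where "good v a b"
      by (rule l2_live_edges[OF \<theta>s], intro that) (unfold good_def, blast)
    then show "\<exists>ee. good v (fst ee) (snd ee)" by (intro exI[of _ "(a, b)"]) simp
  qed
  then obtain ee where ee: "\<forall>v\<in>l2. good v (fst (ee v)) (snd (ee v))" by (rule bchoice[THEN exE])
  interpret fibre_point V E r coord phat \<theta>s "\<lambda>v. fst (ee v)" "\<lambda>v. snd (ee v)"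
  proof unfold_locales
    show "0 < tp \<theta>s w a \<and> tp \<theta>s w a < 1" if "w \<in> V - {r}" "a \<in> {0, 1}" "w \<in> l2 \<or> parent E w \<in> l2" for w a
      using int parent_edge[OF that(1)] that(2,3) by blast
  qed (use \<theta>s ee in \<open>auto simp: good_def\<close>)
  obtain N0 where N0: "\<And>N. N0 < N \<Longrightarrow> sample_proportions (leaf_states V E) N (counts N) = phat"
    using A2_stable by blast
  \<comment> \<open>\<open>N0 < N\<close> makes \<open>N\<close> positive, so the proportions can be
    multiplied out.\<close>
  have "counts N \<alpha> = real N * phat \<alpha>" if "N0 < N" "\<alpha> \<in> leaf_states V E" for N \<alpha>
    using fun_cong[OF N0[OF that(1)], of \<alpha>] that by (auto simp: sample_proportions_def field_simps)
  then show ?thesis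
    by (rule marginal_likelihood_asymptotics) (use A1_pos smooth_near_continuous_on[OF A1_smooth] in auto)
qed

end
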